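(* Consider the one-dimensional Quantum Langevin Dynamics with the quadratic potential $V(x)=\frac12m\Omega^2x^2$ and constant parameters $\eta,\hbar,m,\Omega,k,T$. Put $$D=\frac{4}{m^2}\mu^2\hbar^2+4(\Omega^2+2\eta^2)\nu^2\hbar^2.$$ Then $$\langle x^2\rangle_t=e^{-2\eta t}\left(A+\tilde B\cos(2\Omega t)+\tilde C\sin(2\Omega t)\right)+\frac{D}{8\eta(\Omega^2+\eta^2)},$$ $$\left\langle\frac{p^2}{m^2}\right\rangle_t=e^{-2\eta t}\left(A\Omega^2-\Omega^2\tilde B\cos(2\Omega t)-\Omega^2\tilde C\sin(2\Omega t)\right)+\frac{(2\eta^2+\Omega^2)D}{8\eta(\Omega^2+\eta^2)}-2\hbar^2\nu^2\eta,$$ where $A,\tilde B,\tilde C\in\mathbb{R}$ are constants determined by the initial condition of the system. In particular the convergence rate of $\langle V\rangle_t=\frac12m\Omega^2\langle x^2\rangle_t$ is $O(e^{-2\eta t})$. As $t\to+\infty$, $$\langle V\rangle_t\to\frac12m\Omega^2\frac{D}{8\eta(\Omega^2+\eta^2)},\qquad\left\langle\frac{p^2}{2m}\right\rangle_t\to\frac{m(2\eta^2+\Omega^2)D}{16\eta(\Omega^2+\eta^2)}-m\hbar^2\nu^2\eta,$$ and when $T\to0$ and $t\to+\infty$, $\langle V\rangle_t\to\frac14\hbar\Omega$ and $\left\langle\frac{p^2}{2m}\right\rangle_t\to\frac14\hbar\Omega$. The system always reaches the ground state of the harmonic oscillator, with ground state energy $\frac12\hbar\Omega$, if $T\to0$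 when $t\to+\infty$, no matter what the initial density matrix $\rho(0)$ is.
   Context: One-dimensional Quantum Langevin Dynamics: $x$ and $p=-\mathrm i\hbar\frac{\mathrm d}{\mathrm dx}$ are the position and momentum operators, $H=\frac{p^2}{2m}+V(x)$, and the density matrix $\rho(t)$ evolves by the Lindblad equation $$\frac{\mathrm d\rho}{\mathrm dt}=-\frac{\mathrm i}{\hbar}[H,\rho]+2L\rho L^\dagger-L^\dagger L\rho-\rho L^\dagger L,\qquad L=\mu x+\mathrm i\nu p,\quad L^\dagger=\mu x-\mathrm i\nu p,$$ with $$\mu^2=\frac{\eta m\Omega}{2\hbar}\coth\left(\frac{\hbar\Omega}{4kT}\right),\qquad\nu^2=\frac{\eta}{2\hbar m\Omega}\tanh\left(\frac{\hbar\Omega}{4kT}\right),\qquad2\mu\nu\hbar=\eta.$$ Here $m$ is the mass, $\Omega$ the frequency (the same $\Omega$ as in the potential), $k$ the Boltzmann constant, $T$ the temperature, $\eta>0$ the characteristic damping rate. $\langle O\rangle_t=\mathrm{Tr}(\rho(t)O)$. With this potential, $H$ is the Hamiltonian of a harmonic oscillator with energy levels $(\frac12+j)\hbar\Omega$, $j=0,1,\dots$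
   Formalization: The initial density matrix ρ(0) is assumed to have finite energy (Tr(ρ(0)H) exists); for other ρ(0) the averages of x² and p² are infinite, so the formulas and the energy limits fail. *)

theory Defs
  imports "HOL-Analysis.Analysis" "HOL-Library.Landau_Symbols"
begin

section \<open>The Hilbert space of square-integrable functions and Schwartz functions\<close>

text \<open>Elements of the Hilbert space are represented by functions; operators on it are only
  meaningful up to equality almost everywhere.\<close>

definition L2 :: "(real \<Rightarrow> complex) set" where
  "L2 = {f. f \<in> borel_measurable borel \<and> integrable lborel (\<lambda>x. (norm (f x))\<^sup>2)}"

definition l2_inner :: "(real \<Rightarrow> complex) \<Rightarrow> (real \<Rightarrow> complex) \<Rightarrow> complex" where
  "l2_inner f g = (LINT x|lborel. cnj (f x) * g x)"

definition l2_norm :: "(real \<Rightarrow> complex) \<Rightarrow> real" where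
  "l2_norm f = sqrt (LINT x|lborel. (norm (f x))\<^sup>2)"

definition ddx :: "(real \<Rightarrow> complex) \<Rightarrow> (real \<Rightarrow> complex)" where
  "ddx f = (\<lambda>x. vector_derivative f (at x))"

definition schwartz :: "(real \<Rightarrow> complex) set" where
  "schwartz = {f. (\<forall>k x. (ddx ^^ k) f differentiable at x) \<and>
                  (\<forall>j k. bounded (range (\<lambda>x. complex_of_real (x ^ j) * (ddx ^^ k) f x)))}"


section \<open>Position, momentum, Hamiltonian and jump operator\<close>

text \<open>All of these are differential operators with polynomial coefficients; the Schwartz
  space is their common invariant domain.\<close>

type_synonym qop = "(real \<Rightarrow> complex) \<Rightarrow> (real \<Rightarrow> complex)"

definition position :: qop where
  "position f = (\<lambda>x. complex_of_real x * f x)"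

definition momentum :: "real \<Rightarrow> qop" where
  "momentum hbar f = (\<lambda>x. - \<i> * complex_of_real hbar * ddx f x)"

definition potential :: "(real \<Rightarrow> real) \<Rightarrow> qop" where
  "potential V f = (\<lambda>x. complex_of_real (V x) * f x)"

definition scale_op :: "real \<Rightarrow> qop \<Rightarrow> qop" where
  "scale_op c A f = (\<lambda>x. complex_of_real c * A f x)"

definition add_op :: "qop \<Rightarrow> qop \<Rightarrow> qop" where
  "add_op A B f = (\<lambda>x. A f x + B f x)"

definition kinetic :: "real \<Rightarrow> real \<Rightarrow> qop" where
  "kinetic hbar m = scale_op (1 / (2 * m)) (momentum hbar \<circ> momentum hbar)"

definition hamiltonian :: "real \<Rightarrow> real \<Rightarrow> (real \<Rightarrow> real) \<Rightarrow> qop" where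
  "hamiltonian hbar m V = add_op (kinetic hbar m) (potential V)"

definition harmonic :: "real \<Rightarrow> real \<Rightarrow> real \<Rightarrow> real" where
  "harmonic m \<Omega> x = 1 / 2 * m * \<Omega>\<^sup>2 * x\<^sup>2"

definition jump :: "real \<Rightarrow> real \<Rightarrow> real \<Rightarrow> qop" where
  "jump hbar \<mu> \<nu> f =
     (\<lambda>x. complex_of_real \<mu> * position f x + \<i> * complex_of_real \<nu> * momentum hbar f x)"

definition jump_adj :: "real \<Rightarrow> real \<Rightarrow> real \<Rightarrow> qop" where
  "jump_adj hbar \<mu> \<nu> f =
     (\<lambda>x. complex_of_real \<mu> * position f x - \<i> * complex_of_real \<nu> * momentum hbar f x)"


section \<open>Trace, expectation and density operators\<close>

text \<open>The eigenfunctions of the harmonic oscillator, generated from the Gaussian by the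
  creation operator. They form an orthonormal basis of the Hilbert space consisting of
  Schwartz functions.\<close>

definition creation :: "real \<Rightarrow> real \<Rightarrow> real \<Rightarrow> qop" where
  "creation hbar m \<Omega> f =
     (\<lambda>x. complex_of_real (sqrt (m * \<Omega> / (2 * hbar))) *
           (position f x - \<i> / complex_of_real (m * \<Omega>) * momentum hbar f x))"

primrec qho_basis :: "real \<Rightarrow> real \<Rightarrow> real \<Rightarrow> nat \<Rightarrow> (real \<Rightarrow> complex)" where
  "qho_basis hbar m \<Omega> 0 =
     (\<lambda>x. complex_of_real ((m * \<Omega> / (pi * hbar)) powr (1 / 4) *
                             exp (- (m * \<Omega> * x\<^sup>2) / (2 * hbar))))"
| "qho_basis hbar m \<Omega> (Suc n) =
     (\<lambda>x. complex_of_real (1 / sqrt (real (Suc n))) *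
           creation hbar m \<Omega> (qho_basis hbar m \<Omega> n) x)"

text \<open>The trace is the sum of the diagonal matrix elements. For a trace class operator it does
  not depend on the orthonormal basis; since it is also applied to products of a density operator
  with an unbounded observable, it is taken in a basis on which every polynomial in position and
  momentum is defined.\<close>

definition has_trace :: "real \<Rightarrow> real \<Rightarrow> real \<Rightarrow> qop \<Rightarrow> complex \<Rightarrow> bool" where
  "has_trace hbar m \<Omega> A z \<longleftrightarrow>
     ((\<lambda>n. l2_inner (qho_basis hbar m \<Omega> n) (A (qho_basis hbar m \<Omega> n))) has_sum z) UNIV"

definition has_expectation :: "real \<Rightarrow> real \<Rightarrow> real \<Rightarrow> qop \<Rightarrow> qop \<Rightarrow> complex \<Rightarrow> bool" where
  "has_expectation hbar m \<Omega> R Ob z \<longleftrightarrow> has_trace hbar m \<Omega> (R \<circ> Ob) z"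

text \<open>Only meaningful where \<^const>\<open>has_expectation\<close> holds for some value, and then equal
  to that value.\<close>

definition expectation :: "real \<Rightarrow> real \<Rightarrow> real \<Rightarrow> qop \<Rightarrow> qop \<Rightarrow> complex" where
  "expectation hbar m \<Omega> R Ob =
     (\<Sum>\<^sub>\<infinity>n. l2_inner (qho_basis hbar m \<Omega> n) ((R \<circ> Ob) (qho_basis hbar m \<Omega> n)))"

definition density_operator :: "real \<Rightarrow> real \<Rightarrow> real \<Rightarrow> qop \<Rightarrow> bool" where
  "density_operator hbar m \<Omega> R \<longleftrightarrow>
     (\<forall>f\<in>L2. R f \<in> L2) \<and>
     (\<forall>f\<in>L2. \<forall>g\<in>L2. AE x in lborel. R (\<lambda>y. f y + g y) x = R f x + R g x) \<and>
     (\<forall>c. \<forall>f\<in>L2. AE x in lborel. R (\<lambda>y. c * f y) x = c * R f x) \<and>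
     (\<exists>K. \<forall>f\<in>L2. l2_norm (R f) \<le> K * l2_norm f) \<and>
     (\<forall>f\<in>L2. l2_inner f (R f) \<in> \<real> \<and> 0 \<le> Re (l2_inner f (R f))) \<and>
     has_trace hbar m \<Omega> R 1"

definition finite_energy :: "real \<Rightarrow> real \<Rightarrow> real \<Rightarrow> qop \<Rightarrow> bool" where
  "finite_energy hbar m \<Omega> R \<longleftrightarrow>
     (\<exists>E. has_expectation hbar m \<Omega> R (hamiltonian hbar m (harmonic m \<Omega>)) E)"


section \<open>Quantum Langevin dynamics\<close>

definition langevin_coeffs ::
  "real \<Rightarrow> real \<Rightarrow> real \<Rightarrow> real \<Rightarrow> real \<Rightarrow> real \<Rightarrow> real \<Rightarrow> real \<Rightarrow> bool" where
  "langevin_coeffs hbar m \<Omega> \<eta> k T \<mu> \<nu> \<longleftrightarrow>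
     \<mu>\<^sup>2 = \<eta> * m * \<Omega> / (2 * hbar) *
            (cosh (hbar * \<Omega> / (4 * k * T)) / sinh (hbar * \<Omega> / (4 * k * T))) \<and>
     \<nu>\<^sup>2 = \<eta> / (2 * hbar * m * \<Omega>) * tanh (hbar * \<Omega> / (4 * k * T)) \<and>
     2 * \<mu> * \<nu> * hbar = \<eta>"

text \<open>The matrix element between \<open>\<phi>\<close> and \<open>\<psi>\<close> of the right-hand side of the
  Lindblad equation at \<open>R\<close>, with every unbounded operator standing to the left of
  \<open>R\<close> moved to \<open>\<phi>\<close> by taking its adjoint.\<close>

definition lindblad_form ::
  "real \<Rightarrow> real \<Rightarrow> (real \<Rightarrow> real) \<Rightarrow> real \<Rightarrow> real \<Rightarrow> qop \<Rightarrow>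
    (real \<Rightarrow> complex) \<Rightarrow> (real \<Rightarrow> complex) \<Rightarrow> complex" where
  "lindblad_form hbar m V \<mu> \<nu> R \<phi> \<psi> =
     (let H = hamiltonian hbar m V; L = jump hbar \<mu> \<nu>; L' = jump_adj hbar \<mu> \<nu> in
       - (\<i> / complex_of_real hbar) * (l2_inner (H \<phi>) (R \<psi>) - l2_inner \<phi> (R (H \<psi>)))
       + 2 * l2_inner (L' \<phi>) (R (L' \<psi>))
       - l2_inner (L' (L \<phi>)) (R \<psi>)
       - l2_inner \<phi> (R (L' (L \<psi>))))"

text \<open>A trajectory of density operators starting at \<open>R0\<close> and solving the Lindblad equation
  in the weak sense, i.e. tested against all Schwartz functions. At time \<open>0\<close> the derivative
  is one-sided.\<close>

definition qld_solution ::
  "real \<Rightarrow> real \<Rightarrow> real \<Rightarrow> real \<Rightarrow> real \<Rightarrow> qop \<Rightarrow> (real \<Rightarrow> qop) \<Rightarrow> bool" where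
  "qld_solution hbar m \<Omega> \<mu> \<nu> R0 \<rho> \<longleftrightarrow>
     (\<forall>f\<in>L2. AE x in lborel. \<rho> 0 f x = R0 f x) \<and>
     (\<forall>t\<ge>0. density_operator hbar m \<Omega> (\<rho> t)) \<and>
     (\<forall>t\<ge>0. \<forall>\<phi>\<in>schwartz. \<forall>\<psi>\<in>schwartz.
        ((\<lambda>s. l2_inner \<phi> (\<rho> s \<psi>)) has_vector_derivative
           lindblad_form hbar m (harmonic m \<Omega>) \<mu> \<nu> (\<rho> t) \<phi> \<psi>) (at t within {0..}))"

definition ground_state :: "qop \<Rightarrow> real \<Rightarrow> (real \<Rightarrow> complex) \<Rightarrow> bool" where
  "ground_state H E \<phi> \<longleftrightarrow>
     \<phi> \<in> schwartz \<and> l2_norm \<phi> = 1 \<and> H \<phi> = (\<lambda>x. complex_of_real E * \<phi> x) \<and>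
     (\<forall>f\<in>schwartz. l2_norm f = 1 \<longrightarrow> E \<le> Re (l2_inner f (H f)))"

end

theory Submission
  imports Defs "HOL-Probability.Sinc_Integral" "HOL-Computational_Algebra.Polynomial"
begin

text \<open>In the oscillator eigenbasis the jump operator is \<open>L = \<alpha> a + \<beta> a\<^sup>\<dagger>\<close> with \<open>\<alpha>\<^sup>2 - \<beta>\<^sup>2 = \<eta>\<close>, and the weak
  equation tested on eigenfunctions is an infinite linear system for the matrix entries of \<open>\<rho>\<close>.
  Formally \<open>N = a\<^sup>\<dagger> a\<close> and \<open>a\<^sup>2\<close> obey closed equations,
  \<open>\<langle>N\<rangle>' = - 2 \<eta> \<langle>N\<rangle> + 2 \<beta>\<^sup>2\<close> and \<open>\<langle>a\<^sup>2\<rangle>' = - 2 (\<eta> + \<i> \<Omega>) \<langle>a\<^sup>2\<rangle> - 2 \<alpha> \<beta>\<close>,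
  which give all second moments. That the energy stays finite is not assumed for positive times. It
  follows from the truncated mean of \<open>min N R\<close>: as the trace is \<open>1\<close>, this is a finite combination of
  matrix entries, and by positivity \<open>2 \<bar>\<rho> j k\<bar> \<le> \<rho> j j + \<rho> k k\<close> the boundary terms at \<open>R\<close> are bounded by
  the truncated mean itself, so Gronwall's inequality applies uniformly in \<open>R\<close>. With this a priori
  bound the boundary terms vanish in the limit by dominated convergence. As the temperature tends
  to \<open>0\<close>, so does \<open>\<beta>\<close>, and \<open>1 - \<rho> 0 0 \<le> \<langle>N\<rangle>\<close> yields convergence to the ground state.\<close>

section \<open>Limits of ordinary differential equations and truncated means\<close>

text \<open>The weak equation yields derivatives of single matrix entries; no differentiability of
  an unbounded moment is given. Moments are therefore approached by finite combinations of entries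
  that solve the closed equation up to a defect made of tail and cutoff terms. A defect that is
  bounded on compact time intervals uniformly in the cutoff, and tends to 0 at each time, disappears
  from the integrated equation. With \<open>x0 = sqrt (hbar / (2 m \<Omega>))\<close>, \<alpha> and
  \<beta> are the sum and the difference of \<open>\<mu> x0\<close> and
  \<open>\<nu> hbar / (2 x0)\<close>. The moments relax to \<beta>^2 / \<eta> and -\<alpha> \<beta>
  / (\<eta> + i \<Omega>). Both x^2 and p^2 contain 2 N + 1, but the real part of the second moment
  enters them with opposite signs: A stems from N, the oscillation at 2 \<Omega> from
  \<open>a\<^sup>2\<close>. For T to 0 the squares of \<open>\<mu> x0\<close> and
  \<open>\<nu> hbar / (2 x0)\<close> both tend to \<eta> / 4, so \<beta> vanishes; as the initial
  state is common to all T, transient and thermal terms vanish independently, which gives a joint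
  limit in (T, t).\<close>

lemma ode_limit:
  fixes u err :: "nat \<Rightarrow> real \<Rightarrow> complex" and v :: "real \<Rightarrow> complex" and c d :: complex
  assumes der: "\<And>R s. s \<ge> 0 \<Longrightarrow> (u R has_vector_derivative (c * u R s + d + err R s)) (at s within {0..})"
    and bound: "\<And>R s. 0 \<le> s \<Longrightarrow> s \<le> t \<Longrightarrow> norm (err R s) \<le> M"
    and err: "\<And>s. s \<ge> 0 \<Longrightarrow> (\<lambda>R. err R s) \<longlonglongrightarrow> 0"
    and lim: "\<And>s. s \<ge> 0 \<Longrightarrow> (\<lambda>R. u R s) \<longlonglongrightarrow> v s"
    and "c \<noteq> 0" "t \<ge> 0"
  shows "v t = exp (c * of_real t) * (v 0 + d / c) - d / c"
proof -
  \<comment> \<open>Integrating factor applied to the distance from the fixed point -d / c: its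
    derivative contains the defect alone, so that only an integral of \<open>err\<close> has to pass
    to the limit.\<close>
  define w where "w = (\<lambda>R s. exp (- c * of_real s) * (u R s + d / c))"
  have dw: "(w R has_vector_derivative exp (- c * of_real s) * err R s) (at s within {0..t})"
    if s: "s \<in> {0..t}" for R s
  proof -
    have "((\<lambda>s. exp (- c * of_real s)) has_vector_derivative - c * exp (- c * of_real s)) (at s within {0..t})"
    proof -
      have "((\<lambda>z. exp (- c * z)) has_field_derivative - c * exp (- c * of_real s)) (at (of_real s))"
        by (auto intro!: derivative_eq_intros)
      from has_vector_derivative_real_field[OF this] show ?thesis
        by (rule has_vector_derivative_at_within)
    qed
    moreover have "(u R has_vector_derivative (c * u R s + d + err R s)) (at s within {0..t})"
      by (rule has_vector_derivative_within_subset[OF der]) (use s in auto)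
    then have "((\<lambda>s. u R s + d / c) has_vector_derivative (c * u R s + d + err R s)) (at s within {0..t})"
      by (auto intro!: derivative_eq_intros)
    ultimately have "(w R has_vector_derivative (exp (- c * of_real s) * (c * u R s + d + err R s)
        + - c * exp (- c * of_real s) * (u R s + d / c))) (at s within {0..t})"
      unfolding w_def by (rule has_vector_derivative_mult)
    moreover have "exp (- c * of_real s) * (c * u R s + d + err R s)
        + - c * exp (- c * of_real s) * (u R s + d / c) = exp (- c * of_real s) * err R s"
      using \<open>c \<noteq> 0\<close> by (simp add: algebra_simps)
    ultimately show ?thesis by simp
  qed
  have int: "((\<lambda>s. exp (- c * of_real s) * err R s) has_integral (w R t - w R 0)) {0..t}" for R
    by (rule fundamental_theorem_of_calculus[OF \<open>t \<ge> 0\<close> dw])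
  have "M \<ge> 0" using bound[of 0 0] \<open>t \<ge> 0\<close> norm_ge_zero order_trans by blast
  have "(\<lambda>R. integral {0..t} (\<lambda>s. exp (- c * of_real s) * err R s)) \<longlonglongrightarrow> integral {0..t} (\<lambda>s. 0)"
  proof (rule dominated_convergence(2)[where h = "\<lambda>s. exp (cmod c * t) * M"])
    show "(\<lambda>s. exp (- c * of_real s) * err R s) integrable_on {0..t}" for R
      using int by blast
    show "norm (exp (- c * of_real s) * err R s) \<le> exp (cmod c * t) * M" if s: "s \<in> {0..t}" for R s
    proof -
      have "Re (- c * of_real s) \<le> cmod (- c * of_real s)" by (rule complex_Re_le_cmod)
      also have "\<dots> \<le> cmod c * t" using s by (auto simp: norm_mult intro: mult_left_mono)
      finally have "norm (exp (- c * of_real s)) \<le> exp (cmod c * t)" by simp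
      then show ?thesis unfolding norm_mult
        using s \<open>M \<ge> 0\<close> by (intro mult_mono bound) auto
    qed
    show "(\<lambda>R. exp (- c * of_real s) * err R s) \<longlonglongrightarrow> 0" if "s \<in> {0..t}" for s
      using that by (intro tendsto_mult_right_zero err) auto
  qed (rule integrable_const_ivl)
  then have "(\<lambda>R. w R t - w R 0) \<longlonglongrightarrow> 0"
    by (simp only: integral_unique[OF int] integral_0)
  moreover have "(\<lambda>R. w R t - w R 0) \<longlonglongrightarrow>
      exp (- c * of_real t) * (v t + d / c) - exp (- c * of_real 0) * (v 0 + d / c)"
    unfolding w_def by (intro tendsto_intros lim) (use \<open>t \<ge> 0\<close> in auto)
  ultimately have "exp (- c * of_real t) * (v t + d / c) - exp (- c * of_real 0) * (v 0 + d / c) = 0"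
    by (rule LIMSEQ_unique[symmetric])
  then have "exp (- c * of_real t) * (v t + d / c) = v 0 + d / c" by simp
  then have "v t + d / c = exp (c * of_real t) * (v 0 + d / c)"
    by (simp add: exp_minus field_simps)
  then show ?thesis by (simp add: algebra_simps)
qed

lemma gronwall:
  fixes f f' :: "real \<Rightarrow> real"
  assumes der: "\<And>s. s \<ge> 0 \<Longrightarrow> (f has_real_derivative f' s) (at s within {0..})"
    and le: "\<And>s. s \<ge> 0 \<Longrightarrow> f' s \<le> K * f s" and "t \<ge> 0"
  shows "f t \<le> exp (K * t) * f 0"
proof -
  define g where "g = (\<lambda>s. exp (- K * s) * f s)"
  have dg: "(g has_real_derivative exp (- K * s) * (f' s - K * f s)) (at s within {0..})" if "s \<ge> 0" for s
    unfolding g_def by (rule derivative_eq_intros der[OF that] refl)+ (simp add: algebra_simps)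
  have "g t \<le> g 0"
  proof (rule DERIV_nonpos_imp_decreasing_open[OF \<open>t \<ge> 0\<close>])
    fix s assume s: "0 < s" "s < t"
    have "at s within {0..} = at s" using s by (intro at_within_interior) (simp add: interior_real_atLeast)
    then have "(g has_real_derivative exp (- K * s) * (f' s - K * f s)) (at s)" using dg[of s] s by simp
    moreover have "exp (- K * s) * (f' s - K * f s) \<le> 0"
      using le[of s] s by (intro mult_nonneg_nonpos) auto
    ultimately show "\<exists>y. DERIV g s :> y \<and> y \<le> 0" by blast
  next
    show "continuous_on {0..t} g"
      by (rule continuous_on_subset[of "{0..}"])
        (auto simp: continuous_on_eq_continuous_within intro!: DERIV_continuous dg)
  qed
  then have "exp (K * t) * g t \<le> exp (K * t) * f 0" by (simp add: g_def)
  moreover have "exp (K * t) * g t = f t" by (simp add: g_def flip: mult.assoc exp_add)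
  ultimately show ?thesis by simp
qed

text \<open>Kronecker's lemma for nonnegative summable sequences: each weight (m + 1) / (R + 1) is
  at most 1 and tends to 0 for fixed m, so \<open>y\<close> itself dominates. This lets a boundary
  term with one surplus factor m vanish after averaging.\<close>

lemma weighted_average_tendsto_0:
  fixes y :: "nat \<Rightarrow> real"
  assumes "summable y" "\<And>n. y n \<ge> 0"
  shows "(\<lambda>R. (\<Sum>m\<le>R. real (Suc m) * y m) / real (Suc R)) \<longlonglongrightarrow> 0"
proof -
  define a where "a = (\<lambda>k R. if k \<le> R then real (Suc k) * y k / real (Suc R) else 0)"
  have "(\<lambda>R. \<Sum>k. a k R) \<longlonglongrightarrow> (\<Sum>k. 0)"
  proof (rule conjunct2[OF conjunct2[OF tannerys_theorem[where M = y]]])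
    fix k
    have "(\<lambda>R. real (Suc k) * y k / real (Suc R)) \<longlonglongrightarrow> 0"
      by (rule LIMSEQ_Suc, rule lim_const_over_n)
    moreover have "\<forall>\<^sub>F R in sequentially. real (Suc k) * y k / real (Suc R) = a k R"
      using eventually_ge_at_top[of k] by eventually_elim (simp add: a_def)
    ultimately show "(\<lambda>R. a k R) \<longlonglongrightarrow> 0" by (rule Lim_transform_eventually)
  next
    have "norm (a k R) \<le> y k" for k R
      using assms(2)[of k] by (auto simp: a_def field_simps intro: mult_right_mono)
    then show "\<forall>\<^sub>F (k, n) in sequentially \<times>\<^sub>F sequentially. norm (a k n) \<le> y k"
      by (intro always_eventually) auto
  qed (use assms in auto)
  moreover have "(\<Sum>k. a k R) = (\<Sum>m\<le>R. real (Suc m) * y m) / real (Suc R)" for R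
  proof -
    have "(\<Sum>k. a k R) = (\<Sum>k\<le>R. a k R)" by (rule suminf_finite) (auto simp: a_def)
    also have "\<dots> = (\<Sum>m\<le>R. real (Suc m) * y m / real (Suc R))" by (intro sum.cong) (auto simp: a_def)
    finally show ?thesis by (simp add: sum_divide_distrib)
  qed
  ultimately show ?thesis by simp
qed

lemma weighted_average_le:
  fixes y :: "nat \<Rightarrow> real"
  assumes "summable y" "\<And>n. y n \<ge> 0"
  shows "(\<Sum>m\<le>R. real (Suc m) * y m) / real (Suc R) \<le> suminf y"
proof -
  have "(\<Sum>m\<le>R. real (Suc m) * y m) \<le> (\<Sum>m\<le>R. real (Suc R) * y m)"
    by (intro sum_mono mult_right_mono assms) auto
  also have "\<dots> = real (Suc R) * (\<Sum>m\<le>R. y m)" by (simp add: sum_distrib_left)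
  also have "\<dots> \<le> real (Suc R) * suminf y"
    by (intro mult_left_mono sum_le_suminf assms) auto
  finally show ?thesis by (simp add: field_simps)
qed

lemma cesaro_summable_tendsto:
  fixes a :: "nat \<Rightarrow> complex"
  assumes "summable (\<lambda>n. norm (a n))"
  shows "(\<lambda>R. (\<Sum>m\<le>R. \<Sum>n\<le>m. a n) / of_nat (Suc R)) \<longlonglongrightarrow> suminf a"
proof -
  \<comment> \<open>Summation by parts: \<open>a n\<close> occurs in the partial sums of index n to
    R, that is R + 1 - n times. The correction is a weighted average and vanishes.\<close>
  have id: "(\<Sum>m\<le>R. \<Sum>n\<le>m. a n) = of_nat (Suc R) * (\<Sum>n\<le>R. a n) - (\<Sum>n\<le>R. of_nat n * a n)" for R
    by (induction R) (simp_all add: algebra_simps)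
  have "(\<lambda>R. (\<Sum>n\<le>R. of_nat n * a n) / of_nat (Suc R)) \<longlonglongrightarrow> 0"
  proof (rule Lim_null_comparison)
    show "(\<lambda>R. (\<Sum>m\<le>R. real (Suc m) * norm (a m)) / real (Suc R)) \<longlonglongrightarrow> 0"
      using assms by (intro weighted_average_tendsto_0) auto
    have "norm ((\<Sum>n\<le>R. of_nat n * a n) / of_nat (Suc R))
        \<le> (\<Sum>m\<le>R. real (Suc m) * norm (a m)) / real (Suc R)" for R
    proof -
      have "norm (\<Sum>n\<le>R. of_nat n * a n) \<le> (\<Sum>m\<le>R. real (Suc m) * norm (a m))"
        by (intro sum_norm_le) (auto simp: norm_mult intro: mult_right_mono)
      then show ?thesis unfolding norm_divide norm_of_nat by (intro divide_right_mono) auto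
    qed
    then show "\<forall>\<^sub>F R in sequentially. norm ((\<Sum>n\<le>R. of_nat n * a n) / of_nat (Suc R))
        \<le> (\<Sum>m\<le>R. real (Suc m) * norm (a m)) / real (Suc R)" by simp
  qed
  moreover have "(\<lambda>R. \<Sum>n\<le>R. a n) \<longlonglongrightarrow> suminf a"
    using summable_LIMSEQ'[OF summable_norm_cancel[OF assms]] .
  ultimately have "(\<lambda>R. (\<Sum>n\<le>R. a n) - (\<Sum>n\<le>R. of_nat n * a n) / of_nat (Suc R)) \<longlonglongrightarrow> suminf a - 0"
    by (intro tendsto_diff)
  moreover have "(\<Sum>n\<le>R. a n) - (\<Sum>n\<le>R. of_nat n * a n) / of_nat (Suc R) = (\<Sum>m\<le>R. \<Sum>n\<le>m. a n) / of_nat (Suc R)" for R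
    unfolding id by (simp add: diff_divide_distrib del: of_nat_Suc)
  ultimately show ?thesis by simp
qed

text \<open>\<open>trunc_mean p R\<close> is the mean of \<open>min n R\<close> under the distribution \<open>p\<close>, written with
  finitely many values of \<open>p\<close> only.\<close>

definition trunc_mean :: "(nat \<Rightarrow> real) \<Rightarrow> nat \<Rightarrow> real" where
  "trunc_mean p R = (\<Sum>n<R. 1 - (\<Sum>i\<le>n. p i))"

text \<open>Summation by parts: a value up to R counts itself, while all the mass above R counts
  R.\<close>

lemma trunc_mean_eq:
  "trunc_mean p R = real R * (1 - (\<Sum>i\<le>R. p i)) + (\<Sum>n\<le>R. real n * p n)"
  by (induction R) (simp_all add: trunc_mean_def algebra_simps)

section \<open>Distributions on the natural numbers and their tails\<close>

locale distribution =
  fixes p :: "nat \<Rightarrow> real"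
  assumes nonneg: "p n \<ge> 0" and total: "p sums 1"
begin

lemma cumulative_le_1: "(\<Sum>i\<le>n. p i) \<le> 1"
  using sum_le_suminf[of p "{..n}"] total nonneg by (auto simp: sums_iff)

lemma prob_le_1: "p n \<le> 1"
  using cumulative_le_1[of n] member_le_sum[of n "{..n}" p] nonneg by fastforce

lemma next_prob_le: "p (Suc R) \<le> 1 - (\<Sum>i\<le>R. p i)"
  using cumulative_le_1[of "Suc R"] by simp

lemma trunc_mean_nonneg: "trunc_mean p R \<ge> 0"
  unfolding trunc_mean_def by (intro sum_nonneg) (simp add: cumulative_le_1)

lemma partial_mean_le_trunc_mean: "(\<Sum>n\<le>R. real n * p n) \<le> trunc_mean p R"
  unfolding trunc_mean_eq using cumulative_le_1[of R] by simp

text \<open>The mass above R contains that of R + 1, the level outside the cutoff to which the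
  surviving coherence reaches.\<close>

lemma trunc_mean_ge: "real R * p (Suc R) + (\<Sum>n\<le>R. real n * p n) \<le> trunc_mean p R"
  unfolding trunc_mean_eq using next_prob_le[of R] by (intro add_mono mult_left_mono) auto

text \<open>The two levels joined by the coherence at the cutoff, with the weight from its bound.
  Lowering the weight \<open>Suc R\<close> to R - 1 and to R leaves over two copies of
  \<open>p (R - 1)\<close> and one of \<open>p (Suc R)\<close>, at most 3 in all. For R = 0 the
  subtraction stops at 0 and the estimate stays valid.\<close>

lemma boundary_le_trunc_mean:
  "real (Suc R) * (p (R - 1) + p (Suc R)) \<le> 3 * (1 + trunc_mean p R)"
proof -
  have "real (R - 1) * p (R - 1) \<le> (\<Sum>n\<le>R. real n * p n)"
    by (rule member_le_sum) (auto simp: nonneg)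
  moreover have "real (Suc R) * p (R - 1) \<le> (real (R - 1) + 2) * p (R - 1)"
    by (intro mult_right_mono nonneg) auto
  moreover have "real (Suc R) * p (Suc R) = real R * p (Suc R) + p (Suc R)"
    by (simp add: algebra_simps)
  ultimately show ?thesis
    using trunc_mean_ge[of R] trunc_mean_nonneg[of R] prob_le_1[of "R - 1"] prob_le_1[of "Suc R"]
    by (simp add: algebra_simps)
qed

lemma summable_of_trunc_mean_bounded:
  assumes "\<And>R. trunc_mean p R \<le> B"
  shows "summable (\<lambda>n. real n * p n)"
  using partial_mean_le_trunc_mean assms nonneg
  by (intro bounded_imp_summable[where B = B]) (auto intro: order_trans)

context
  assumes mean: "summable (\<lambda>n. real n * p n)"
begin

text \<open>Markov's inequality on the tail. The right-hand side is the remainder of a convergent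
  series, so R times the tail mass not only stays bounded but tends to 0.\<close>

lemma tail_le: "real R * (1 - (\<Sum>i\<le>R. p i)) \<le> (\<Sum>n. real n * p n) - (\<Sum>n\<le>R. real n * p n)"
proof -
  have "summable p" "suminf p = 1" using total by (auto simp: sums_iff)
  have "1 - (\<Sum>i\<le>R. p i) = (\<Sum>n. p (n + Suc R))"
    using suminf_minus_initial_segment[OF \<open>summable p\<close>, of "Suc R"] \<open>suminf p = 1\<close>
    by (simp add: lessThan_Suc_atMost)
  then have "real R * (1 - (\<Sum>i\<le>R. p i)) = (\<Sum>n. real R * p (n + Suc R))"
    using \<open>summable p\<close> by (simp add: suminf_mult summable_ignore_initial_segment del: add_Suc_right)
  also have "\<dots> \<le> (\<Sum>n. real (n + Suc R) * p (n + Suc R))"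
    using \<open>summable p\<close> mean
    by (intro suminf_le mult_right_mono nonneg summable_mult)
      (auto simp: summable_iff_shift[of "\<lambda>n. real n * p n" "Suc R"] summable_iff_shift[of p "Suc R"] simp del: add_Suc_right of_nat_add)
  also have "\<dots> = (\<Sum>n. real n * p n) - (\<Sum>n\<le>R. real n * p n)"
    using suminf_minus_initial_segment[OF mean, of "Suc R"] by (simp add: lessThan_Suc_atMost)
  finally show ?thesis .
qed

lemma trunc_mean_le_mean: "trunc_mean p R \<le> (\<Sum>n. real n * p n)"
  unfolding trunc_mean_eq using tail_le[of R] by simp

lemma mean_nonneg: "0 \<le> (\<Sum>n. real n * p n)"
  by (intro suminf_nonneg mean) (simp add: nonneg)

lemma tail_tendsto: "(\<lambda>R. real R * (1 - (\<Sum>i\<le>R. p i))) \<longlonglongrightarrow> 0"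
proof (rule tendsto_sandwich[OF _ _ tendsto_const])
  have "(\<lambda>R. (\<Sum>n. real n * p n) - (\<Sum>n\<le>R. real n * p n)) \<longlonglongrightarrow> (\<Sum>n. real n * p n) - (\<Sum>n. real n * p n)"
    by (intro tendsto_diff tendsto_const summable_LIMSEQ'[OF mean])
  then show "(\<lambda>R. (\<Sum>n. real n * p n) - (\<Sum>n\<le>R. real n * p n)) \<longlonglongrightarrow> 0" by simp
qed (use tail_le cumulative_le_1 in auto)

lemma trunc_mean_tendsto: "trunc_mean p \<longlonglongrightarrow> (\<Sum>n. real n * p n)"
  using tendsto_add[OF tail_tendsto summable_LIMSEQ'[OF mean]] by (simp add: trunc_mean_eq[abs_def])

lemma cumulative_tendsto: "(\<lambda>R. \<Sum>i\<le>R. p i) \<longlonglongrightarrow> 1"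
  using total by (simp add: sums_def_le)

lemma Suc_mult_summable: "summable (\<lambda>n. real (Suc n) * p n)"
proof -
  have "summable (\<lambda>n. real n * p n + p n)"
    using total by (intro summable_add mean) (simp add: sums_iff)
  then show ?thesis by (simp add: algebra_simps)
qed

lemma Suc_mult_tendsto_0: "(\<lambda>n. real (Suc n) * p n) \<longlonglongrightarrow> 0"
  by (rule summable_LIMSEQ_zero[OF Suc_mult_summable])

lemma shifted_tendsto_0: "(\<lambda>n. real (Suc n) * p (n + k)) \<longlonglongrightarrow> 0"
proof (rule tendsto_sandwich[OF _ _ tendsto_const])
  show "(\<lambda>n. real (Suc (n + k)) * p (n + k)) \<longlonglongrightarrow> 0"
    using Suc_mult_tendsto_0 by (rule LIMSEQ_ignore_initial_segment)
qed (auto intro!: always_eventually mult_right_mono nonneg mult_nonneg_nonneg)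

lemma shifted_summable: "summable (\<lambda>n. real (Suc n) * p (n + k))"
  by (rule summable_comparison_test'[OF summable_ignore_initial_segment[OF Suc_mult_summable, of k], of 0])
    (auto simp: nonneg intro!: mult_right_mono)

text \<open>Raising the weight to \<open>Suc (n + k)\<close> turns the sum into a tail of the series
  of \<open>Suc n * p n\<close>; the 1 is the total mass.\<close>

lemma shifted_suminf_le: "(\<Sum>n. real (Suc n) * p (n + k)) \<le> 1 + (\<Sum>n. real n * p n)"
proof -
  have "(\<Sum>n. real (Suc n) * p (n + k)) \<le> (\<Sum>n. real (Suc (n + k)) * p (n + k))"
    by (intro suminf_le mult_right_mono nonneg shifted_summable summable_ignore_initial_segment[OF Suc_mult_summable]) auto
  also have "\<dots> \<le> (\<Sum>n. real (Suc n) * p n)"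
    unfolding suminf_minus_initial_segment[OF Suc_mult_summable]
    by (simp add: sum_nonneg nonneg)
  also have "\<dots> = (\<Sum>n. real n * p n + p n)" by (simp add: algebra_simps)
  also have "\<dots> = (\<Sum>n. real n * p n) + 1"
    using total by (subst suminf_add[symmetric, OF mean]) (auto simp: sums_iff)
  finally show ?thesis by simp
qed

end

end

section \<open>The Lindblad equation in the number basis\<close>

text \<open>Entry \<open>(j, k)\<close> of the Lindblad generator in the number basis for \<open>L = \<alpha> a + \<beta> a\<^sup>\<dagger>\<close>.
  Truncated indices only occur next to a vanishing square root.\<close>

definition lindblad_matrix_rhs ::
  "real \<Rightarrow> real \<Rightarrow> real \<Rightarrow> (nat \<Rightarrow> nat \<Rightarrow> complex) \<Rightarrow> nat \<Rightarrow> nat \<Rightarrow> complex" where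
  "lindblad_matrix_rhs \<alpha> \<beta> \<Omega> r j k =
     - \<i> * of_real (\<Omega> * (real j - real k)) * r j k
     + 2 * (of_real (\<alpha>\<^sup>2 * (sqrt (real (j + 1)) * sqrt (real (k + 1)))) * r (j + 1) (k + 1)
          + of_real (\<alpha> * \<beta> * (sqrt (real (j + 1)) * sqrt (real k))) * r (j + 1) (k - 1)
          + of_real (\<alpha> * \<beta> * (sqrt (real j) * sqrt (real (k + 1)))) * r (j - 1) (k + 1)
          + of_real (\<beta>\<^sup>2 * (sqrt (real j) * sqrt (real k))) * r (j - 1) (k - 1))
     - of_real (\<alpha>\<^sup>2 * (real j + real k) + \<beta>\<^sup>2 * (real j + real k + 2)) * r j k
     - of_real (\<alpha> * \<beta>) * (of_real (sqrt (real j * real (j - 1))) * r (j - 2) k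
          + of_real (sqrt (real (j + 1) * real (j + 2))) * r (j + 2) k
          + of_real (sqrt (real k * real (k - 1))) * r j (k - 2)
          + of_real (sqrt (real (k + 1) * real (k + 2))) * r j (k + 2))"

text \<open>The summands of \<open>Tr (\<rho> a\<^sup>2)\<close> and \<open>Tr (\<rho> a\<^sup>4)\<close>.\<close>

definition pair_coherence :: "(nat \<Rightarrow> nat \<Rightarrow> complex) \<Rightarrow> nat \<Rightarrow> complex" where
  "pair_coherence r n = of_real (sqrt (real n * real (n - 1))) * r n (n - 2)"

definition quad_coherence :: "(nat \<Rightarrow> nat \<Rightarrow> complex) \<Rightarrow> nat \<Rightarrow> complex" where
  "quad_coherence r n = of_real (sqrt (real n * real (n - 1) * real (n - 2) * real (n - 3))) * r n (n - 4)"

definition diagonal :: "(nat \<Rightarrow> nat \<Rightarrow> complex) \<Rightarrow> nat \<Rightarrow> real" where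
  "diagonal r n = Re (r n n)"

text \<open>Positivity enters as the linear form of the Cauchy-Schwarz bound on 2 x 2 minors. Being
  linear, it bounds coherences by sums of populations, hence by the truncated mean; with j = k it
  makes the populations nonnegative.\<close>

locale density_matrix =
  fixes r :: "nat \<Rightarrow> nat \<Rightarrow> complex"
  assumes hermitian: "r k j = cnj (r j k)"
    and offdiagonal_le: "2 * cmod (r j k) \<le> Re (r j j) + Re (r k k)"
    and trace: "(\<lambda>n. Re (r n n)) sums 1"
begin

abbreviation p :: "nat \<Rightarrow> real" where "p \<equiv> diagonal r"

lemma p_def: "p n = Re (r n n)"
  by (simp add: diagonal_def)

sublocale distribution p
proof
  show "p n \<ge> 0" for n
    using order_trans[OF norm_ge_zero, of "r n n"] offdiagonal_le[of n n] by (simp add: p_def)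
  show "p sums 1" using trace by (simp add: p_def[abs_def])
qed

lemma diagonal_eq: "r n n = of_real (p n)"
  using hermitian[of n n] by (auto simp: p_def complex_eq_iff)

lemma offdiagonal_le': "cmod (r j k) \<le> (p j + p k) / 2"
  using offdiagonal_le[of j k] by (simp add: p_def)

text \<open>Balance equation of the populations. Emission and absorption enter as differences of
  currents between neighbouring levels, proportional to \<open>n * p n\<close> downwards and
  \<open>n * p (n - 1)\<close> upwards; the coherences enter as a second difference. Hence all three
  can be summed in closed form.\<close>

lemma Re_rhs_diagonal:
  "Re (lindblad_matrix_rhs \<alpha> \<beta> \<Omega> r n n) =
     2 * \<alpha>\<^sup>2 * (real (n + 1) * p (n + 1) - real n * p n) + 2 * \<beta>\<^sup>2 * (real n * p (n - 1) - real (n + 1) * p n)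
     - 2 * \<alpha> * \<beta> * (Re (pair_coherence r (n + 2)) - 2 * Re (pair_coherence r (n + 1)) + Re (pair_coherence r n))"
proof -
  have h: "Re (r k j) = Re (r j k)" for j k using hermitian[of k j] by simp
  have s: "sqrt (real (n + 1)) * sqrt (real n) = sqrt (real (n + 1) * real n)"
    "sqrt (real n) * sqrt (real (n + 1)) = sqrt (real (n + 1) * real n)"
    "sqrt (real (n + 1) * real (n + 2)) = sqrt (real (n + 2) * real (n + 1))"
    by (simp_all only: real_sqrt_mult mult.commute)
  show ?thesis
    unfolding lindblad_matrix_rhs_def s pair_coherence_def diagonal_eq
    by (simp add: h[of "n - 2" n] h[of n "n + 2"] p_def[symmetric] h[of "Suc n" "n - Suc 0"]
       h[of n "Suc (Suc n)"] algebra_simps power2_eq_square)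
qed

text \<open>The rates of the populations telescope twice: first to a cumulative probability, then to the
  truncated mean, where the coherences survive only at the cutoff.\<close>

lemma sum_Re_rhs_diagonal:
  "(\<Sum>i\<le>n. Re (lindblad_matrix_rhs \<alpha> \<beta> \<Omega> r i i)) =
     2 * \<alpha>\<^sup>2 * (real (n + 1) * p (n + 1)) - 2 * \<beta>\<^sup>2 * (real (n + 1) * p n)
     - 2 * \<alpha> * \<beta> * (Re (pair_coherence r (n + 2)) - Re (pair_coherence r (n + 1)))"
proof (induction n)
  case 0
  show ?case by (simp add: Re_rhs_diagonal) (simp add: pair_coherence_def)
next
  case (Suc n)
  then show ?case by (simp add: Re_rhs_diagonal algebra_simps)
qed

text \<open>The bracket next to \<beta>^2 is the sum of (n + 1) p n over n < R, rewritten with sums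
  up to R so that it matches \<open>trunc_mean_eq\<close>.\<close>

definition trunc_mean_rate :: "real \<Rightarrow> real \<Rightarrow> nat \<Rightarrow> real" where
  "trunc_mean_rate \<alpha> \<beta> R = - 2 * \<alpha>\<^sup>2 * (\<Sum>n\<le>R. real n * p n)
     + 2 * \<beta>\<^sup>2 * ((\<Sum>n\<le>R. real n * p n) + (\<Sum>n\<le>R. p n) - real (Suc R) * p R)
     + 2 * \<alpha> * \<beta> * Re (pair_coherence r (R + 1))"

lemma trunc_mean_rate_eq:
  "(\<Sum>n<R. - (\<Sum>i\<le>n. Re (lindblad_matrix_rhs \<alpha> \<beta> \<Omega> r i i))) = trunc_mean_rate \<alpha> \<beta> R"
proof (induction R)
  case 0
  show ?case by (simp add: trunc_mean_rate_def) (simp add: pair_coherence_def)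
next
  case (Suc R)
  then show ?case
    by (simp add: sum_Re_rhs_diagonal trunc_mean_rate_def algebra_simps)
qed

lemma sqrt_mult_le: "0 \<le> a \<Longrightarrow> a \<le> c \<Longrightarrow> 0 \<le> b \<Longrightarrow> b \<le> c \<Longrightarrow> sqrt (a * b) \<le> c"
  by (rule real_le_lsqrt) (auto simp: power2_eq_square intro: mult_mono)

lemma pair_coherence_le: "2 * cmod (pair_coherence r n) \<le> real n * (p n + p (n - 2))"
proof -
  have "sqrt (real n * real (n - 1)) \<le> real n" by (rule sqrt_mult_le) auto
  then have "sqrt (real n * real (n - 1)) * cmod (r n (n - 2)) \<le> real n * ((p n + p (n - 2)) / 2)"
    by (intro mult_mono offdiagonal_le') auto
  then show ?thesis by (simp add: pair_coherence_def norm_mult)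
qed

lemma quad_coherence_le: "2 * cmod (quad_coherence r n) \<le> (real n)\<^sup>2 * (p n + p (n - 4))"
proof -
  have "sqrt (real n * real (n - 1) * real (n - 2) * real (n - 3)) \<le> (real n)\<^sup>2"
    unfolding mult.assoc[of "real n * real (n - 1)"] power2_eq_square
    by (intro sqrt_mult_le mult_mono) auto
  then have "sqrt (real n * real (n - 1) * real (n - 2) * real (n - 3)) * cmod (r n (n - 4))
     \<le> (real n)\<^sup>2 * ((p n + p (n - 4)) / 2)"
    by (intro mult_mono offdiagonal_le') auto
  then show ?thesis by (simp add: quad_coherence_def norm_mult)
qed

lemma boundary_coherence_le: "2 * \<bar>Re (pair_coherence r (R + 1))\<bar> \<le> real (Suc R) * (p (R - 1) + p (Suc R))"
  using pair_coherence_le[of "R + 1"] abs_Re_le_cmod[of "pair_coherence r (R + 1)"]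
  by (simp add: add.commute)

lemma boundary_term_le:
  "\<bar>2 * \<alpha> * \<beta> * Re (pair_coherence r (R + 1))\<bar> \<le> 3 * \<bar>\<alpha> * \<beta>\<bar> * (1 + trunc_mean p R)"
proof -
  have "\<bar>2 * \<alpha> * \<beta> * Re (pair_coherence r (R + 1))\<bar> = \<bar>\<alpha> * \<beta>\<bar> * (2 * \<bar>Re (pair_coherence r (R + 1))\<bar>)"
    by (simp add: abs_mult)
  also have "\<dots> \<le> \<bar>\<alpha> * \<beta>\<bar> * (3 * (1 + trunc_mean p R))"
    by (intro mult_left_mono order_trans[OF boundary_coherence_le boundary_le_trunc_mean]) auto
  finally show ?thesis by (simp only: mult_ac)
qed

text \<open>The loss term has a sign and is dropped. What remains is affine in the truncated mean,
  with constants free of R and of the state.\<close>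

lemma trunc_mean_rate_le:
  "trunc_mean_rate \<alpha> \<beta> R \<le> (2 * \<beta>\<^sup>2 + 3 * \<bar>\<alpha> * \<beta>\<bar>) * (1 + trunc_mean p R)"
proof -
  have "- 2 * \<alpha>\<^sup>2 * (\<Sum>n\<le>R. real n * p n) \<le> 0"
    by (auto intro!: mult_nonneg_nonneg sum_nonneg simp: nonneg)
  moreover have "2 * \<beta>\<^sup>2 * ((\<Sum>n\<le>R. real n * p n) + (\<Sum>n\<le>R. p n) - real (Suc R) * p R) \<le> 2 * \<beta>\<^sup>2 * (1 + trunc_mean p R)"
  proof (rule mult_left_mono)
    have "0 \<le> real (Suc R) * p R" by (intro mult_nonneg_nonneg nonneg) auto
    then show "(\<Sum>n\<le>R. real n * p n) + (\<Sum>n\<le>R. p n) - real (Suc R) * p R \<le> 1 + trunc_mean p R"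
      using partial_mean_le_trunc_mean[of R] cumulative_le_1[of R] by linarith
  qed auto
  moreover have "2 * \<alpha> * \<beta> * Re (pair_coherence r (R + 1)) \<le> 3 * \<bar>\<alpha> * \<beta>\<bar> * (1 + trunc_mean p R)"
    using boundary_term_le[of \<alpha> \<beta> R] by linarith
  ultimately show ?thesis unfolding trunc_mean_rate_def by (simp add: algebra_simps)
qed

text \<open>The discrepancy between the rate and the formal equation for the mean: the tail mass,
  with and without the factor R, together with the population and the coherence at the
  cutoff.\<close>

definition trunc_mean_defect :: "real \<Rightarrow> real \<Rightarrow> nat \<Rightarrow> real" where
  "trunc_mean_defect \<alpha> \<beta> R = 2 * \<alpha>\<^sup>2 * (real R * (1 - (\<Sum>n\<le>R. p n)))
     - 2 * \<beta>\<^sup>2 * (real R * (1 - (\<Sum>n\<le>R. p n)) + (1 - (\<Sum>n\<le>R. p n)) + real (Suc R) * p R)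
     + 2 * \<alpha> * \<beta> * Re (pair_coherence r (R + 1))"

lemma trunc_mean_rate_defect:
  "trunc_mean_rate \<alpha> \<beta> R = - 2 * (\<alpha>\<^sup>2 - \<beta>\<^sup>2) * trunc_mean p R + 2 * \<beta>\<^sup>2 + trunc_mean_defect \<alpha> \<beta> R"
  unfolding trunc_mean_rate_def trunc_mean_defect_def trunc_mean_eq by (simp add: algebra_simps)

text \<open>The weight turns entry (n + 2, n) into a summand of the trace against
  \<open>a\<^sup>2\<close>. Every square root then either completes a coherence or occurs squared.
  What remains are first differences with linear weights, a second difference of populations with a
  quadratic weight, and an unweighted second difference of quadruple coherences.\<close>

lemma weighted_rhs:
  "of_real (sqrt (real (n + 2) * real (n + 1))) * lindblad_matrix_rhs \<alpha> \<beta> \<Omega> r (n + 2) n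
   = - 2 * \<i> * of_real \<Omega> * pair_coherence r (n + 2)
     + 2 * of_real (\<alpha>\<^sup>2) * (of_nat (n + 1) * (pair_coherence r (n + 3) - pair_coherence r (n + 2)))
     + 2 * of_real (\<beta>\<^sup>2) * (of_nat (n + 2) * (pair_coherence r (n + 1) - pair_coherence r (n + 2)))
     - of_real (\<alpha> * \<beta> * (real (n + 1) * real (n + 2) * (p n - 2 * p (n + 1) + p (n + 2))))
     + of_real (\<alpha> * \<beta>) * (2 * quad_coherence r (n + 3) - quad_coherence r (n + 4) - quad_coherence r (n + 2))"
proof -
  \<comment> \<open>With the roots named, the claim is a polynomial identity in which only the
    squares of \<open>s0\<close>, \<open>s1\<close>, \<open>s2\<close> are evaluated. The truncated
    subtraction in \<open>sm\<close> is harmless: it occurs next to \<open>s0\<close>, which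
    vanishes for n = 0.\<close>
  define s0 s1 s2 s3 s4 sm where "s0 = complex_of_real (sqrt (real n))" and "s1 = complex_of_real (sqrt (real (n + 1)))"
    and "s2 = complex_of_real (sqrt (real (n + 2)))" and "s3 = complex_of_real (sqrt (real (n + 3)))"
    and "s4 = complex_of_real (sqrt (real (n + 4)))" and "sm = complex_of_real (sqrt (real (n - 1)))"
  have sq: "s0 * s0 = of_nat n" "s1 * s1 = of_nat n + 1" "s2 * s2 = of_nat n + 2"
    unfolding s0_def s1_def s2_def of_real_mult[symmetric] real_sqrt_mult_self by simp_all
  have pc: "pair_coherence r (n + 2) = s2 * s1 * r (n + 2) n"
    "pair_coherence r (n + 3) = s3 * s2 * r (n + 3) (n + 1)"
    "pair_coherence r (n + 1) = s1 * s0 * r (n + 1) (n - 1)"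
    by (simp_all add: pair_coherence_def s0_def s1_def s2_def s3_def real_sqrt_mult add.commute numeral_eq_Suc)
  have qc: "quad_coherence r (n + 3) = s3 * s2 * s1 * s0 * r (n + 3) (n - 1)"
    "quad_coherence r (n + 4) = s4 * s3 * s2 * s1 * r (n + 4) n"
    "quad_coherence r (n + 2) = s2 * s1 * s0 * sm * r (n + 2) (n - 2)"
    by (simp_all add: quad_coherence_def s0_def s1_def s2_def s3_def s4_def sm_def real_sqrt_mult add.commute numeral_eq_Suc)
  have rhs: "lindblad_matrix_rhs \<alpha> \<beta> \<Omega> r (n + 2) n = - 2 * \<i> * of_real \<Omega> * r (n + 2) n
     + 2 * (of_real \<alpha> * of_real \<alpha> * s3 * s1 * r (n + 3) (n + 1) + of_real \<alpha> * of_real \<beta> * s3 * s0 * r (n + 3) (n - 1)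
       + of_real \<alpha> * of_real \<beta> * s2 * s1 * of_real (p (n + 1)) + of_real \<beta> * of_real \<beta> * s2 * s0 * r (n + 1) (n - 1))
     - (of_real \<alpha> * of_real \<alpha> * (2 * of_nat n + 2) + of_real \<beta> * of_real \<beta> * (2 * of_nat n + 4)) * r (n + 2) n
     - of_real \<alpha> * of_real \<beta> * (s2 * s1 * of_real (p n) + s3 * s4 * r (n + 4) n
        + s0 * sm * r (n + 2) (n - 2) + s1 * s2 * of_real (p (n + 2)))"
    unfolding lindblad_matrix_rhs_def diagonal_eq[symmetric]
    unfolding s0_def s1_def s2_def s3_def s4_def sm_def real_sqrt_mult
    by (simp add: add.commute numeral_eq_Suc power2_eq_square del: of_nat_Suc) (simp add: algebra_simps)
  have w: "complex_of_real (sqrt (real (n + 2) * real (n + 1))) = s2 * s1"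
    by (simp add: s1_def s2_def real_sqrt_mult)
  have e: "s2 * (s2 * x) = (of_nat n + 2) * x" "s1 * (s1 * x) = (of_nat n + 1) * x" "s0 * (s0 * x) = of_nat n * x" for x
    using sq by (simp_all flip: mult.assoc)
  show ?thesis
    unfolding w rhs pc qc by (simp add: algebra_simps power2_eq_square sq e)
qed

text \<open>Boundary terms of the summation by parts below. The quadruple coherences are kept apart,
  because their boundary term is a difference of neighbours and telescopes once more in the average
  over m.\<close>

definition pair_defect :: "real \<Rightarrow> real \<Rightarrow> nat \<Rightarrow> complex" where
  "pair_defect \<alpha> \<beta> m = 2 * of_real (\<alpha>\<^sup>2) * (of_nat (m + 1) * pair_coherence r (m + 3))
     - 2 * of_real (\<beta>\<^sup>2) * (of_nat (m + 3) * pair_coherence r (m + 2))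
     - of_real (\<alpha> * \<beta> * (real (m + 1) * real (m + 2) * p (m + 2) - real (m + 1) * real (m + 4) * p (m + 1)))"

text \<open>Summation by parts. The linear weights have difference 1 and reproduce the sum of
  coherences; the weight (n + 1) (n + 2) has second difference 2 and produces the trace; the
  unweighted second difference leaves its upper end.\<close>

lemma sum_weighted_rhs:
  "(\<Sum>n\<le>m. of_real (sqrt (real (n + 2) * real (n + 1))) * lindblad_matrix_rhs \<alpha> \<beta> \<Omega> r (n + 2) n)
   = - 2 * (of_real (\<alpha>\<^sup>2 - \<beta>\<^sup>2) + \<i> * of_real \<Omega>) * (\<Sum>n\<le>m. pair_coherence r (n + 2))
     - 2 * of_real (\<alpha> * \<beta>) * of_real (\<Sum>n\<le>m. p n)
     + pair_defect \<alpha> \<beta> m + of_real (\<alpha> * \<beta>) * (quad_coherence r (m + 3) - quad_coherence r (m + 4))"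
proof (induction m)
  case 0
  have "pair_coherence r 1 = 0" "quad_coherence r 2 = 0" "quad_coherence r 3 = 0"
    by (simp_all add: pair_coherence_def quad_coherence_def)
  then show ?case
    unfolding weighted_rhs by (simp add: weighted_rhs[of 0, simplified] pair_defect_def algebra_simps numeral_eq_Suc)
next
  case (Suc m)
  show ?case
    unfolding sum.atMost_Suc Suc
    unfolding weighted_rhs pair_defect_def
    by (simp add: algebra_simps numeral_eq_Suc)
qed

end

section \<open>Averaged truncations of the second moment\<close>

context density_matrix
begin

text \<open>A sharp cutoff of \<open>Tr (\<rho> a\<^sup>2)\<close> leaves boundary terms of size \<open>R\<^sup>2 p R\<close>, which finite energy does
  not control; averaging the partial sums does.\<close>

definition pair_avg :: "nat \<Rightarrow> complex" where
  "pair_avg R = (\<Sum>m\<le>R. \<Sum>n\<le>m. pair_coherence r (n + 2)) / of_nat (Suc R)"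

text \<open>Three sources: the trace missing below the cutoff, whose average over m is the truncated
  mean divided by R + 1; the averaged boundary terms; and the one quadruple coherence left by
  telescoping, whose quadratic weight is reduced to a linear one by the division.\<close>

definition pair_avg_defect :: "real \<Rightarrow> real \<Rightarrow> nat \<Rightarrow> complex" where
  "pair_avg_defect \<alpha> \<beta> R = of_real (2 * \<alpha> * \<beta> * (trunc_mean p (Suc R) / real (Suc R)))
     + (\<Sum>m\<le>R. pair_defect \<alpha> \<beta> m) / of_nat (Suc R)
     - of_real (\<alpha> * \<beta>) * (quad_coherence r (R + 4) / of_nat (Suc R))"

lemma pair_avg_rate:
  "(\<Sum>m\<le>R. \<Sum>n\<le>m. of_real (sqrt (real (n + 2) * real (n + 1))) * lindblad_matrix_rhs \<alpha> \<beta> \<Omega> r (n + 2) n)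
      / of_nat (Suc R)
   = - 2 * (of_real (\<alpha>\<^sup>2 - \<beta>\<^sup>2) + \<i> * of_real \<Omega>) * pair_avg R - 2 * of_real (\<alpha> * \<beta>)
     + pair_avg_defect \<alpha> \<beta> R"
proof -
  let ?N = "of_nat (Suc R) :: complex"
  have tele: "(\<Sum>m\<le>R. quad_coherence r (m + 3)) - (\<Sum>m\<le>R. quad_coherence r (m + 4)) = - quad_coherence r (R + 4)"
  proof -
    have "(\<Sum>m\<le>R. quad_coherence r (m + 3)) = (\<Sum>m\<le>R. quad_coherence r (m + 4)) - quad_coherence r (R + 4)"
    proof (induction R)
      case 0
      show ?case by (simp add: quad_coherence_def)
    qed (simp add: numeral_eq_Suc)
    then show ?thesis by simp
  qed
  have tm: "(\<Sum>m\<le>R. \<Sum>n\<le>m. p n) = real (Suc R) - trunc_mean p (Suc R)"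
    by (simp add: trunc_mean_def lessThan_Suc_atMost sum_subtractf)
  have S: "(\<Sum>m\<le>R. \<Sum>n\<le>m. of_real (sqrt (real (n + 2) * real (n + 1))) * lindblad_matrix_rhs \<alpha> \<beta> \<Omega> r (n + 2) n)
    = - 2 * (of_real (\<alpha>\<^sup>2 - \<beta>\<^sup>2) + \<i> * of_real \<Omega>) * (\<Sum>m\<le>R. \<Sum>n\<le>m. pair_coherence r (n + 2))
      - 2 * of_real (\<alpha> * \<beta>) * of_real (real (Suc R) - trunc_mean p (Suc R))
      + (\<Sum>m\<le>R. pair_defect \<alpha> \<beta> m) + of_real (\<alpha> * \<beta>) * (- quad_coherence r (R + 4))"
    unfolding sum_weighted_rhs sum.distrib sum_subtractf sum_distrib_left[symmetric] tele
      of_real_sum[symmetric] tm ..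
  show ?thesis
  proof -
    have gen: "(- 2 * z * Q - 2 * c * (N - u) + P + c * (- q)) / N
        = - 2 * z * (Q / N) - 2 * c + (2 * c * (u / N) + P / N - c * (q / N))"
      if "N \<noteq> 0" for z Q c N u P q :: complex
      using that by (simp add: field_simps)
    have N: "?N \<noteq> 0" by (simp del: of_nat_Suc)
    have c1: "of_real (real (Suc R) - trunc_mean p (Suc R)) = ?N - of_real (trunc_mean p (Suc R))"
      by (simp del: of_nat_Suc)
    have c2: "of_real (2 * \<alpha> * \<beta> * (trunc_mean p (Suc R) / real (Suc R)))
        = 2 * of_real (\<alpha> * \<beta>) * (of_real (trunc_mean p (Suc R)) / ?N)"
      by (simp del: of_nat_Suc)
    show ?thesis unfolding S pair_avg_def pair_avg_defect_def c1 c2 by (rule gen[OF N])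
  qed
qed

context
  assumes mean: "summable (\<lambda>n. real n * p n)"
begin

text \<open>A bound free of R, as dominated convergence in time requires. The three terms next to
  \<beta>^2 are each at most one plus the mean, whence the 6.\<close>

lemma trunc_mean_defect_le:
  "\<bar>trunc_mean_defect \<alpha> \<beta> R\<bar> \<le> (2 * \<alpha>\<^sup>2 + 6 * \<beta>\<^sup>2 + 3 * \<bar>\<alpha> * \<beta>\<bar>) * (1 + (\<Sum>n. real n * p n))"
proof -
  define E where "E = (\<Sum>n. real n * p n)"
  define a where "a = real R * (1 - (\<Sum>n\<le>R. p n))"
  define b where "b = 1 - (\<Sum>n\<le>R. p n)"
  define c where "c = real (Suc R) * p R"
  have a: "0 \<le> a" "a \<le> 1 + E"
  proof -
    show "0 \<le> a" using cumulative_le_1[of R] by (simp add: a_def)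
    have "0 \<le> (\<Sum>n\<le>R. real n * p n)" by (intro sum_nonneg mult_nonneg_nonneg nonneg) auto
    then show "a \<le> 1 + E" using tail_le[OF mean, of R] by (simp add: a_def E_def)
  qed
  have b: "0 \<le> b" "b \<le> 1" using cumulative_le_1[of R] by (auto simp: b_def intro!: sum_nonneg nonneg)
  have c: "0 \<le> c" "c \<le> 1 + E"
  proof -
    show "0 \<le> c" by (auto simp: c_def intro!: mult_nonneg_nonneg nonneg)
    have "real R * p R \<le> E"
      using sum_le_suminf[OF mean, of "{R}"] by (simp add: E_def nonneg)
    then show "c \<le> 1 + E" using prob_le_1[of R] by (simp add: c_def algebra_simps)
  qed
  have E: "0 \<le> E" unfolding E_def by (rule mean_nonneg[OF mean])
  have 1: "\<bar>2 * \<alpha>\<^sup>2 * a\<bar> \<le> 2 * \<alpha>\<^sup>2 * (1 + E)"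
    using a by (simp add: abs_mult mult_left_mono)
  have 2: "\<bar>2 * \<beta>\<^sup>2 * (a + b + c)\<bar> \<le> 2 * \<beta>\<^sup>2 * (3 * (1 + E))"
    unfolding abs_mult using a b c E by (intro mult_mono) auto
  have 3: "\<bar>2 * \<alpha> * \<beta> * Re (pair_coherence r (R + 1))\<bar> \<le> 3 * \<bar>\<alpha> * \<beta>\<bar> * (1 + E)"
  proof (rule order_trans[OF boundary_term_le])
    show "3 * \<bar>\<alpha> * \<beta>\<bar> * (1 + trunc_mean p R) \<le> 3 * \<bar>\<alpha> * \<beta>\<bar> * (1 + E)"
      using trunc_mean_le_mean[OF mean, of R] by (intro mult_left_mono) (auto simp: E_def)
  qed
  have "\<bar>2 * \<alpha>\<^sup>2 * a - 2 * \<beta>\<^sup>2 * (a + b + c) + 2 * \<alpha> * \<beta> * Re (pair_coherence r (R + 1))\<bar>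
      \<le> (2 * \<alpha>\<^sup>2 + 6 * \<beta>\<^sup>2 + 3 * \<bar>\<alpha> * \<beta>\<bar>) * (1 + E)"
  proof -
    have tri: "\<bar>x - y + z\<bar> \<le> \<bar>x\<bar> + \<bar>y\<bar> + \<bar>z\<bar>" for x y z :: real by linarith
    have "2 * \<alpha>\<^sup>2 * (1 + E) + 2 * \<beta>\<^sup>2 * (3 * (1 + E)) + 3 * \<bar>\<alpha> * \<beta>\<bar> * (1 + E)
        = (2 * \<alpha>\<^sup>2 + 6 * \<beta>\<^sup>2 + 3 * \<bar>\<alpha> * \<beta>\<bar>) * (1 + E)" by (simp add: algebra_simps)
    then show ?thesis
      using order_trans[OF tri add_mono[OF add_mono[OF 1 2] 3]] by metis
  qed
  then show ?thesis
    unfolding trunc_mean_defect_def a_def b_def c_def E_def .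
qed

lemma trunc_mean_defect_tendsto: "(\<lambda>R. trunc_mean_defect \<alpha> \<beta> R) \<longlonglongrightarrow> 0"
proof -
  have "(\<lambda>R. 1 - (\<Sum>n\<le>R. p n)) \<longlonglongrightarrow> 1 - 1" by (intro tendsto_intros cumulative_tendsto[OF mean])
  \<comment> \<open>The shift by one turns the lower neighbour \<open>R - 1\<close> of the cutoff
    into an honest index, so that \<open>shifted_tendsto_0\<close> covers both neighbours.\<close>
  moreover have "(\<lambda>R. Re (pair_coherence r (R + 1))) \<longlonglongrightarrow> 0"
  proof (rule LIMSEQ_offset[where k = 1], rule Lim_null_comparison)
    have "(\<lambda>R. 2 * (real (Suc R) * p R) + 2 * (real (Suc R) * p (R + 2))) \<longlonglongrightarrow> 2 * 0 + 2 * 0"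
      using shifted_tendsto_0[OF mean, of 0] by (intro tendsto_intros shifted_tendsto_0[OF mean]) simp
    then show "(\<lambda>R. 2 * (real (Suc R) * p R) + 2 * (real (Suc R) * p (R + 2))) \<longlonglongrightarrow> 0" by simp
    have "norm (Re (pair_coherence r (R + 1 + 1))) \<le> 2 * (real (Suc R) * p R) + 2 * (real (Suc R) * p (R + 2))" for R
    proof -
      have "2 * \<bar>Re (pair_coherence r (R + 1 + 1))\<bar> \<le> real (Suc (R + 1)) * (p R + p (R + 2))"
        using boundary_coherence_le[of "R + 1"] by (simp add: numeral_2_eq_2)
      also have "\<dots> \<le> (2 * real (Suc R)) * (p R + p (R + 2))"
        by (intro mult_right_mono add_nonneg_nonneg nonneg) auto
      also have "\<dots> = 2 * (real (Suc R) * p R) + 2 * (real (Suc R) * p (R + 2))" by (simp add: algebra_simps)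
      finally show ?thesis by simp
    qed
    then show "\<forall>\<^sub>F R in sequentially. norm (Re (pair_coherence r (R + 1 + 1)))
        \<le> 2 * (real (Suc R) * p R) + 2 * (real (Suc R) * p (R + 2))" by simp
  qed
  ultimately have "(\<lambda>R. trunc_mean_defect \<alpha> \<beta> R) \<longlonglongrightarrow> 2 * \<alpha>\<^sup>2 * 0 - 2 * \<beta>\<^sup>2 * (0 + (1 - 1) + 0) + 2 * \<alpha> * \<beta> * 0"
    unfolding trunc_mean_defect_def
    by (intro tendsto_intros cumulative_tendsto[OF mean] tail_tendsto[OF mean] Suc_mult_tendsto_0[OF mean])
  then show ?thesis by simp
qed

text \<open>A summable majorant: the levels that coherences of step 2 or 4 near m can touch, with
  the linear weight that a finite mean permits. The summand \<open>m + 0\<close> gives all five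
  terms the shape of the shift lemmas.\<close>

definition spread :: "nat \<Rightarrow> real" where
  "spread m = real (Suc m) * p (m + 0) + real (Suc m) * p (m + 1) + real (Suc m) * p (m + 2)
     + real (Suc m) * p (m + 3) + real (Suc m) * p (m + 4)"

lemma spread_nonneg: "spread m \<ge> 0"
  unfolding spread_def by (intro add_nonneg_nonneg mult_nonneg_nonneg nonneg) auto

lemma spread_summable: "summable spread"
  unfolding spread_def[abs_def] by (intro summable_add shifted_summable[OF mean])

lemma spread_suminf_le: "suminf spread \<le> 5 * (1 + (\<Sum>n. real n * p n))"
proof -
  note s = shifted_summable[OF mean] and le = shifted_suminf_le[OF mean]
  have "suminf spread = (\<Sum>n. real (Suc n) * p (n + 0)) + (\<Sum>n. real (Suc n) * p (n + 1)) + (\<Sum>n. real (Suc n) * p (n + 2))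
     + (\<Sum>n. real (Suc n) * p (n + 3)) + (\<Sum>n. real (Suc n) * p (n + 4))"
    unfolding spread_def[abs_def] by (simp only: suminf_add[symmetric] s summable_add)
  also have "\<dots> \<le> (1 + (\<Sum>n. real n * p n)) + (1 + (\<Sum>n. real n * p n)) + (1 + (\<Sum>n. real n * p n))
     + (1 + (\<Sum>n. real n * p n)) + (1 + (\<Sum>n. real n * p n))"
    by (intro add_mono le)
  finally show ?thesis by simp
qed

text \<open>The boundary terms carry quadratic weights, one factor m + 1 more than the summable
  \<open>spread\<close>; the average removes exactly this factor. The constants compare shifted
  weights with N = m + 1, which is at least 1.\<close>

lemma pair_defect_le:
  "cmod (pair_defect \<alpha> \<beta> m) \<le> (3 * \<alpha>\<^sup>2 + 6 * \<beta>\<^sup>2 + 6 * \<bar>\<alpha> * \<beta>\<bar>) * (real (Suc m) * spread m)"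
proof -
  define N where "N = real (Suc m)"
  define S where "S = p m + p (m + 1) + p (m + 2) + p (m + 3) + p (m + 4)"
  have sp: "spread m = N * S" by (simp add: spread_def N_def S_def algebra_simps)
  have N: "N \<ge> 1" by (simp add: N_def)
  have pp: "p m \<ge> 0" "p (m + 1) \<ge> 0" "p (m + 2) \<ge> 0" "p (m + 3) \<ge> 0" "p (m + 4) \<ge> 0"
    by (auto intro: nonneg)
  have S: "S \<ge> 0" unfolding S_def using pp by linarith
  have N2: "N * (N + 2) \<le> 3 * (N * N)" "(N + 2) * (N + 1) \<le> 6 * (N * N)" "N * (N + 1) \<le> 2 * (N * N)" "N * (N + 3) \<le> 4 * (N * N)"
  proof -
    have "N \<le> N * N" "1 \<le> N * N" using N mult_mono[of 1 N 1 N] by simp_all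
    then show "N * (N + 2) \<le> 3 * (N * N)" "(N + 2) * (N + 1) \<le> 6 * (N * N)" "N * (N + 1) \<le> 2 * (N * N)" "N * (N + 3) \<le> 4 * (N * N)"
      using N unfolding distrib_left distrib_right by linarith+
  qed
  have 1: "cmod (2 * of_real (\<alpha>\<^sup>2) * (of_nat (m + 1) * pair_coherence r (m + 3))) \<le> 3 * \<alpha>\<^sup>2 * (N * N * S)"
  proof -
    have "2 * cmod (pair_coherence r (m + 3)) \<le> (N + 2) * S"
    proof -
      have "2 * cmod (pair_coherence r (m + 3)) \<le> real (m + 3) * (p (m + 3) + p (m + 1))"
        using pair_coherence_le[of "m + 3"] by (simp add: numeral_eq_Suc)
      also have "\<dots> \<le> (N + 2) * S"
        using pp by (intro mult_mono) (auto simp: N_def S_def)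
      finally show ?thesis .
    qed
    then have "\<alpha>\<^sup>2 * (N * (2 * cmod (pair_coherence r (m + 3)))) \<le> \<alpha>\<^sup>2 * (N * ((N + 2) * S))"
      using N by (intro mult_left_mono) auto
    also have "\<dots> = \<alpha>\<^sup>2 * ((N * (N + 2)) * S)" by (simp only: mult.assoc)
    also have "\<dots> \<le> \<alpha>\<^sup>2 * ((3 * (N * N)) * S)"
      by (intro mult_left_mono mult_right_mono N2 S) auto
    finally have *: "\<alpha>\<^sup>2 * (N * (2 * cmod (pair_coherence r (m + 3)))) \<le> \<alpha>\<^sup>2 * ((3 * (N * N)) * S)" .
    have "cmod (of_nat (m + 1)) = N" unfolding norm_of_nat by (simp add: N_def)
    then have "cmod (2 * of_real (\<alpha>\<^sup>2) * (of_nat (m + 1) * pair_coherence r (m + 3)))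
        = \<alpha>\<^sup>2 * (N * (2 * cmod (pair_coherence r (m + 3))))"
      by (simp add: norm_mult norm_power)
    then show ?thesis using * by (simp add: mult_ac)
  qed
  have 2: "cmod (2 * of_real (\<beta>\<^sup>2) * (of_nat (m + 3) * pair_coherence r (m + 2))) \<le> 6 * \<beta>\<^sup>2 * (N * N * S)"
  proof -
    have "2 * cmod (pair_coherence r (m + 2)) \<le> (N + 1) * S"
    proof -
      have "2 * cmod (pair_coherence r (m + 2)) \<le> real (m + 2) * (p (m + 2) + p m)"
        using pair_coherence_le[of "m + 2"] by simp
      also have "\<dots> \<le> (N + 1) * S"
        using pp by (intro mult_mono) (auto simp: N_def S_def)
      finally show ?thesis .
    qed
    then have "\<beta>\<^sup>2 * ((N + 2) * (2 * cmod (pair_coherence r (m + 2)))) \<le> \<beta>\<^sup>2 * ((N + 2) * ((N + 1) * S))"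
      using N by (intro mult_left_mono) auto
    also have "\<dots> = \<beta>\<^sup>2 * (((N + 2) * (N + 1)) * S)" by (simp only: mult.assoc)
    also have "\<dots> \<le> \<beta>\<^sup>2 * ((6 * (N * N)) * S)"
      by (intro mult_left_mono mult_right_mono N2 S) auto
    finally have *: "\<beta>\<^sup>2 * ((N + 2) * (2 * cmod (pair_coherence r (m + 2)))) \<le> \<beta>\<^sup>2 * ((6 * (N * N)) * S)" .
    have "cmod (of_nat (m + 3)) = N + 2" unfolding norm_of_nat by (simp add: N_def)
    then have "cmod (2 * of_real (\<beta>\<^sup>2) * (of_nat (m + 3) * pair_coherence r (m + 2)))
        = \<beta>\<^sup>2 * ((N + 2) * (2 * cmod (pair_coherence r (m + 2))))"
      by (simp add: norm_mult norm_power)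
    then show ?thesis using * by (simp add: mult_ac)
  qed
  have 3: "cmod (of_real (\<alpha> * \<beta> * (real (m + 1) * real (m + 2) * p (m + 2) - real (m + 1) * real (m + 4) * p (m + 1))))
      \<le> 6 * \<bar>\<alpha> * \<beta>\<bar> * (N * N * S)"
  proof -
    define u v where "u = N * (N + 1) * p (m + 2)" and "v = N * (N + 3) * p (m + 1)"
    have "0 \<le> u" "0 \<le> v" using N pp by (auto simp: u_def v_def)
    moreover have "u \<le> 2 * (N * N) * S" unfolding u_def
      using N pp by (intro mult_mono N2) (auto simp: S_def)
    moreover have "v \<le> 4 * (N * N) * S" unfolding v_def
      using N pp by (intro mult_mono N2) (auto simp: S_def)
    ultimately have "\<bar>u - v\<bar> \<le> 6 * (N * N * S)" unfolding mult.assoc by linarith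
    then have "\<bar>\<alpha> * \<beta>\<bar> * \<bar>u - v\<bar> \<le> \<bar>\<alpha> * \<beta>\<bar> * (6 * (N * N * S))" by (intro mult_left_mono) auto
    moreover have "real (m + 1) * real (m + 2) * p (m + 2) - real (m + 1) * real (m + 4) * p (m + 1) = u - v"
      by (simp add: u_def v_def N_def add.commute)
    ultimately show ?thesis by (simp only: norm_of_real abs_mult mult_ac)
  qed
  have "cmod (pair_defect \<alpha> \<beta> m) \<le> 3 * \<alpha>\<^sup>2 * (N * N * S) + 6 * \<beta>\<^sup>2 * (N * N * S) + 6 * \<bar>\<alpha> * \<beta>\<bar> * (N * N * S)"
    unfolding pair_defect_def by (intro order_trans[OF norm_triangle_ineq4] add_mono 1 2 3)
  then show ?thesis unfolding sp N_def[symmetric] by (simp add: algebra_simps)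
qed

text \<open>The weight of a step-4 coherence is quadratic, and division by R + 1 leaves the linear
  weight of \<open>spread\<close>. The 8 is half of the 16 in (N + 3)^2 <= (4 N)^2.\<close>

lemma quad_boundary_le: "cmod (quad_coherence r (R + 4) / of_nat (Suc R)) \<le> 8 * spread R"
proof -
  define N where "N = real (Suc R)"
  have N: "N \<ge> 1" by (simp add: N_def)
  have pp: "p R \<ge> 0" "p (R + 1) \<ge> 0" "p (R + 2) \<ge> 0" "p (R + 3) \<ge> 0" "p (R + 4) \<ge> 0"
    by (auto intro: nonneg)
  have "2 * cmod (quad_coherence r (R + 4)) \<le> (N + 3)\<^sup>2 * (p (R + 4) + p R)"
    using quad_coherence_le[of "R + 4"] by (simp add: N_def add.commute)
  also have "\<dots> \<le> (4 * N)\<^sup>2 * (p (R + 4) + p R)"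
    using N pp by (intro mult_right_mono power_mono) auto
  also have "\<dots> = 16 * N * (N * (p (R + 4) + p R))" by (simp add: power2_eq_square)
  also have "\<dots> \<le> 16 * N * spread R"
  proof (rule mult_left_mono)
    have "0 \<le> N * p (R + 1)" "0 \<le> N * p (R + 2)" "0 \<le> N * p (R + 3)" using N pp by auto
    then show "N * (p (R + 4) + p R) \<le> spread R"
      unfolding spread_def N_def[symmetric] by (simp add: distrib_left)
  qed (use N in auto)
  finally have "cmod (quad_coherence r (R + 4)) \<le> 8 * spread R * N" by (simp add: mult_ac)
  then show ?thesis
    unfolding norm_divide norm_of_nat N_def[symmetric] using N by (simp add: field_simps)
qed

lemma pair_defect_avg_le:
  "cmod ((\<Sum>m\<le>R. pair_defect \<alpha> \<beta> m) / of_nat (Suc R))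
    \<le> (3 * \<alpha>\<^sup>2 + 6 * \<beta>\<^sup>2 + 6 * \<bar>\<alpha> * \<beta>\<bar>) * ((\<Sum>m\<le>R. real (Suc m) * spread m) / real (Suc R))"
proof -
  have "cmod (\<Sum>m\<le>R. pair_defect \<alpha> \<beta> m)
      \<le> (\<Sum>m\<le>R. (3 * \<alpha>\<^sup>2 + 6 * \<beta>\<^sup>2 + 6 * \<bar>\<alpha> * \<beta>\<bar>) * (real (Suc m) * spread m))"
    by (intro sum_norm_le pair_defect_le)
  then show ?thesis
    unfolding norm_divide norm_of_nat sum_distrib_left[symmetric] times_divide_eq_right
    by (intro divide_right_mono) auto
qed

text \<open>The 16 adds 2 for the missing trace, 6 for the averaged boundary terms and 8 for the
  leftover quadruple coherence; the 5 counts the shifts in \<open>spread\<close>.\<close>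

lemma pair_avg_defect_le:
  "cmod (pair_avg_defect \<alpha> \<beta> R)
    \<le> (3 * \<alpha>\<^sup>2 + 6 * \<beta>\<^sup>2 + 16 * \<bar>\<alpha> * \<beta>\<bar>) * (5 * (1 + (\<Sum>n. real n * p n)))"
proof -
  define E where "E = (\<Sum>n. real n * p n)"
  define B where "B = 5 * (1 + E)"
  have E: "E \<ge> 0" unfolding E_def by (rule mean_nonneg[OF mean])
  have 1: "cmod (of_real (2 * \<alpha> * \<beta> * (trunc_mean p (Suc R) / real (Suc R)))) \<le> 2 * \<bar>\<alpha> * \<beta>\<bar> * B"
  proof -
    have "trunc_mean p (Suc R) / real (Suc R) \<le> trunc_mean p (Suc R) / 1"
      using trunc_mean_nonneg[of "Suc R"] by (intro divide_left_mono) auto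
    also have "\<dots> \<le> B" using trunc_mean_le_mean[OF mean, of "Suc R"] E by (simp add: B_def E_def)
    finally have "2 * \<bar>\<alpha> * \<beta>\<bar> * (trunc_mean p (Suc R) / real (Suc R)) \<le> 2 * \<bar>\<alpha> * \<beta>\<bar> * B"
      by (intro mult_left_mono) auto
    moreover have "0 \<le> trunc_mean p (Suc R) / real (Suc R)" using trunc_mean_nonneg[of "Suc R"] by simp
    ultimately show ?thesis by (simp only: norm_of_real abs_mult abs_of_nonneg abs_numeral mult.assoc)
  qed
  have "(\<Sum>m\<le>R. real (Suc m) * spread m) / real (Suc R) \<le> B"
    using weighted_average_le[OF spread_summable spread_nonneg, of R] spread_suminf_le by (simp add: B_def E_def)
  then have 2: "cmod ((\<Sum>m\<le>R. pair_defect \<alpha> \<beta> m) / of_nat (Suc R)) \<le> (3 * \<alpha>\<^sup>2 + 6 * \<beta>\<^sup>2 + 6 * \<bar>\<alpha> * \<beta>\<bar>) * B"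
    by (intro order_trans[OF pair_defect_avg_le] mult_left_mono) auto
  have "spread R \<le> B"
    using sum_le_suminf[OF spread_summable, of "{R}"] spread_suminf_le spread_nonneg by (simp add: B_def E_def)
  then have "cmod (quad_coherence r (R + 4) / of_nat (Suc R)) \<le> 8 * B"
    using quad_boundary_le[of R] by linarith
  then have "\<bar>\<alpha> * \<beta>\<bar> * cmod (quad_coherence r (R + 4) / of_nat (Suc R)) \<le> \<bar>\<alpha> * \<beta>\<bar> * (8 * B)"
    by (rule mult_left_mono) auto
  then have 3: "cmod (of_real (\<alpha> * \<beta>) * (quad_coherence r (R + 4) / of_nat (Suc R))) \<le> 8 * \<bar>\<alpha> * \<beta>\<bar> * B"
    unfolding norm_mult norm_of_real by (simp only: mult_ac)
  have "cmod (pair_avg_defect \<alpha> \<beta> R) \<le> 2 * \<bar>\<alpha> * \<beta>\<bar> * B + (3 * \<alpha>\<^sup>2 + 6 * \<beta>\<^sup>2 + 6 * \<bar>\<alpha> * \<beta>\<bar>) * B + 8 * \<bar>\<alpha> * \<beta>\<bar> * B"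
    unfolding pair_avg_defect_def
    by (intro order_trans[OF norm_triangle_ineq4] add_mono order_trans[OF norm_triangle_ineq] 1 2 3)
  then show ?thesis unfolding E_def[symmetric] B_def[symmetric] by (simp add: algebra_simps)
qed

lemma pair_avg_defect_tendsto: "(\<lambda>R. pair_avg_defect \<alpha> \<beta> R) \<longlonglongrightarrow> 0"
proof -
  have "(\<lambda>R. trunc_mean p (Suc R) * inverse (real (Suc R))) \<longlonglongrightarrow> (\<Sum>n. real n * p n) * 0"
    by (intro tendsto_mult LIMSEQ_Suc[OF trunc_mean_tendsto[OF mean]] LIMSEQ_inverse_real_of_nat)
  then have A: "(\<lambda>R. of_real (2 * \<alpha> * \<beta> * (trunc_mean p (Suc R) / real (Suc R))) :: complex) \<longlonglongrightarrow> of_real (2 * \<alpha> * \<beta> * 0)"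
    unfolding divide_inverse by (intro tendsto_intros) simp
  have B: "(\<lambda>R. (\<Sum>m\<le>R. pair_defect \<alpha> \<beta> m) / of_nat (Suc R)) \<longlonglongrightarrow> 0"
  proof (rule Lim_null_comparison)
    show "(\<lambda>R. (3 * \<alpha>\<^sup>2 + 6 * \<beta>\<^sup>2 + 6 * \<bar>\<alpha> * \<beta>\<bar>) * ((\<Sum>m\<le>R. real (Suc m) * spread m) / real (Suc R))) \<longlonglongrightarrow> 0"
      by (intro tendsto_mult_right_zero weighted_average_tendsto_0 spread_summable spread_nonneg)
  qed (use pair_defect_avg_le in auto)
  have C: "(\<lambda>R. quad_coherence r (R + 4) / of_nat (Suc R)) \<longlonglongrightarrow> 0"
  proof (rule Lim_null_comparison)
    show "(\<lambda>R. 8 * spread R) \<longlonglongrightarrow> 0"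
      by (intro tendsto_mult_right_zero summable_LIMSEQ_zero[OF spread_summable])
  qed (use quad_boundary_le in auto)
  have "(\<lambda>R. pair_avg_defect \<alpha> \<beta> R) \<longlonglongrightarrow> of_real (2 * \<alpha> * \<beta> * 0) + 0 - of_real (\<alpha> * \<beta>) * 0"
    unfolding pair_avg_defect_def
    by (rule tendsto_diff[OF tendsto_add[OF A B] tendsto_mult[OF tendsto_const C]])
  then show ?thesis by simp
qed

lemma pair_coherence_summable: "summable (\<lambda>n. norm (pair_coherence r (n + 2)))"
proof (rule summable_comparison_test'[where N = 0 and g = spread])
  show "summable spread" by (rule spread_summable)
  fix n :: nat
  have "2 * cmod (pair_coherence r (n + 2)) \<le> real (n + 2) * (p (n + 2) + p n)"
    using pair_coherence_le[of "n + 2"] by simp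
  also have "\<dots> \<le> (2 * real (Suc n)) * (p (n + 2) + p n)"
    by (intro mult_right_mono add_nonneg_nonneg nonneg) auto
  also have "\<dots> \<le> 2 * spread n"
  proof -
    have "0 \<le> real (Suc n) * p (n + 1)" "0 \<le> real (Suc n) * p (n + 3)" "0 \<le> real (Suc n) * p (n + 4)"
      by (intro mult_nonneg_nonneg nonneg; simp)+
    then show ?thesis unfolding spread_def by (simp add: distrib_left mult.assoc del: of_nat_Suc)
  qed
  finally show "norm (norm (pair_coherence r (n + 2))) \<le> spread n" by simp
qed

lemma pair_avg_tendsto: "pair_avg \<longlonglongrightarrow> (\<Sum>n. pair_coherence r (n + 2))"
  unfolding pair_avg_def[abs_def] by (rule cesaro_summable_tendsto[OF pair_coherence_summable])

end

end

section \<open>Time evolution of the moments\<close>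

locale lindblad_evolution =
  fixes \<alpha> \<beta> \<Omega> :: real and r :: "real \<Rightarrow> nat \<Rightarrow> nat \<Rightarrow> complex"
  assumes state: "t \<ge> 0 \<Longrightarrow> density_matrix (r t)"
    and evolution: "t \<ge> 0 \<Longrightarrow> ((\<lambda>s. r s j k) has_vector_derivative lindblad_matrix_rhs \<alpha> \<beta> \<Omega> (r t) j k) (at t within {0..})"
    and damping: "\<beta>\<^sup>2 < \<alpha>\<^sup>2"
    and mean_0: "summable (\<lambda>n. real n * diagonal (r 0) n)"
begin

definition mean :: "real \<Rightarrow> real" where
  "mean t = (\<Sum>n. real n * diagonal (r t) n)"

definition pair_mean :: "real \<Rightarrow> complex" where
  "pair_mean t = (\<Sum>n. pair_coherence (r t) (n + 2))"

lemma distr: "t \<ge> 0 \<Longrightarrow> distribution (diagonal (r t))"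
proof -
  assume "t \<ge> 0"
  then interpret density_matrix "r t" by (rule state)
  show ?thesis by unfold_locales
qed

lemma trunc_mean_derivative:
  assumes "t \<ge> 0"
  shows "((\<lambda>s. trunc_mean (diagonal (r s)) R) has_real_derivative
     density_matrix.trunc_mean_rate (r t) \<alpha> \<beta> R) (at t within {0..})"
proof -
  have "((\<lambda>s. diagonal (r s) n) has_real_derivative Re (lindblad_matrix_rhs \<alpha> \<beta> \<Omega> (r t) n n)) (at t within {0..})" for n
    unfolding diagonal_def by (rule has_field_derivative_Re[OF evolution[OF assms]])
  then have "((\<lambda>s. trunc_mean (diagonal (r s)) R) has_real_derivative
      (\<Sum>n<R. 0 - (\<Sum>i\<le>n. Re (lindblad_matrix_rhs \<alpha> \<beta> \<Omega> (r t) i i)))) (at t within {0..})"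
    unfolding trunc_mean_def by (intro DERIV_sum DERIV_diff DERIV_const)
  then show ?thesis
    by (simp only: diff_0 density_matrix.trunc_mean_rate_eq[OF state[OF assms]])
qed

definition growth :: real where "growth = 2 * \<beta>\<^sup>2 + 3 * \<bar>\<alpha> * \<beta>\<bar>"

lemma trunc_mean_bounded:
  assumes "t \<ge> 0"
  shows "trunc_mean (diagonal (r t)) R \<le> exp (growth * t) * (1 + mean 0)"
proof -
  \<comment> \<open>The rate is affine in the truncated mean; adding 1 makes the differential
    inequality homogeneous.\<close>
  have "1 + trunc_mean (diagonal (r t)) R \<le> exp (growth * t) * (1 + trunc_mean (diagonal (r 0)) R)"
  proof (rule gronwall[OF _ _ assms])
    fix s :: real assume s: "s \<ge> 0"
    show "((\<lambda>s. 1 + trunc_mean (diagonal (r s)) R) has_real_derivative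
        density_matrix.trunc_mean_rate (r s) \<alpha> \<beta> R) (at s within {0..})"
      by (auto intro!: derivative_eq_intros trunc_mean_derivative s)
    show "density_matrix.trunc_mean_rate (r s) \<alpha> \<beta> R \<le> growth * (1 + trunc_mean (diagonal (r s)) R)"
      unfolding growth_def by (rule density_matrix.trunc_mean_rate_le[OF state[OF s]])
  qed
  also have "\<dots> \<le> exp (growth * t) * (1 + mean 0)"
    using distribution.trunc_mean_le_mean[OF distr mean_0, of R]
    by (intro mult_left_mono) (auto simp: mean_def)
  finally show ?thesis by simp
qed

lemma mean_summable: "t \<ge> 0 \<Longrightarrow> summable (\<lambda>n. real n * diagonal (r t) n)"
  by (rule distribution.summable_of_trunc_mean_bounded[OF distr trunc_mean_bounded])

lemma trunc_mean_tendsto: "t \<ge> 0 \<Longrightarrow> (\<lambda>R. trunc_mean (diagonal (r t)) R) \<longlonglongrightarrow> mean t"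
  using distribution.trunc_mean_tendsto[OF distr mean_summable] by (simp add: mean_def)

lemma mean_nonneg: "t \<ge> 0 \<Longrightarrow> 0 \<le> mean t"
  using distribution.mean_nonneg[OF distr mean_summable] by (simp add: mean_def)

text \<open>The truncated bounds pass to the limit in the cutoff, and the time s is replaced by t,
  since one constant has to dominate the defects on the whole interval.\<close>

lemma mean_bounded:
  assumes "0 \<le> s" "s \<le> t"
  shows "mean s \<le> exp (growth * t) * (1 + mean 0)"
proof -
  have "mean s \<le> exp (growth * s) * (1 + mean 0)"
    by (rule LIMSEQ_le_const2[OF trunc_mean_tendsto]) (use trunc_mean_bounded assms in auto)
  also have "\<dots> \<le> exp (growth * t) * (1 + mean 0)"
    using assms mean_nonneg[of 0] by (intro mult_right_mono) (auto simp: growth_def intro!: mult_left_mono)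
  finally show ?thesis .
qed

lemma mean_eq:
  assumes "t \<ge> 0"
  shows "mean t = exp (- 2 * (\<alpha>\<^sup>2 - \<beta>\<^sup>2) * t) * (mean 0 - \<beta>\<^sup>2 / (\<alpha>\<^sup>2 - \<beta>\<^sup>2)) + \<beta>\<^sup>2 / (\<alpha>\<^sup>2 - \<beta>\<^sup>2)"
proof -
  define g where "g = \<alpha>\<^sup>2 - \<beta>\<^sup>2"
  have g: "g > 0" using damping by (simp add: g_def)
  define M where "M = (2 * \<alpha>\<^sup>2 + 6 * \<beta>\<^sup>2 + 3 * \<bar>\<alpha> * \<beta>\<bar>) * (1 + exp (growth * t) * (1 + mean 0))"
  \<comment> \<open>The real equation is read over the complex numbers so that the same limit lemma
    serves both moments. Its fixed point -d / c is \<beta>^2 / g.\<close>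
  have "complex_of_real (mean t) = exp (of_real (- 2 * g) * of_real t) * (of_real (mean 0) + of_real (2 * \<beta>\<^sup>2) / of_real (- 2 * g))
      - of_real (2 * \<beta>\<^sup>2) / of_real (- 2 * g)"
  proof (rule ode_limit[where u = "\<lambda>R s. complex_of_real (trunc_mean (diagonal (r s)) R)" and M = M
        and err = "\<lambda>R s. complex_of_real (density_matrix.trunc_mean_defect (r s) \<alpha> \<beta> R)"])
    fix R :: nat and s :: real assume s: "0 \<le> s"
    show "((\<lambda>s. complex_of_real (trunc_mean (diagonal (r s)) R)) has_vector_derivative
        of_real (- 2 * g) * of_real (trunc_mean (diagonal (r s)) R) + of_real (2 * \<beta>\<^sup>2)
          + of_real (density_matrix.trunc_mean_defect (r s) \<alpha> \<beta> R)) (at s within {0..})"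
      using has_vector_derivative_of_real[OF trunc_mean_derivative[OF s, of R]]
      unfolding density_matrix.trunc_mean_rate_defect[OF state[OF s]] by (simp add: g_def)
    assume "s \<le> t"
    have "\<bar>density_matrix.trunc_mean_defect (r s) \<alpha> \<beta> R\<bar> \<le> (2 * \<alpha>\<^sup>2 + 6 * \<beta>\<^sup>2 + 3 * \<bar>\<alpha> * \<beta>\<bar>) * (1 + mean s)"
      unfolding mean_def by (rule density_matrix.trunc_mean_defect_le[OF state[OF s] mean_summable[OF s]])
    also have "\<dots> \<le> M"
      unfolding M_def using mean_bounded[OF s \<open>s \<le> t\<close>] by (intro mult_left_mono) auto
    finally show "norm (complex_of_real (density_matrix.trunc_mean_defect (r s) \<alpha> \<beta> R)) \<le> M" by simp
  next
    fix s :: real assume s: "0 \<le> s"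
    show "(\<lambda>R. complex_of_real (density_matrix.trunc_mean_defect (r s) \<alpha> \<beta> R)) \<longlonglongrightarrow> 0"
      using tendsto_of_real[OF density_matrix.trunc_mean_defect_tendsto[OF state[OF s] mean_summable[OF s]], where 'a = complex] by simp
    show "(\<lambda>R. complex_of_real (trunc_mean (diagonal (r s)) R)) \<longlonglongrightarrow> of_real (mean s)"
      by (intro tendsto_of_real trunc_mean_tendsto s)
  qed (use g assms in auto)
  also have "\<dots> = of_real (exp (- 2 * g * t) * (mean 0 - \<beta>\<^sup>2 / g) + \<beta>\<^sup>2 / g)"
    using g by (simp add: exp_of_real[symmetric])
  finally show ?thesis unfolding of_real_eq_iff g_def .
qed

lemma pair_mean_eq:
  assumes "t \<ge> 0"
  defines "z \<equiv> of_real (\<alpha>\<^sup>2 - \<beta>\<^sup>2) + \<i> * of_real \<Omega>"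
  shows "pair_mean t = exp (- 2 * z * of_real t) * (pair_mean 0 + of_real (\<alpha> * \<beta>) / z) - of_real (\<alpha> * \<beta>) / z"
proof -
  have z: "z \<noteq> 0" using damping by (auto simp: z_def complex_eq_iff)
  define M where "M = (3 * \<alpha>\<^sup>2 + 6 * \<beta>\<^sup>2 + 16 * \<bar>\<alpha> * \<beta>\<bar>) * (5 * (1 + exp (growth * t) * (1 + mean 0)))"
  \<comment> \<open>Below, \<open>pair_avg\<close> is written out: its defining equation holds under
    the assumption that the state is a density matrix, known at nonnegative times, whereas the
    derivative concerns a function of s.\<close>
  have "pair_mean t = exp (- 2 * z * of_real t) * (pair_mean 0 + - 2 * of_real (\<alpha> * \<beta>) / (- 2 * z))
      - - 2 * of_real (\<alpha> * \<beta>) / (- 2 * z)"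
  proof (rule ode_limit[where u = "\<lambda>R s. (\<Sum>m\<le>R. \<Sum>n\<le>m. pair_coherence (r s) (n + 2)) / of_nat (Suc R)" and M = M
        and err = "\<lambda>R s. density_matrix.pair_avg_defect (r s) \<alpha> \<beta> R"])
    fix R :: nat and s :: real assume s: "0 \<le> s"
    note D = state[OF s] mean_summable[OF s]
    have "((\<lambda>s. pair_coherence (r s) (n + 2)) has_vector_derivative
       of_real (sqrt (real (n + 2) * real (n + 1))) * lindblad_matrix_rhs \<alpha> \<beta> \<Omega> (r s) (n + 2) n) (at s within {0..})" for n
      unfolding pair_coherence_def
      using has_vector_derivative_mult_right[OF evolution[OF s, of "n + 2" n], of "of_real (sqrt (real (n + 2) * real (n + 1)))"]
      by simp
    then have "((\<lambda>s. (\<Sum>m\<le>R. \<Sum>n\<le>m. pair_coherence (r s) (n + 2)) / of_nat (Suc R)) has_vector_derivative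
       (\<Sum>m\<le>R. \<Sum>n\<le>m. of_real (sqrt (real (n + 2) * real (n + 1))) * lindblad_matrix_rhs \<alpha> \<beta> \<Omega> (r s) (n + 2) n)
        / of_nat (Suc R)) (at s within {0..})"
      by (intro has_vector_derivative_divide has_vector_derivative_sum)
    then show "((\<lambda>s. (\<Sum>m\<le>R. \<Sum>n\<le>m. pair_coherence (r s) (n + 2)) / of_nat (Suc R)) has_vector_derivative
       - 2 * z * ((\<Sum>m\<le>R. \<Sum>n\<le>m. pair_coherence (r s) (n + 2)) / of_nat (Suc R)) + - 2 * of_real (\<alpha> * \<beta>)
         + density_matrix.pair_avg_defect (r s) \<alpha> \<beta> R) (at s within {0..})"
      unfolding density_matrix.pair_avg_rate[OF D(1)] density_matrix.pair_avg_def[OF D(1)] z_def by simp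
    assume "s \<le> t"
    have "cmod (density_matrix.pair_avg_defect (r s) \<alpha> \<beta> R) \<le> (3 * \<alpha>\<^sup>2 + 6 * \<beta>\<^sup>2 + 16 * \<bar>\<alpha> * \<beta>\<bar>) * (5 * (1 + mean s))"
      unfolding mean_def by (rule density_matrix.pair_avg_defect_le[OF D])
    also have "\<dots> \<le> M"
      unfolding M_def using mean_bounded[OF s \<open>s \<le> t\<close>] by (intro mult_left_mono) auto
    finally show "norm (density_matrix.pair_avg_defect (r s) \<alpha> \<beta> R) \<le> M" .
  next
    fix s :: real assume s: "0 \<le> s"
    note D = state[OF s] mean_summable[OF s]
    show "(\<lambda>R. density_matrix.pair_avg_defect (r s) \<alpha> \<beta> R) \<longlonglongrightarrow> 0"
      by (rule density_matrix.pair_avg_defect_tendsto[OF D])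
    show "(\<lambda>R. (\<Sum>m\<le>R. \<Sum>n\<le>m. pair_coherence (r s) (n + 2)) / of_nat (Suc R)) \<longlonglongrightarrow> pair_mean s"
      using density_matrix.pair_avg_tendsto[OF D]
      unfolding pair_mean_def density_matrix.pair_avg_def[OF D(1), abs_def] .
  qed (use z assms(1) in auto)
  then show ?thesis using z by simp
qed

end

section \<open>Schwartz functions\<close>

text \<open>A class that contains the oscillator eigenfunctions and is closed under
  \<open>ddx\<close> and under multiplication by polynomials.\<close>

definition gauss_poly :: "real \<Rightarrow> complex poly \<Rightarrow> real \<Rightarrow> complex" where
  "gauss_poly a p x = poly p (complex_of_real x) * complex_of_real (exp (- a * x\<^sup>2))"

lemma gauss_poly_has_vector_derivative:
  "(gauss_poly a p has_vector_derivative
     gauss_poly a (pderiv p - smult (2 * complex_of_real a) (pCons 0 p)) x) (at x)"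
proof -
  let ?F = "\<lambda>z. poly p z * exp (- complex_of_real a * z\<^sup>2)"
  have "(?F has_field_derivative
      gauss_poly a (pderiv p - smult (2 * complex_of_real a) (pCons 0 p)) x) (at (complex_of_real x))"
    unfolding gauss_poly_def
    by (auto intro!: derivative_eq_intros simp: exp_of_real[symmetric] algebra_simps)
  then have "((\<lambda>x. ?F (complex_of_real x)) has_vector_derivative
      gauss_poly a (pderiv p - smult (2 * complex_of_real a) (pCons 0 p)) x) (at x)"
    by (rule has_vector_derivative_real_field)
  moreover have "(\<lambda>x. ?F (complex_of_real x)) = gauss_poly a p"
    by (auto simp: gauss_poly_def exp_of_real[symmetric])
  ultimately show ?thesis by simp
qed

lemma ddx_gauss_poly:
  "ddx (gauss_poly a p) = gauss_poly a (pderiv p - smult (2 * complex_of_real a) (pCons 0 p))"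
  unfolding ddx_def by (rule ext, rule vector_derivative_at, rule gauss_poly_has_vector_derivative)

lemma gauss_poly_differentiable: "gauss_poly a p differentiable (at x)"
  using gauss_poly_has_vector_derivative[of a p x] differentiableI_vector by blast

text \<open>One term of the exponential series gives (a x^2)^n <= n! exp (a x^2). The summand 1
  covers |x| <= 1, where |x|^n may exceed x^(2n).\<close>

lemma power_gauss_bounded:
  fixes a x :: real
  assumes "a > 0"
  shows "\<bar>x\<bar> ^ n * exp (- a * x\<^sup>2) \<le> 1 + fact n / a ^ n"
proof -
  have "sum (\<lambda>k. (a * x\<^sup>2) ^ k /\<^sub>R fact k) {n} \<le> suminf (\<lambda>k. (a * x\<^sup>2) ^ k /\<^sub>R fact k)"
    by (rule sum_le_suminf) (use assms in \<open>auto simp: summable_exp intro!: mult_nonneg_nonneg\<close>)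
  then have "(a * x\<^sup>2) ^ n / fact n \<le> exp (a * x\<^sup>2)"
    by (simp add: exp_def divide_inverse_commute)
  then have "(a * x\<^sup>2) ^ n * exp (- a * x\<^sup>2) \<le> fact n"
    by (simp add: exp_minus field_simps)
  then have "(x\<^sup>2) ^ n * exp (- a * x\<^sup>2) \<le> fact n / a ^ n"
    using assms by (simp add: field_simps power_mult_distrib)
  moreover have "\<bar>x\<bar> ^ n \<le> 1 + (x\<^sup>2) ^ n"
  proof (cases "\<bar>x\<bar> \<le> 1")
    case True
    then have "\<bar>x\<bar> ^ n \<le> 1" by (simp add: power_le_one)
    then show ?thesis by (smt (verit) zero_le_power zero_le_power2)
  next
    case False
    then have "\<bar>x\<bar> \<le> x\<^sup>2"
      by (metis abs_ge_self abs_square_le_1 linorder_le_cases mult.right_neutral mult_left_mono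
          power2_abs power2_eq_square abs_ge_zero)
    then have "\<bar>x\<bar> ^ n \<le> (x\<^sup>2) ^ n" by (intro power_mono) auto
    then show ?thesis by simp
  qed
  then have "\<bar>x\<bar> ^ n * exp (- a * x\<^sup>2) \<le> (1 + (x\<^sup>2) ^ n) * exp (- a * x\<^sup>2)"
    by (intro mult_right_mono) auto
  moreover have "exp (- a * x\<^sup>2) \<le> 1" using assms by simp
  ultimately show ?thesis unfolding distrib_right by linarith
qed

text \<open>The factor x of \<open>pCons\<close> is absorbed into the power, for which the induction
  leaves j arbitrary.\<close>

lemma bounded_power_gauss_poly:
  assumes "a > 0"
  shows "bounded (range (\<lambda>x. complex_of_real (x ^ j) * gauss_poly a p x))"
proof (induction p arbitrary: j)
  case 0
  then show ?case by (auto simp: gauss_poly_def intro: boundedI[of _ 0])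
next
  case (pCons c p)
  let ?f = "\<lambda>x. complex_of_real (x ^ j) * gauss_poly a [:c:] x"
  have "bounded (range ?f)"
  proof (intro boundedI, safe)
    fix x
    have "norm (?f x) = cmod c * (\<bar>x\<bar> ^ j * exp (- a * x\<^sup>2))"
      by (simp add: gauss_poly_def norm_mult norm_power)
    also have "\<dots> \<le> cmod c * (1 + fact j / a ^ j)"
      by (intro mult_left_mono power_gauss_bounded assms) auto
    finally show "norm (?f x) \<le> cmod c * (1 + fact j / a ^ j)" .
  qed
  moreover have "(\<lambda>x. complex_of_real (x ^ j) * gauss_poly a (pCons c p) x)
      = (\<lambda>x. ?f x + complex_of_real (x ^ Suc j) * gauss_poly a p x)"
    by (auto simp: gauss_poly_def algebra_simps)
  ultimately show ?case
    using bounded_plus_comp[OF _ pCons.IH[of "Suc j"]] by metis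
qed

lemma ddx_pow_gauss_poly: "\<exists>q. (ddx ^^ k) (gauss_poly a p) = gauss_poly a q"
  by (induction k) (auto simp: ddx_gauss_poly)

lemma gauss_poly_schwartz:
  assumes "a > 0"
  shows "gauss_poly a p \<in> schwartz"
proof -
  have "(ddx ^^ k) (gauss_poly a p) differentiable at x" for k x
    using ddx_pow_gauss_poly[of k a p] gauss_poly_differentiable by metis
  moreover have "bounded (range (\<lambda>x. complex_of_real (x ^ j) * (ddx ^^ k) (gauss_poly a p) x))" for j k
    using ddx_pow_gauss_poly[of k a p] bounded_power_gauss_poly[OF assms] by metis
  ultimately show ?thesis by (simp add: schwartz_def)
qed

section \<open>Decay and integrability of Schwartz functions\<close>

lemma integrable_inverse_1_plus_square_lborel: "integrable lborel (\<lambda>x::real. inverse (1 + x\<^sup>2))"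
  using integrable_inverse_1_plus_square by (simp add: set_integrable_def einterval_def)

lemma integrable_of_quadratic_decay:
  fixes f :: "real \<Rightarrow> 'a::{banach,second_countable_topology}"
  assumes "f \<in> borel_measurable borel" "\<And>x. (1 + x\<^sup>2) * norm (f x) \<le> C"
  shows "integrable lborel f"
proof (rule Bochner_Integration.integrable_bound)
  show "integrable lborel (\<lambda>x::real. C * inverse (1 + x\<^sup>2))"
    using integrable_inverse_1_plus_square_lborel by simp
  show "f \<in> borel_measurable lborel" using assms(1) by simp
  have "norm (f x) \<le> norm (C * inverse (1 + x\<^sup>2))" for x
  proof -
    have "1 + x\<^sup>2 > 0" by (smt (verit) zero_le_power2)
    then have "norm (f x) \<le> C * inverse (1 + x\<^sup>2)"
      using assms(2)[of x] by (simp add: field_simps)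
    then show ?thesis by simp
  qed
  then show "AE x in lborel. norm (f x) \<le> norm (C * inverse (1 + x\<^sup>2))" by simp
qed

lemma schwartz_ddx:
  assumes "f \<in> schwartz"
  shows "ddx f \<in> schwartz"
proof -
  have "(ddx ^^ k) (ddx f) = (ddx ^^ Suc k) f" for k by (simp add: funpow_swap1)
  then show ?thesis using assms unfolding schwartz_def mem_Collect_eq by metis
qed

lemma schwartz_has_vector_derivative:
  assumes "f \<in> schwartz"
  shows "(f has_vector_derivative ddx f x) (at x)"
proof -
  have "(ddx ^^ 0) f differentiable at x" using assms unfolding schwartz_def by blast
  then show ?thesis by (simp add: ddx_def vector_derivative_works)
qed

lemma schwartz_isCont: "f \<in> schwartz \<Longrightarrow> isCont f x"
  using has_vector_derivative_continuous schwartz_has_vector_derivative by blast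

lemma schwartz_borel_measurable: "f \<in> schwartz \<Longrightarrow> f \<in> borel_measurable borel"
  by (intro borel_measurable_continuous_onI continuous_at_imp_continuous_on) (auto simp: schwartz_isCont)

text \<open>The definition of \<open>schwartz\<close> controls single monomials; the binomial
  theorem combines them into a weight that dominates all lower powers.\<close>

lemma schwartz_decay:
  assumes "f \<in> schwartz"
  obtains C where "C \<ge> 0" "\<And>x. (1 + \<bar>x\<bar>) ^ n * norm (f x) \<le> C"
proof -
  have "\<exists>C. \<forall>x. norm (complex_of_real (x ^ j) * f x) \<le> C" for j
  proof -
    have "bounded (range (\<lambda>x. complex_of_real (x ^ j) * (ddx ^^ 0) f x))"
      using assms unfolding schwartz_def by blast
    then show ?thesis by (auto simp: bounded_iff)
  qed
  then obtain C where C: "\<And>j x. norm (complex_of_real (x ^ j) * f x) \<le> C j" by metis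
  have eq: "(1 + \<bar>x\<bar>) ^ n * norm (f x)
      = (\<Sum>j\<le>n. of_nat (n choose j) * norm (complex_of_real (x ^ j) * f x))" for x
    by (subst add.commute, subst binomial_ring)
      (simp add: sum_distrib_right sum_distrib_left norm_mult norm_power mult_ac)
  have "(1 + \<bar>x\<bar>) ^ n * norm (f x) \<le> (\<Sum>j\<le>n. of_nat (n choose j) * C j)" for x
    unfolding eq by (intro sum_mono mult_left_mono C) auto
  then have "(1 + \<bar>x\<bar>) ^ n * norm (f x) \<le> \<bar>\<Sum>j\<le>n. of_nat (n choose j) * C j\<bar>" for x
    by (meson abs_ge_self order_trans)
  then show ?thesis using that by (meson abs_ge_zero)
qed

lemma one_plus_sq_le: "1 + x\<^sup>2 \<le> (1 + \<bar>x\<bar>)\<^sup>2" for x :: real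
  by (simp add: power2_eq_square algebra_simps)

text \<open>All the decay is taken from f, including two powers for an integrable majorant; g
  contributes a constant.\<close>

lemma schwartz_product_decay:
  assumes "f \<in> schwartz" "g \<in> schwartz"
  shows "\<exists>C. \<forall>x. (1 + x\<^sup>2) * ((1 + \<bar>x\<bar>) ^ n * (norm (f x) * norm (g x))) \<le> C"
proof -
  obtain C1 where C1: "C1 \<ge> 0" "\<And>x. (1 + \<bar>x\<bar>) ^ (n + 2) * norm (f x) \<le> C1"
    using schwartz_decay[OF assms(1)] by metis
  obtain C2 where C2: "C2 \<ge> 0" "\<And>x. (1 + \<bar>x\<bar>) ^ 0 * norm (g x) \<le> C2"
    using schwartz_decay[OF assms(2)] by metis
  have "(1 + x\<^sup>2) * ((1 + \<bar>x\<bar>) ^ n * (norm (f x) * norm (g x))) \<le> C1 * C2" for x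
  proof -
    have "(1 + x\<^sup>2) * ((1 + \<bar>x\<bar>) ^ n * (norm (f x) * norm (g x)))
        \<le> (1 + \<bar>x\<bar>)\<^sup>2 * ((1 + \<bar>x\<bar>) ^ n * (norm (f x) * norm (g x)))"
      by (intro mult_right_mono one_plus_sq_le) auto
    also have "\<dots> = ((1 + \<bar>x\<bar>) ^ (n + 2) * norm (f x)) * norm (g x)"
      by (simp add: power_add power2_eq_square mult_ac)
    also have "\<dots> \<le> C1 * C2"
      by (intro mult_mono C1) (use C1 C2 in auto)
    finally show ?thesis .
  qed
  then show ?thesis by blast
qed

lemma schwartz_product_integrable:
  assumes "f \<in> schwartz" "g \<in> schwartz" and [measurable]: "w \<in> borel_measurable borel"
    and "\<And>x. norm (w x) \<le> K * ((1 + \<bar>x\<bar>) ^ n * (norm (f x) * norm (g x)))" "K \<ge> 0"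
  shows "integrable lborel (w :: real \<Rightarrow> 'a::{banach,second_countable_topology})"
proof -
  obtain C where C: "\<And>x. (1 + x\<^sup>2) * ((1 + \<bar>x\<bar>) ^ n * (norm (f x) * norm (g x))) \<le> C"
    using schwartz_product_decay[OF assms(1,2)] by metis
  have "(1 + x\<^sup>2) * norm (w x) \<le> K * C" for x
  proof -
    have "(1 + x\<^sup>2) * norm (w x) \<le> (1 + x\<^sup>2) * (K * ((1 + \<bar>x\<bar>) ^ n * (norm (f x) * norm (g x))))"
      by (intro mult_left_mono assms) auto
    also have "\<dots> = K * ((1 + x\<^sup>2) * ((1 + \<bar>x\<bar>) ^ n * (norm (f x) * norm (g x))))"
      by (simp add: mult_ac)
    also have "\<dots> \<le> K * C" by (intro mult_left_mono C assms)
    finally show ?thesis .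
  qed
  then show ?thesis by (intro integrable_of_quadratic_decay) auto
qed

lemma schwartz_L2: "schwartz \<subseteq> L2"
proof
  fix f assume f: "f \<in> schwartz"
  have "integrable lborel (\<lambda>x. (norm (f x))\<^sup>2)"
    using f schwartz_borel_measurable[OF f]
    by (intro schwartz_product_integrable[OF f f, where K = 1 and n = 0]) (auto simp: power2_eq_square)
  then show "f \<in> L2" using schwartz_borel_measurable[OF f] by (auto simp: L2_def)
qed

section \<open>Ladder relations of the oscillator eigenfunctions\<close>

declare qho_basis.simps [simp del]

lemma ddx_lincomb:
  assumes "f \<in> schwartz" "g \<in> schwartz"
  shows "ddx (\<lambda>x. a * f x + b * g x) = (\<lambda>x. a * ddx f x + b * ddx g x)"
proof
  fix x
  have "((\<lambda>x. a * f x + b * g x) has_vector_derivative (a * ddx f x + b * ddx g x)) (at x)"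
    by (intro has_vector_derivative_add has_vector_derivative_mult_right
        schwartz_has_vector_derivative assms)
  then show "ddx (\<lambda>x. a * f x + b * g x) x = a * ddx f x + b * ddx g x"
    unfolding ddx_def[of "\<lambda>x. a * f x + b * g x"] by (rule vector_derivative_at)
qed

lemma ddx_cmult:
  assumes "f \<in> schwartz"
  shows "ddx (\<lambda>x. a * f x) = (\<lambda>x. a * ddx f x)"
  using ddx_lincomb[OF assms assms, of a 0] by simp

locale oscillator =
  fixes hbar m \<Omega> :: real
  assumes pos: "hbar > 0" "m > 0" "\<Omega> > 0"
begin

abbreviation e :: "nat \<Rightarrow> real \<Rightarrow> complex" where
  "e \<equiv> qho_basis hbar m \<Omega>"

text \<open>Standard deviation of the position in the ground state. In this unit
  \<open>x = x0 (a + a\<^sup>\<dagger>)\<close> and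
  \<open>d/dx = (a - a\<^sup>\<dagger>) / (2 x0)\<close>.\<close>

definition x0 :: real where
  "x0 = sqrt (hbar / (2 * m * \<Omega>))"

lemma x0_pos: "x0 > 0"
  using pos by (simp add: x0_def)

lemma x0_sq: "x0\<^sup>2 = hbar / (2 * m * \<Omega>)"
  using pos by (simp add: x0_def)

lemma creation_eq:
  "creation hbar m \<Omega> f x = of_real (1 / (2 * x0)) * (of_real x * f x) - of_real x0 * ddx f x"
proof -
  have s: "sqrt (m * \<Omega> / (2 * hbar)) = 1 / (2 * x0)"
  proof (rule real_sqrt_unique)
    show "(1 / (2 * x0))\<^sup>2 = m * \<Omega> / (2 * hbar)"
      using pos by (simp add: power_divide power_mult_distrib x0_sq field_simps)
  qed (use x0_pos in simp)
  have "1 / (2 * x0) * (hbar / (m * \<Omega>)) = x0"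
    using pos x0_pos x0_sq by (simp add: field_simps power2_eq_square)
  then have h: "complex_of_real (1 / (2 * x0)) * (of_real hbar / of_real (m * \<Omega>)) = of_real x0"
    by (metis of_real_divide of_real_mult)
  have "creation hbar m \<Omega> f x = of_real (1 / (2 * x0)) * (of_real x * f x)
      - (complex_of_real (1 / (2 * x0)) * (of_real hbar / of_real (m * \<Omega>))) * ddx f x"
    unfolding creation_def s position_def momentum_def by (simp add: algebra_simps)
  then show ?thesis by (simp only: h)
qed

lemma basis_gauss_poly: "\<exists>p. e n = gauss_poly (m * \<Omega> / (2 * hbar)) p"
proof (induction n)
  case 0
  have "e 0 = gauss_poly (m * \<Omega> / (2 * hbar)) [:of_real ((m * \<Omega> / (pi * hbar)) powr (1 / 4)):]"
    by (auto simp: gauss_poly_def qho_basis.simps)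
  then show ?case by blast
next
  case (Suc n)
  let ?a = "m * \<Omega> / (2 * hbar)"
  obtain p where p: "e n = gauss_poly ?a p" using Suc by blast
  let ?q = "smult (of_real (1 / (2 * x0))) (pCons 0 p)
     + smult (- of_real x0) (pderiv p - smult (2 * complex_of_real ?a) (pCons 0 p))"
  have "e (Suc n) = gauss_poly ?a (smult (of_real (1 / sqrt (real (Suc n)))) ?q)"
    unfolding qho_basis.simps(2) creation_eq p ddx_gauss_poly
    by (auto simp: gauss_poly_def algebra_simps)
  then show ?case by blast
qed

lemma basis_schwartz: "e n \<in> schwartz"
proof -
  have "m * \<Omega> / (2 * hbar) > 0" using pos by simp
  then show ?thesis using basis_gauss_poly[of n] gauss_poly_schwartz by metis
qed

lemma ddx_basis_0: "ddx (e 0) x = - of_real (1 / (2 * x0\<^sup>2)) * of_real x * e 0 x"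
proof -
  let ?a = "m * \<Omega> / (2 * hbar)" and ?c = "complex_of_real ((m * \<Omega> / (pi * hbar)) powr (1 / 4))"
  have e: "e 0 = gauss_poly ?a [:?c:]" by (auto simp: gauss_poly_def qho_basis.simps)
  have a: "2 * complex_of_real ?a = of_real (1 / (2 * x0\<^sup>2))"
    unfolding x0_sq by simp
  show ?thesis unfolding e ddx_gauss_poly a by (simp add: gauss_poly_def pderiv_pCons)
qed

lemma raising_basis:
  "of_real (1 / (2 * x0)) * (of_real x * e n x) - of_real x0 * ddx (e n) x
    = of_real (sqrt (real (Suc n))) * e (Suc n) x"
  unfolding qho_basis.simps(2) creation_eq by (simp del: of_nat_Suc)

text \<open>Induction through the commutator: \<open>a a\<^sup>\<dagger> e n = a\<^sup>\<dagger> a e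
  n + e n = (n + 1) e n\<close>. For n = 0 the index n - 1 is 0, and the factor
  \<open>sqrt 0\<close> hides it.\<close>

lemma lowering_basis:
  "of_real (1 / (2 * x0)) * (of_real x * e n x) + of_real x0 * ddx (e n) x
    = of_real (sqrt (real n)) * e (n - 1) x"
proof (induction n arbitrary: x)
  case 0
  show ?case unfolding ddx_basis_0 using x0_pos by (simp add: field_simps power2_eq_square)
next
  case (Suc n)
  define A where "A = complex_of_real x0"
  define X where "X = complex_of_real x"
  have A: "A \<noteq> 0" using x0_pos by (simp add: A_def)
  have IH: "1 / (2 * A) * (of_real y * e n y) + A * ddx (e n) y = of_real (sqrt (real n)) * e (n - 1) y" for y
    using Suc.IH[of y] by (simp add: A_def)
  have en: "e n \<in> schwartz" "ddx (e n) \<in> schwartz" "e (n - 1) \<in> schwartz"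
    by (auto intro: basis_schwartz schwartz_ddx)
  note D = schwartz_has_vector_derivative[OF en(1), of x]
    schwartz_has_vector_derivative[OF en(2), of x] schwartz_has_vector_derivative[OF en(3), of x]
  have DX: "((\<lambda>y. complex_of_real y) has_vector_derivative 1) (at x)"
    by (auto intro!: derivative_eq_intros has_vector_derivative_of_real)
  have "((\<lambda>y. 1 / (2 * A) * (of_real y * e n y) + A * ddx (e n) y) has_vector_derivative
      1 / (2 * A) * (X * ddx (e n) x + 1 * e n x) + A * ddx (ddx (e n)) x) (at x)"
    unfolding X_def by (intro derivative_intros D DX)
  moreover have "((\<lambda>y. of_real (sqrt (real n)) * e (n - 1) y) has_vector_derivative
      of_real (sqrt (real n)) * ddx (e (n - 1)) x) (at x)"
    by (intro derivative_intros D)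
  \<comment> \<open>The induction hypothesis holds at every point, so both sides may be
    differentiated; this controls the second derivative of \<open>e n\<close>.\<close>
  ultimately have d2: "1 / (2 * A) * (X * ddx (e n) x + 1 * e n x) + A * ddx (ddx (e n)) x
      = of_real (sqrt (real n)) * ddx (e (n - 1)) x"
    unfolding IH by (rule vector_derivative_unique_at)
  define s where "s = complex_of_real (sqrt (real (Suc n)))"
  have s: "s \<noteq> 0" "s * s = of_nat n + 1"
    unfolding s_def using real_sqrt_mult_self[of "real (Suc n)"]
    by (simp_all flip: of_real_mult add: add.commute)
  have eS: "e (Suc n) = (\<lambda>y. (1 / s) * (1 / (2 * A) * (of_real y * e n y) - A * ddx (e n) y))"
    unfolding qho_basis.simps(2) creation_eq by (simp add: A_def s_def)
  have "(e (Suc n) has_vector_derivative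
      (1 / s) * (1 / (2 * A) * (X * ddx (e n) x + 1 * e n x) - A * ddx (ddx (e n)) x)) (at x)"
    unfolding eS X_def by (intro derivative_intros D DX)
  then have dS: "ddx (e (Suc n)) x
      = (1 / s) * (1 / (2 * A) * (X * ddx (e n) x + 1 * e n x) - A * ddx (ddx (e n)) x)"
    unfolding ddx_def[of "e (Suc n)"] by (rule vector_derivative_at)
  \<comment> \<open>The relation \<open>a\<^sup>\<dagger> a e n = n e n\<close>, from the raising
    relation at n - 1.\<close>
  have low: "of_real (sqrt (real n)) * (1 / (2 * A) * (X * e (n - 1) x) - A * ddx (e (n - 1)) x)
     = of_nat n * e n x"
  proof (cases n)
    case 0
    then show ?thesis by simp
  next
    case (Suc k)
    have "complex_of_real (sqrt (real n)) * of_real (sqrt (real n)) = of_nat n"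
      by (metis of_real_mult of_real_of_nat_eq of_nat_0_le_iff real_sqrt_mult_self abs_of_nat)
    then show ?thesis
      using raising_basis[of x k] Suc by (simp add: A_def X_def flip: mult.assoc del: of_nat_Suc)
  qed
  have "s * (1 / (2 * A) * (X * e (Suc n) x) + A * ddx (e (Suc n)) x) = s * (s * e n x)"
  proof -
    have "s * (1 / (2 * A) * (X * e (Suc n) x) + A * ddx (e (Suc n)) x)
      = X / (2 * A) * (1 / (2 * A) * (X * e n x) - A * ddx (e n) x)
         + A * (1 / (2 * A) * (X * ddx (e n) x + 1 * e n x) - A * ddx (ddx (e n)) x)"
      unfolding dS unfolding eS using s A by (simp add: field_simps X_def)
    also have "\<dots> = X / (2 * A) * (1 / (2 * A) * (X * e n x) + A * ddx (e n) x) + e n x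
         - A * (1 / (2 * A) * (X * ddx (e n) x + 1 * e n x) + A * ddx (ddx (e n)) x)"
      using A by (simp add: field_simps)
    \<comment> \<open>The commutator: exchanging the two first-order factors costs exactly
      \<open>e n x\<close>.\<close>
    also have "\<dots> = of_nat n * e n x + e n x"
      unfolding d2 IH[of x, folded X_def] low[symmetric] by (simp add: algebra_simps)
    also have "\<dots> = s * (s * e n x)" using s(2) by (simp add: algebra_simps flip: mult.assoc)
    finally show ?thesis .
  qed
  then show ?case using s(1) by (simp add: A_def X_def s_def)
qed

lemma position_basis:
  "of_real x * e n x = of_real x0 * (of_real (sqrt (real n)) * e (n - 1) x
     + of_real (sqrt (real (Suc n))) * e (Suc n) x)"
  unfolding lowering_basis[symmetric] raising_basis[symmetric] using x0_pos by (simp add: field_simps)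

lemma ddx_basis:
  "ddx (e n) x = of_real (1 / (2 * x0)) * (of_real (sqrt (real n)) * e (n - 1) x
     - of_real (sqrt (real (Suc n))) * e (Suc n) x)"
  unfolding lowering_basis[symmetric] raising_basis[symmetric] using x0_pos by (simp add: field_simps)

lemma position_position_basis:
  "(position \<circ> position) (e n) = (\<lambda>x. of_real (x0\<^sup>2) *
     (of_real (sqrt (real n * real (n - 1))) * e (n - 2) x + of_real (2 * real n + 1) * e n x
      + of_real (sqrt (real (Suc n) * real (n + 2))) * e (n + 2) x))"
proof
  fix x
  have "(position \<circ> position) (e n) x = of_real x0 * (of_real (sqrt (real n)) * (of_real x * e (n - 1) x)
     + of_real (sqrt (real (Suc n))) * (of_real x * e (Suc n) x))"
    by (simp add: position_def position_basis[of x n] algebra_simps)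
  \<comment> \<open>Going down and up again leads to \<open>e (Suc (n - 1))\<close>, which is
    \<open>e n\<close> for n > 0 only; at n = 0 its coefficient vanishes, hence the case
    split.\<close>
  also have "\<dots> = of_real (x0\<^sup>2) *
     (of_real (sqrt (real n) * sqrt (real (n - 1))) * e (n - 1 - 1) x
      + of_real (sqrt (real n) * sqrt (real n) + sqrt (real (Suc n)) * sqrt (real (Suc n))) * e n x
      + of_real (sqrt (real (Suc n)) * sqrt (real (n + 2))) * e (n + 2) x)"
    unfolding position_basis[of x "n - 1"] position_basis[of x "Suc n"]
    by (cases n) (simp_all add: algebra_simps power2_eq_square del: of_nat_Suc real_sqrt_mult_self)
  finally show "(position \<circ> position) (e n) x = of_real (x0\<^sup>2) *
     (of_real (sqrt (real n * real (n - 1))) * e (n - 2) x + of_real (2 * real n + 1) * e n x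
      + of_real (sqrt (real (Suc n) * real (n + 2))) * e (n + 2) x)"
    by (simp add: real_sqrt_mult numeral_2_eq_2)
qed

lemma ddx_ddx_basis:
  "ddx (ddx (e n)) x = of_real (1 / (4 * x0\<^sup>2)) *
     (of_real (sqrt (real n * real (n - 1))) * e (n - 2) x - of_real (2 * real n + 1) * e n x
      + of_real (sqrt (real (Suc n) * real (n + 2))) * e (n + 2) x)"
proof -
  have "ddx (e n) = (\<lambda>x. of_real (1 / (2 * x0) * sqrt (real n)) * e (n - 1) x
     + of_real (- (1 / (2 * x0)) * sqrt (real (Suc n))) * e (Suc n) x)"
    by (auto simp: ddx_basis[of n] algebra_simps)
  then have "ddx (ddx (e n)) x = of_real (1 / (2 * x0) * sqrt (real n)) * ddx (e (n - 1)) x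
     + of_real (- (1 / (2 * x0)) * sqrt (real (Suc n))) * ddx (e (Suc n)) x"
    by (simp only: ddx_lincomb[OF basis_schwartz basis_schwartz])
  also have "\<dots> = of_real (1 / (2 * x0) * (1 / (2 * x0))) *
     (of_real (sqrt (real n) * sqrt (real (n - 1))) * e (n - 1 - 1) x
      - of_real (sqrt (real n) * sqrt (real n) + sqrt (real (Suc n)) * sqrt (real (Suc n))) * e n x
      + of_real (sqrt (real (Suc n)) * sqrt (real (n + 2))) * e (n + 2) x)"
    unfolding ddx_basis[of "n - 1"] ddx_basis[of "Suc n"]
    by (cases n) (simp_all add: algebra_simps power2_eq_square del: of_nat_Suc real_sqrt_mult_self)
  finally show ?thesis
    by (simp add: real_sqrt_mult numeral_2_eq_2 power2_eq_square)
qed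

lemma momentum_momentum:
  assumes "f \<in> schwartz"
  shows "(momentum hbar \<circ> momentum hbar) f x = - of_real (hbar\<^sup>2) * ddx (ddx f) x"
proof -
  have "momentum hbar f = (\<lambda>x. (- \<i> * of_real hbar) * ddx f x)" by (simp add: momentum_def)
  then have "ddx (momentum hbar f) x = (- \<i> * of_real hbar) * ddx (ddx f) x"
    using ddx_cmult[OF schwartz_ddx[OF assms]] by metis
  then show ?thesis by (simp add: momentum_def[of hbar "momentum hbar f"] power2_eq_square algebra_simps)
qed

lemma hamiltonian_eq:
  assumes "f \<in> schwartz"
  shows "hamiltonian hbar m (harmonic m \<Omega>) f x
    = of_real (- hbar\<^sup>2 / (2 * m)) * ddx (ddx f) x + of_real (m * \<Omega>\<^sup>2 * x\<^sup>2 / 2) * f x"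
  using momentum_momentum[OF assms, of x]
  by (simp add: hamiltonian_def add_op_def kinetic_def scale_op_def potential_def harmonic_def)

text \<open>Kinetic and potential energy have the same coefficient hbar \<Omega> / 4 and opposite
  signs at the two-step terms, so the diagonal alone survives.\<close>

lemma hamiltonian_basis:
  "hamiltonian hbar m (harmonic m \<Omega>) (e n) = (\<lambda>x. of_real (hbar * \<Omega> * (real n + 1 / 2)) * e n x)"
proof
  fix x
  define S where "S = of_real (sqrt (real n * real (n - 1))) * e (n - 2) x
      + of_real (sqrt (real (Suc n) * real (n + 2))) * e (n + 2) x"
  have c1: "- hbar\<^sup>2 / (2 * m) * (1 / (4 * x0\<^sup>2)) = - hbar * \<Omega> / 4"
    unfolding x0_sq using pos by (simp add: field_simps power2_eq_square)
  have c2: "m * \<Omega>\<^sup>2 / 2 * x0\<^sup>2 = hbar * \<Omega> / 4"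
    unfolding x0_sq using pos by (simp add: field_simps power2_eq_square)
  have "of_real (m * \<Omega>\<^sup>2 * x\<^sup>2 / 2) * e n x
      = of_real (m * \<Omega>\<^sup>2 / 2) * (position \<circ> position) (e n) x"
    by (simp add: position_def power2_eq_square algebra_simps)
  also have "\<dots> = of_real (m * \<Omega>\<^sup>2 / 2 * x0\<^sup>2) * (S + of_real (2 * real n + 1) * e n x)"
    unfolding position_position_basis S_def by (simp add: algebra_simps)
  finally have V: "of_real (m * \<Omega>\<^sup>2 * x\<^sup>2 / 2) * e n x
     = of_real (hbar * \<Omega> / 4) * (S + of_real (2 * real n + 1) * e n x)" unfolding c2 .
  have "of_real (- hbar\<^sup>2 / (2 * m)) * ddx (ddx (e n)) x
      = of_real (- hbar\<^sup>2 / (2 * m) * (1 / (4 * x0\<^sup>2))) * (S - of_real (2 * real n + 1) * e n x)"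
  proof -
    have "of_real (sqrt (real n * real (n - 1))) * e (n - 2) x - of_real (2 * real n + 1) * e n x
      + of_real (sqrt (real (Suc n) * real (n + 2))) * e (n + 2) x
      = S - of_real (2 * real n + 1) * e n x" by (simp add: S_def)
    then show ?thesis unfolding ddx_ddx_basis by (simp only: of_real_mult mult.assoc)
  qed
  then have K: "of_real (- hbar\<^sup>2 / (2 * m)) * ddx (ddx (e n)) x
      = of_real (- hbar * \<Omega> / 4) * (S - of_real (2 * real n + 1) * e n x)" unfolding c1 .
  show "hamiltonian hbar m (harmonic m \<Omega>) (e n) x = of_real (hbar * \<Omega> * (real n + 1 / 2)) * e n x"
    unfolding hamiltonian_eq[OF basis_schwartz] V K by (simp add: algebra_simps)
qed

text \<open>Origin of \<alpha> and \<beta>: \<open>\<mu> x\<close> contributes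
  \<open>\<mu> x0 (a + a\<^sup>\<dagger>)\<close>, and \<open>\<i> \<nu> p = \<nu> hbar d/dx\<close>
  contributes \<open>\<nu> hbar / (2 x0) (a - a\<^sup>\<dagger>)\<close>.\<close>

lemma jump_basis:
  "jump hbar \<mu> \<nu> (e n) = (\<lambda>x. of_real ((\<mu> * x0 + \<nu> * hbar / (2 * x0)) * sqrt (real n)) * e (n - 1) x
     + of_real ((\<mu> * x0 - \<nu> * hbar / (2 * x0)) * sqrt (real (Suc n))) * e (Suc n) x)"
  by (auto simp: jump_def position_def momentum_def position_basis[of _ n] ddx_basis[of n] algebra_simps
      simp del: of_nat_Suc)

lemma jump_adj_basis:
  "jump_adj hbar \<mu> \<nu> (e n) = (\<lambda>x. of_real ((\<mu> * x0 - \<nu> * hbar / (2 * x0)) * sqrt (real n)) * e (n - 1) x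
     + of_real ((\<mu> * x0 + \<nu> * hbar / (2 * x0)) * sqrt (real (Suc n))) * e (Suc n) x)"
  by (auto simp: jump_adj_def position_def momentum_def position_basis[of _ n] ddx_basis[of n] algebra_simps
      simp del: of_nat_Suc)

lemma jump_adj_lincomb:
  assumes "f \<in> schwartz" "g \<in> schwartz"
  shows "jump_adj hbar \<mu> \<nu> (\<lambda>x. a * f x + b * g x) x
    = a * jump_adj hbar \<mu> \<nu> f x + b * jump_adj hbar \<mu> \<nu> g x"
  by (simp add: jump_adj_def position_def momentum_def ddx_lincomb[OF assms] algebra_simps)

lemma jump_adj_jump_basis:
  fixes \<mu> \<nu> :: real
  defines "\<alpha> \<equiv> \<mu> * x0 + \<nu> * hbar / (2 * x0)" and "\<beta> \<equiv> \<mu> * x0 - \<nu> * hbar / (2 * x0)"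
  shows "jump_adj hbar \<mu> \<nu> (jump hbar \<mu> \<nu> (e n)) = (\<lambda>x.
     of_real (\<alpha> * \<beta> * sqrt (real n * real (n - 1))) * e (n - 2) x
     + of_real (\<alpha>\<^sup>2 * real n + \<beta>\<^sup>2 * (real n + 1)) * e n x
     + of_real (\<alpha> * \<beta> * sqrt (real (Suc n) * real (n + 2))) * e (n + 2) x)"
proof
  fix x
  have "jump_adj hbar \<mu> \<nu> (jump hbar \<mu> \<nu> (e n)) x
     = of_real (\<alpha> * sqrt (real n)) * (of_real (\<beta> * sqrt (real (n - 1))) * e (n - 1 - 1) x
         + of_real (\<alpha> * sqrt (real (Suc (n - 1)))) * e (Suc (n - 1)) x)
     + of_real (\<beta> * sqrt (real (Suc n))) * (of_real (\<beta> * sqrt (real (Suc n))) * e n x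
         + of_real (\<alpha> * sqrt (real (n + 2))) * e (n + 2) x)"
    unfolding jump_basis jump_adj_lincomb[OF basis_schwartz basis_schwartz] jump_adj_basis
    by (simp add: \<alpha>_def \<beta>_def del: of_nat_Suc)
  also have "\<dots> = of_real (\<alpha> * \<beta> * (sqrt (real n) * sqrt (real (n - 1)))) * e (n - 1 - 1) x
     + of_real (\<alpha>\<^sup>2 * (sqrt (real n) * sqrt (real n)) + \<beta>\<^sup>2 * (sqrt (real (Suc n)) * sqrt (real (Suc n)))) * e n x
     + of_real (\<alpha> * \<beta> * (sqrt (real (Suc n)) * sqrt (real (n + 2)))) * e (n + 2) x"
    by (cases n) (simp_all add: algebra_simps power2_eq_square del: of_nat_Suc real_sqrt_mult_self)
  finally show "jump_adj hbar \<mu> \<nu> (jump hbar \<mu> \<nu> (e n)) x =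
     of_real (\<alpha> * \<beta> * sqrt (real n * real (n - 1))) * e (n - 2) x
     + of_real (\<alpha>\<^sup>2 * real n + \<beta>\<^sup>2 * (real n + 1)) * e n x
     + of_real (\<alpha> * \<beta> * sqrt (real (Suc n) * real (n + 2))) * e (n + 2) x"
    by (simp add: real_sqrt_mult numeral_2_eq_2 add.commute)
qed

end

section \<open>The ground state energy\<close>

lemma integral_derivative_eq_0:
  fixes F G :: "real \<Rightarrow> real"
  assumes F: "\<And>x. (F has_real_derivative G x) (at x)" and G: "\<And>x. isCont G x" "integrable lborel G"
    and lim: "(F \<longlongrightarrow> 0) at_infinity"
  shows "integral\<^sup>L lborel G = 0"
proof -
  have "(LBINT x=-\<infinity>..\<infinity>. G x) = 0 - 0"
  proof (rule interval_integral_FTC_integrable[where F = F])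
    show "((F \<circ> real_of_ereal) \<longlongrightarrow> 0) (at_right (-\<infinity>))" "((F \<circ> real_of_ereal) \<longlongrightarrow> 0) (at_left \<infinity>)"
      using lim tendsto_mono[OF at_bot_le_at_infinity] tendsto_mono[OF at_top_le_at_infinity]
      by (auto simp: ereal_tendsto_simps)
  qed (use F G in \<open>auto simp: set_integrable_def einterval_def has_real_derivative_iff_has_vector_derivative\<close>)
  then show ?thesis
    by (simp add: interval_lebesgue_integral_def set_lebesgue_integral_def einterval_def)
qed

lemma schwartz_product_vanish:
  fixes w :: "real \<Rightarrow> 'a::real_normed_vector"
  assumes "f \<in> schwartz" "g \<in> schwartz"
    and w: "\<And>x. norm (w x) \<le> (1 + \<bar>x\<bar>) ^ n * (norm (f x) * norm (g x))"
  shows "(w \<longlongrightarrow> 0) at_infinity"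
proof -
  obtain C where C: "\<And>x. (1 + x\<^sup>2) * ((1 + \<bar>x\<bar>) ^ n * (norm (f x) * norm (g x))) \<le> C"
    using schwartz_product_decay[OF assms(1,2)] by metis
  have "norm (w x) \<le> \<bar>C * inverse x\<bar>" if "x \<noteq> 0" for x
  proof -
    have "\<bar>x\<bar> \<le> 1 + x\<^sup>2"
      using zero_le_power2[of "\<bar>x\<bar> - 1"] abs_ge_zero[of x] by (simp add: power2_diff)
    then have "\<bar>x\<bar> * norm (w x) \<le> (1 + x\<^sup>2) * ((1 + \<bar>x\<bar>) ^ n * (norm (f x) * norm (g x)))"
      by (intro mult_mono w) auto
    also have "\<dots> \<le> \<bar>C\<bar>" using C[of x] by linarith
    finally show ?thesis using that by (simp add: abs_mult field_simps)
  qed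
  then have "\<forall>\<^sub>F x in at_infinity. norm (w x) \<le> \<bar>C * inverse x\<bar>"
    by (auto simp: eventually_at_infinity intro!: exI[of _ 1])
  moreover have "((\<lambda>x. \<bar>C * inverse x\<bar>) \<longlongrightarrow> 0) at_infinity"
    by (intro tendsto_rabs_zero tendsto_mult_right_zero tendsto_inverse_0)
  ultimately show ?thesis by (rule Lim_null_comparison)
qed

lemma re_product_integrable:
  assumes "f \<in> schwartz" "g \<in> schwartz"
  shows "integrable lborel (\<lambda>x. of_real (x ^ n) * (cnj (f x) * g x))"
    and "integrable lborel (\<lambda>x. x ^ n * Re (cnj (f x) * g x))"
    and "((\<lambda>x. x ^ n * Re (cnj (f x) * g x)) \<longlongrightarrow> 0) at_infinity"
proof -
  have b: "\<bar>x\<bar> ^ n * (norm (f x) * norm (g x)) \<le> (1 + \<bar>x\<bar>) ^ n * (norm (f x) * norm (g x))" for x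
    by (intro mult_right_mono power_mono) auto
  have c: "norm (x ^ n * Re (cnj (f x) * g x)) \<le> (1 + \<bar>x\<bar>) ^ n * (norm (f x) * norm (g x))" for x
  proof -
    have "norm (x ^ n * Re (cnj (f x) * g x)) = \<bar>x\<bar> ^ n * \<bar>Re (cnj (f x) * g x)\<bar>"
      by (simp only: real_norm_def abs_mult power_abs)
    also have "\<dots> \<le> \<bar>x\<bar> ^ n * norm (cnj (f x) * g x)"
      by (intro mult_left_mono abs_Re_le_cmod) auto
    finally have "norm (x ^ n * Re (cnj (f x) * g x)) \<le> \<bar>x\<bar> ^ n * norm (cnj (f x) * g x)" .
    then show ?thesis using b[of x] by (simp add: norm_mult)
  qed
  have [measurable]: "f \<in> borel_measurable borel" "g \<in> borel_measurable borel"
    using assms by (auto intro: schwartz_borel_measurable)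
  have [measurable]: "(\<lambda>x. cnj (f x)) \<in> borel_measurable borel"
    using assms by (intro borel_measurable_continuous_onI continuous_on_cnj continuous_at_imp_continuous_on)
      (auto simp: schwartz_isCont)
  have "(\<lambda>x. of_real (x ^ n) * (cnj (f x) * g x)) \<in> borel_measurable borel"
    by measurable
  then show "integrable lborel (\<lambda>x. of_real (x ^ n) * (cnj (f x) * g x))"
    by (rule schwartz_product_integrable[OF assms, where K = 1 and n = n])
      (use b in \<open>simp_all add: norm_mult norm_power\<close>)
  show "integrable lborel (\<lambda>x. x ^ n * Re (cnj (f x) * g x))"
    by (rule schwartz_product_integrable[OF assms, where K = 1 and n = n])
      (measurable, use c in \<open>simp_all del: times_complex.sel\<close>)
  show "((\<lambda>x. x ^ n * Re (cnj (f x) * g x)) \<longlongrightarrow> 0) at_infinity"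
    by (rule schwartz_product_vanish[OF assms c])
qed

lemma re_product_derivative:
  assumes "f \<in> schwartz" "g \<in> schwartz"
  shows "((\<lambda>x. Re (cnj (f x) * g x)) has_real_derivative
     Re (cnj (f x) * ddx g x) + Re (cnj (ddx f x) * g x)) (at x)"
proof -
  have "((\<lambda>x. cnj (f x) * g x) has_vector_derivative (cnj (f x) * ddx g x + cnj (ddx f x) * g x)) (at x)"
    by (intro has_vector_derivative_mult has_vector_derivative_cnj schwartz_has_vector_derivative assms)
  from has_field_derivative_Re[OF this] show ?thesis by simp
qed

lemma re_product_isCont:
  assumes "f \<in> schwartz" "g \<in> schwartz"
  shows "isCont (\<lambda>x. Re (cnj (f x) * g x)) x"
  using re_product_derivative[OF assms] DERIV_isCont by blast

context oscillator
begin

text \<open>Completing the square: the energy density equals \<open>hbar \<Omega> / 2\<close> times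
  |f|^2, plus |hbar f' + m \<Omega> x f|^2 / (2 m), minus a derivative that integrates to 0. The
  square is the squared norm of the annihilation operator applied to f, up to a constant.\<close>

lemma hamiltonian_lower_bound:
  assumes f: "f \<in> schwartz"
  shows "hbar * \<Omega> / 2 * (LINT x|lborel. (norm (f x))\<^sup>2)
     \<le> Re (l2_inner f (hamiltonian hbar m (harmonic m \<Omega>) f))"
proof -
  define f1 where "f1 = ddx f"
  define f2 where "f2 = ddx f1"
  have s: "f \<in> schwartz" "f1 \<in> schwartz" "f2 \<in> schwartz"
    using f by (auto simp: f1_def f2_def schwartz_ddx)
  define c1 where "c1 = hbar\<^sup>2 / (2 * m)"
  define c2 where "c2 = m * \<Omega>\<^sup>2 / 2"
  define c3 where "c3 = hbar * \<Omega> / 2"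
  define P where "P = (\<lambda>(u::real\<Rightarrow>complex) v (x::real). Re (cnj (u x) * v x))"
  \<comment> \<open>The primitive of that derivative: \<open>c1 * P f f1\<close> integrates the
    second derivative by parts, and \<open>c3 * (x * P f f x)\<close> supplies the cross term of the
    square together with the zero-point energy.\<close>
  define W where "W = (\<lambda>x. c1 * P f f1 x + c3 * (x * P f f x))"
  define W' where "W' = (\<lambda>x. c1 * (P f f2 x + P f1 f1 x) + c3 * (P f f x + x * (P f f1 x + P f1 f x)))"
  note intP = re_product_integrable(2)[OF s(1,1), of 0] re_product_integrable(2)[OF s(1,1), of 1]
     re_product_integrable(2)[OF s(1,2), of 0] re_product_integrable(2)[OF s(1,2), of 1]
     re_product_integrable(2)[OF s(2,1), of 1]
     re_product_integrable(2)[OF s(2,2), of 0] re_product_integrable(2)[OF s(1,3), of 0]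
     re_product_integrable(2)[OF s(1,1), of 2]
  have intP': "integrable lborel (P f f)" "integrable lborel (\<lambda>x. x * P f f1 x)" "integrable lborel (\<lambda>x. x * P f1 f x)"
    "integrable lborel (P f1 f1)" "integrable lborel (P f f2)" "integrable lborel (\<lambda>x. x\<^sup>2 * P f f x)"
    using intP unfolding P_def by (simp_all only: power_0 power_one_right mult_1)
  have dP: "(P f g has_real_derivative P f (ddx g) x + P (ddx f) g x) (at x)"
    if "f \<in> schwartz" "g \<in> schwartz" for f g x
    unfolding P_def by (rule re_product_derivative[OF that])
  have "integral\<^sup>L lborel W' = 0"
  proof (rule integral_derivative_eq_0[where F = W])
    show "(W has_real_derivative W' x) (at x)" for x
      unfolding W_def W'_def
      by (rule derivative_eq_intros dP s refl)+ (simp add: f1_def f2_def algebra_simps)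
    show "isCont W' x" for x
      unfolding W'_def by (intro continuous_intros) (auto simp: P_def intro!: re_product_isCont s simp del: times_complex.sel)
    show "integrable lborel W'"
      unfolding W'_def distrib_left by (intro Bochner_Integration.integrable_add integrable_mult_right intP')
    have "(P f f1 \<longlongrightarrow> 0) at_infinity" "((\<lambda>x. x * P f f x) \<longlongrightarrow> 0) at_infinity"
      using re_product_integrable(3)[OF s(1,2), of 0] re_product_integrable(3)[OF s(1,1), of 1]
      unfolding P_def by (simp_all only: power_0 power_one_right mult_1)
    then show "(W \<longlongrightarrow> 0) at_infinity"
      unfolding W_def by (auto intro!: tendsto_add_zero tendsto_mult_right_zero)
  qed
  have Hf: "cnj (f x) * hamiltonian hbar m (harmonic m \<Omega>) f x
      = of_real (- c1) * (of_real (x ^ 0) * (cnj (f x) * f2 x)) + of_real c2 * (of_real (x ^ 2) * (cnj (f x) * f x))" for x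
    unfolding hamiltonian_eq[OF f] f1_def[symmetric] f2_def[symmetric]
    by (simp add: c1_def c2_def algebra_simps)
  have iH: "integrable lborel (\<lambda>x. cnj (f x) * hamiltonian hbar m (harmonic m \<Omega>) f x)"
    unfolding Hf by (intro Bochner_Integration.integrable_add integrable_mult_right re_product_integrable s)
  define R where "R = (\<lambda>x. Re (cnj (f x) * hamiltonian hbar m (harmonic m \<Omega>) f x))"
  have R: "R x = - c1 * P f f2 x + c2 * (x\<^sup>2 * P f f x)" for x
    unfolding R_def Hf P_def by (simp add: algebra_simps)
  have iR: "integrable lborel R"
    unfolding R by (intro Bochner_Integration.integrable_add integrable_mult_right intP')
  have Pff: "P f f = (\<lambda>x. (norm (f x))\<^sup>2)"
    by (rule ext) (simp add: P_def cmod_power2 flip: power2_eq_square)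
  have ineq: "c3 * P f f x - W' x \<le> R x" for x
  proof -
    define a b c d where "a = Re (f x)" and "b = Im (f x)" and "c = Re (f1 x)" and "d = Im (f1 x)"
    have "R x - (c3 * P f f x - W' x) = c1 * P f1 f1 x + c2 * (x\<^sup>2 * P f f x) + c3 * (x * (P f f1 x + P f1 f x))"
      by (simp add: R W'_def algebra_simps)
    \<comment> \<open>Real and imaginary parts of hbar f' + m \<Omega> x f, squared
      separately.\<close>
    also have "\<dots> = ((hbar * c + m * \<Omega> * x * a)\<^sup>2 + (hbar * d + m * \<Omega> * x * b)\<^sup>2) / (2 * m)"
      using pos unfolding P_def c1_def c2_def c3_def a_def b_def c_def d_def
      by (simp add: field_simps power2_eq_square)
    also have "\<dots> \<ge> 0" using pos by simp
    finally show ?thesis by simp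
  qed
  have "c3 * integral\<^sup>L lborel (P f f) - integral\<^sup>L lborel W' \<le> integral\<^sup>L lborel R"
  proof -
    have iW: "integrable lborel W'"
      unfolding W'_def distrib_left by (intro Bochner_Integration.integrable_add integrable_mult_right intP')
    have "integral\<^sup>L lborel (\<lambda>x. c3 * P f f x - W' x) \<le> integral\<^sup>L lborel R"
      by (intro integral_mono Bochner_Integration.integrable_diff integrable_mult_right intP' iR iW ineq)
    then show ?thesis using intP'(1) iW by simp
  qed
  moreover have "integral\<^sup>L lborel R = Re (l2_inner f (hamiltonian hbar m (harmonic m \<Omega>) f))"
    unfolding R_def l2_inner_def using iH by (rule integral_Re)
  ultimately show ?thesis
    using \<open>integral\<^sup>L lborel W' = 0\<close> by (simp add: Pff c3_def)
qed

text \<open>The squared Gaussian is the centred normal density with standard deviation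
  \<open>x0\<close>.\<close>

lemma norm_basis_0: "l2_norm (e 0) = 1"
proof -
  have "(norm (e 0 x))\<^sup>2 = normal_density 0 x0 x" for x
  proof -
    have k: "m * \<Omega> / (pi * hbar) > 0" using pos by simp
    have "(norm (e 0 x))\<^sup>2 = ((m * \<Omega> / (pi * hbar)) powr (1 / 4))\<^sup>2 * (exp (- (m * \<Omega> * x\<^sup>2) / (2 * hbar)))\<^sup>2"
      by (simp add: qho_basis.simps norm_mult power_mult_distrib)
    also have "((m * \<Omega> / (pi * hbar)) powr (1 / 4))\<^sup>2 = sqrt (m * \<Omega> / (pi * hbar))"
    proof -
      have "((m * \<Omega> / (pi * hbar)) powr (1 / 4))\<^sup>2 = (m * \<Omega> / (pi * hbar)) powr (1 / 4 + 1 / 4)"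
        by (simp only: power2_eq_square powr_add)
      also have "\<dots> = sqrt (m * \<Omega> / (pi * hbar))"
        using k powr_half_sqrt[of "m * \<Omega> / (pi * hbar)"] by simp
      finally show ?thesis .
    qed
    also have "(exp (- (m * \<Omega> * x\<^sup>2) / (2 * hbar)))\<^sup>2 = exp (- x\<^sup>2 / (2 * x0\<^sup>2))"
      unfolding x0_sq using pos by (simp add: power2_eq_square flip: exp_add)
    also have "sqrt (m * \<Omega> / (pi * hbar)) = 1 / sqrt (2 * pi * x0\<^sup>2)"
      unfolding x0_sq using pos by (simp add: real_sqrt_divide real_sqrt_mult)
    finally show ?thesis by (simp add: normal_density_def)
  qed
  then show ?thesis using x0_pos by (simp add: l2_norm_def integral_normal_density)
qed

lemma ground_state_basis_0:
  "ground_state (hamiltonian hbar m (harmonic m \<Omega>)) (1 / 2 * hbar * \<Omega>) (e 0)"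
  unfolding ground_state_def
proof (intro conjI ballI impI)
  show "hamiltonian hbar m (harmonic m \<Omega>) (e 0) = (\<lambda>x. of_real (1 / 2 * hbar * \<Omega>) * e 0 x)"
    unfolding hamiltonian_basis by (simp add: mult_ac)
  fix f assume f: "f \<in> schwartz" "l2_norm f = 1"
  then have "(LINT x|lborel. (norm (f x))\<^sup>2) = 1" by (simp add: l2_norm_def)
  then show "1 / 2 * hbar * \<Omega> \<le> Re (l2_inner f (hamiltonian hbar m (harmonic m \<Omega>) f))"
    using hamiltonian_lower_bound[OF f(1)] by simp
qed (rule basis_schwartz norm_basis_0)+

end

section \<open>Density operators as matrices\<close>

lemma L2_add:
  assumes "f \<in> L2" "g \<in> L2"
  shows "(\<lambda>x. f x + g x) \<in> L2"
proof -
  have [measurable]: "f \<in> borel_measurable borel" "g \<in> borel_measurable borel"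
    and i: "integrable lborel (\<lambda>x. (norm (f x))\<^sup>2)" "integrable lborel (\<lambda>x. (norm (g x))\<^sup>2)"
    using assms by (auto simp: L2_def)
  have "integrable lborel (\<lambda>x. (norm (f x + g x))\<^sup>2)"
  proof (rule Bochner_Integration.integrable_bound)
    show "integrable lborel (\<lambda>x. 2 * (norm (f x))\<^sup>2 + 2 * (norm (g x))\<^sup>2)"
      using i by simp
    have "(norm (f x + g x))\<^sup>2 \<le> 2 * (norm (f x))\<^sup>2 + 2 * (norm (g x))\<^sup>2" for x
    proof -
      have "(norm (f x + g x))\<^sup>2 \<le> (norm (f x) + norm (g x))\<^sup>2"
        by (intro power_mono norm_triangle_ineq) auto
      also have "\<dots> \<le> 2 * (norm (f x))\<^sup>2 + 2 * (norm (g x))\<^sup>2"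
        using sum_squares_bound[of "norm (f x)" "norm (g x)"] by (simp add: power2_sum)
      finally show ?thesis .
    qed
    then show "AE x in lborel. norm ((norm (f x + g x))\<^sup>2) \<le> norm (2 * (norm (f x))\<^sup>2 + 2 * (norm (g x))\<^sup>2)"
      by simp
  qed measurable
  then show ?thesis by (simp add: L2_def)
qed

lemma L2_cmult:
  assumes "f \<in> L2"
  shows "(\<lambda>x. c * f x) \<in> L2"
  using assms by (auto simp: L2_def norm_mult power_mult_distrib)

lemma borel_measurable_cnj_comp:
  assumes "f \<in> borel_measurable M"
  shows "(\<lambda>x. cnj (f x)) \<in> borel_measurable M"
  by (rule measurable_compose[OF assms]) (intro borel_measurable_continuous_onI continuous_intros)

lemma L2_product_integrable:
  assumes "f \<in> L2" "g \<in> L2"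
  shows "integrable lborel (\<lambda>x. cnj (f x) * g x)"
proof (rule Bochner_Integration.integrable_bound)
  have i: "integrable lborel (\<lambda>x. (norm (f x))\<^sup>2)" "integrable lborel (\<lambda>x. (norm (g x))\<^sup>2)"
    using assms by (auto simp: L2_def)
  then show "integrable lborel (\<lambda>x. (norm (f x))\<^sup>2 + (norm (g x))\<^sup>2)" by simp
  have [measurable]: "g \<in> borel_measurable borel" "(\<lambda>x. cnj (f x)) \<in> borel_measurable borel"
    using assms by (auto simp: L2_def intro: borel_measurable_cnj_comp)
  show "(\<lambda>x. cnj (f x) * g x) \<in> borel_measurable lborel" by measurable
  have "norm (f x) * norm (g x) \<le> (norm (f x))\<^sup>2 + (norm (g x))\<^sup>2" for x
  proof -
    have "2 * (norm (f x) * norm (g x)) \<le> (norm (f x))\<^sup>2 + (norm (g x))\<^sup>2"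
      using sum_squares_bound[of "norm (f x)" "norm (g x)"] by (simp only: mult.assoc)
    moreover have "0 \<le> norm (f x) * norm (g x)" by simp
    ultimately show ?thesis by linarith
  qed
  then show "AE x in lborel. norm (cnj (f x) * g x) \<le> norm ((norm (f x))\<^sup>2 + (norm (g x))\<^sup>2)"
    by (simp add: norm_mult)
qed

lemma l2_inner_lincomb_left:
  assumes "f \<in> L2" "g \<in> L2" "h \<in> L2"
  shows "l2_inner (\<lambda>x. a * f x + b * g x) h = cnj a * l2_inner f h + cnj b * l2_inner g h"
proof -
  have "l2_inner (\<lambda>x. a * f x + b * g x) h = (LINT x|lborel. cnj a * (cnj (f x) * h x) + cnj b * (cnj (g x) * h x))"
    unfolding l2_inner_def by (simp add: algebra_simps)
  then show ?thesis
    using L2_product_integrable[OF assms(1,3)] L2_product_integrable[OF assms(2,3)] by (simp add: l2_inner_def)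
qed

lemma l2_inner_lincomb_right:
  assumes "f \<in> L2" "g \<in> L2" "h \<in> L2"
  shows "l2_inner h (\<lambda>x. a * f x + b * g x) = a * l2_inner h f + b * l2_inner h g"
proof -
  have "l2_inner h (\<lambda>x. a * f x + b * g x) = (LINT x|lborel. a * (cnj (h x) * f x) + b * (cnj (h x) * g x))"
    unfolding l2_inner_def by (simp add: algebra_simps)
  then show ?thesis
    using L2_product_integrable[OF assms(3,1)] L2_product_integrable[OF assms(3,2)] by (simp add: l2_inner_def)
qed

lemma l2_inner_cong_AE:
  assumes "f \<in> L2" "g \<in> L2" "h \<in> L2" "AE x in lborel. f x = g x"
  shows "l2_inner h f = l2_inner h g"
  unfolding l2_inner_def
proof (rule integral_cong_AE)
  show "(\<lambda>x. cnj (h x) * f x) \<in> borel_measurable lborel" "(\<lambda>x. cnj (h x) * g x) \<in> borel_measurable lborel"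
    using L2_product_integrable[OF assms(3,1)] L2_product_integrable[OF assms(3,2)] by auto
  show "AE x in lborel. cnj (h x) * f x = cnj (h x) * g x"
    using assms(4) by eventually_elim simp
qed

lemma density_L2: "density_operator hbar m \<Omega> R \<Longrightarrow> f \<in> L2 \<Longrightarrow> R f \<in> L2"
  by (simp add: density_operator_def)

text \<open>The operator is additive and homogeneous only almost everywhere; inside the inner
  product these laws become equalities.\<close>

lemma density_lincomb_right:
  assumes R: "density_operator hbar m \<Omega> R" and fg: "f \<in> L2" "g \<in> L2" "h \<in> L2"
  shows "l2_inner h (R (\<lambda>x. a * f x + b * g x)) = a * l2_inner h (R f) + b * l2_inner h (R g)"
proof -
  have L: "(\<lambda>x. a * f x) \<in> L2" "(\<lambda>x. b * g x) \<in> L2" "R f \<in> L2" "R g \<in> L2"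
    using fg R by (auto intro: L2_cmult density_L2)
  have add: "\<forall>f\<in>L2. \<forall>g\<in>L2. AE x in lborel. R (\<lambda>y. f y + g y) x = R f x + R g x"
    using R unfolding density_operator_def by (elim conjE)
  have scale: "\<forall>c. \<forall>f\<in>L2. AE x in lborel. R (\<lambda>y. c * f y) x = c * R f x"
    using R unfolding density_operator_def by (elim conjE)
  note bspec[OF bspec[OF add L(1)] L(2)] bspec[OF spec[OF scale, of a] fg(1)]
    bspec[OF spec[OF scale, of b] fg(2)]
  then have "AE x in lborel. R (\<lambda>x. a * f x + b * g x) x = a * R f x + b * R g x"
    by eventually_elim simp
  then have "l2_inner h (R (\<lambda>x. a * f x + b * g x)) = l2_inner h (\<lambda>x. a * R f x + b * R g x)"
    by (intro l2_inner_cong_AE density_L2[OF R] L2_add L2_cmult L fg)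
  then show ?thesis by (simp add: l2_inner_lincomb_right L fg)
qed

lemma density_cmult_right:
  assumes R: "density_operator hbar m \<Omega> R" and "f \<in> L2" "h \<in> L2"
  shows "l2_inner h (R (\<lambda>x. a * f x)) = a * l2_inner h (R f)"
  using density_lincomb_right[OF R assms(2,2,3), of a 0] by simp

lemma density_lincomb3_right:
  assumes R: "density_operator hbar m \<Omega> R" and fg: "f \<in> L2" "f' \<in> L2" "f'' \<in> L2" "h \<in> L2"
  shows "l2_inner h (R (\<lambda>x. a * f x + b * f' x + c * f'' x))
    = a * l2_inner h (R f) + b * l2_inner h (R f') + c * l2_inner h (R f'')"
  using density_lincomb_right[OF R L2_add[OF L2_cmult[OF fg(1), of a] L2_cmult[OF fg(2), of b]] fg(3,4), of 1 c]
  by (simp add: density_lincomb_right[OF R fg(1,2,4)])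

lemma l2_inner_lincomb3_left:
  assumes fg: "f \<in> L2" "f' \<in> L2" "f'' \<in> L2" "h \<in> L2"
  shows "l2_inner (\<lambda>x. a * f x + b * f' x + c * f'' x) h
    = cnj a * l2_inner f h + cnj b * l2_inner f' h + cnj c * l2_inner f'' h"
  using l2_inner_lincomb_left[OF L2_add[OF L2_cmult[OF fg(1), of a] L2_cmult[OF fg(2), of b]] fg(3,4), of 1 c]
  by (simp add: l2_inner_lincomb_left[OF fg(1,2,4)])

text \<open>\<open>q c\<close> is the quadratic form of R at f + c g. Suitable choices of c extract
  hermiticity and the bound on off-diagonal entries.\<close>

lemma density_quadratic:
  assumes R: "density_operator hbar m \<Omega> R" and fg: "f \<in> L2" "g \<in> L2"
  defines "q \<equiv> \<lambda>c. l2_inner f (R f) + c * l2_inner f (R g) + cnj c * l2_inner g (R f)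
        + cnj c * c * l2_inner g (R g)"
  shows "Im (q c) = 0" "0 \<le> Re (q c)"
proof -
  let ?h = "\<lambda>x. 1 * f x + c * g x"
  have L: "R f \<in> L2" "R g \<in> L2" using fg density_L2[OF R] by auto
  have h: "?h \<in> L2" by (intro L2_add L2_cmult fg)
  have "l2_inner ?h (R ?h) = l2_inner ?h (R f) + c * l2_inner ?h (R g)"
    using density_lincomb_right[OF R fg h, of 1 c] by simp
  also have "\<dots> = q c"
    unfolding q_def l2_inner_lincomb_left[OF fg L(1)] l2_inner_lincomb_left[OF fg L(2)]
    by (simp add: algebra_simps)
  finally have "l2_inner ?h (R ?h) = q c" .
  moreover have "\<forall>f\<in>L2. l2_inner f (R f) \<in> \<real> \<and> 0 \<le> Re (l2_inner f (R f))"
    using R unfolding density_operator_def by (elim conjE)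
  note bspec[OF this h]
  ultimately show "Im (q c) = 0" "0 \<le> Re (q c)"
    by (auto simp: complex_is_Real_iff)
qed

text \<open>Polarization: over the complex numbers a real quadratic form is hermitian. The choices c
  = 1 and c = i compare the imaginary and the real parts.\<close>

lemma density_hermitian:
  assumes R: "density_operator hbar m \<Omega> R" and fg: "f \<in> L2" "g \<in> L2"
  shows "l2_inner g (R f) = cnj (l2_inner f (R g))"
proof -
  have d: "Im (l2_inner f (R f)) = 0" "Im (l2_inner g (R g)) = 0"
    using density_quadratic(1)[OF R fg(1,1), of 0] density_quadratic(1)[OF R fg(2,2), of 0] by auto
  show ?thesis
    using density_quadratic(1)[OF R fg, of 1] density_quadratic(1)[OF R fg, of \<i>] d
    by (auto intro: complex_eqI)
qed

lemma density_offdiagonal_le: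
  assumes R: "density_operator hbar m \<Omega> R" and fg: "f \<in> L2" "g \<in> L2"
  shows "2 * cmod (l2_inner f (R g)) \<le> Re (l2_inner f (R f)) + Re (l2_inner g (R g))"
proof -
  define z where "z = l2_inner f (R g)"
  \<comment> \<open>The phase that turns the cross term into -|z|; for z = 0 it is 0.\<close>
  define c where "c = - cnj (sgn z)"
  have cz: "c * z = - of_real (cmod z)"
  proof (cases "z = 0")
    case False
    have "z * cnj z = of_real (cmod z) * of_real (cmod z)"
      by (simp add: complex_norm_square[symmetric] power2_eq_square)
    then show ?thesis using False
      by (simp add: c_def sgn_div_norm scaleR_conv_of_real field_simps)
  qed simp
  have nc: "cmod c \<le> 1" by (simp add: c_def norm_sgn)
  have "0 \<le> Re (l2_inner f (R f)) + Re (c * z) + Re (cnj (c * z)) + Re (of_real ((cmod c)\<^sup>2) * l2_inner g (R g))"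
  proof -
    have "cnj c * c = of_real ((cmod c)\<^sup>2)" by (simp only: complex_norm_square mult.commute)
    then show ?thesis
      using density_quadratic(2)[OF R fg, of c]
      by (simp add: z_def density_hermitian[OF R fg] del: times_complex.sel of_real_power)
  qed
  also have "\<dots> = Re (l2_inner f (R f)) - 2 * cmod z + (cmod c)\<^sup>2 * Re (l2_inner g (R g))"
    unfolding cz by simp
  also have "(cmod c)\<^sup>2 * Re (l2_inner g (R g)) \<le> 1 * Re (l2_inner g (R g))"
    using nc density_quadratic(2)[OF R fg(2,2), of 0] by (intro mult_right_mono) (auto simp: power_le_one)
  finally show ?thesis by (simp add: z_def)
qed

context oscillator
begin

lemma basis_L2: "e n \<in> L2"
  using basis_schwartz schwartz_L2 by blast

text \<open>In this form every unbounded operator acts on an eigenfunction and yields a combination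
  of at most three eigenfunctions, so only matrix entries of R appear. The hbar in the energies
  cancels the prefactor.\<close>

lemma lindblad_form_basis:
  fixes \<mu> \<nu> :: real
  defines "\<alpha> \<equiv> \<mu> * x0 + \<nu> * hbar / (2 * x0)" and "\<beta> \<equiv> \<mu> * x0 - \<nu> * hbar / (2 * x0)"
  assumes R: "density_operator hbar m \<Omega> R"
  shows "lindblad_form hbar m (harmonic m \<Omega>) \<mu> \<nu> R (e j) (e k)
    = lindblad_matrix_rhs \<alpha> \<beta> \<Omega> (\<lambda>j k. l2_inner (e j) (R (e k))) j k"
proof -
  define r where "r = (\<lambda>j k. l2_inner (e j) (R (e k)))"
  have L: "R (e n) \<in> L2" for n by (intro density_L2[OF R] basis_L2)
  note J = jump_adj_basis[of \<mu> \<nu>, folded \<alpha>_def \<beta>_def] and JJ = jump_adj_jump_basis[of \<mu> \<nu>, folded \<alpha>_def \<beta>_def]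
  have H1: "l2_inner (hamiltonian hbar m (harmonic m \<Omega>) (e j)) (R (e k)) = of_real (hbar * \<Omega> * (real j + 1 / 2)) * r j k"
    using l2_inner_lincomb_left[OF basis_L2[of j] basis_L2[of j] L[of k], of "of_real (hbar * \<Omega> * (real j + 1 / 2))" 0]
    unfolding hamiltonian_basis r_def by simp
  have H2: "l2_inner (e j) (R (hamiltonian hbar m (harmonic m \<Omega>) (e k))) = of_real (hbar * \<Omega> * (real k + 1 / 2)) * r j k"
    unfolding hamiltonian_basis r_def by (rule density_cmult_right[OF R basis_L2 basis_L2])
  have LJ: "(\<lambda>x. of_real a * e i x + of_real b * e l x) \<in> L2" for a b i l
    by (intro L2_add L2_cmult basis_L2)
  have T1: "l2_inner (jump_adj hbar \<mu> \<nu> (e j)) (R (jump_adj hbar \<mu> \<nu> (e k)))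
     = of_real (\<beta> * sqrt (real k)) * (of_real (\<beta> * sqrt (real j)) * r (j - 1) (k - 1)
           + of_real (\<alpha> * sqrt (real (Suc j))) * r (Suc j) (k - 1))
      + of_real (\<alpha> * sqrt (real (Suc k))) * (of_real (\<beta> * sqrt (real j)) * r (j - 1) (Suc k)
           + of_real (\<alpha> * sqrt (real (Suc j))) * r (Suc j) (Suc k))"
    unfolding J density_lincomb_right[OF R basis_L2 basis_L2 LJ]
      l2_inner_lincomb_left[OF basis_L2 basis_L2 L] r_def complex_cnj_complex_of_real ..
  have T2: "l2_inner (jump_adj hbar \<mu> \<nu> (jump hbar \<mu> \<nu> (e j))) (R (e k))
    = of_real (\<alpha> * \<beta> * sqrt (real j * real (j - 1))) * r (j - 2) k
     + of_real (\<alpha>\<^sup>2 * real j + \<beta>\<^sup>2 * (real j + 1)) * r j k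
     + of_real (\<alpha> * \<beta> * sqrt (real (Suc j) * real (j + 2))) * r (j + 2) k"
    unfolding JJ l2_inner_lincomb3_left[OF basis_L2 basis_L2 basis_L2 L] r_def complex_cnj_complex_of_real ..
  have T3: "l2_inner (e j) (R (jump_adj hbar \<mu> \<nu> (jump hbar \<mu> \<nu> (e k))))
    = of_real (\<alpha> * \<beta> * sqrt (real k * real (k - 1))) * r j (k - 2)
     + of_real (\<alpha>\<^sup>2 * real k + \<beta>\<^sup>2 * (real k + 1)) * r j k
     + of_real (\<alpha> * \<beta> * sqrt (real (Suc k) * real (k + 2))) * r j (k + 2)"
    unfolding JJ density_lincomb3_right[OF R basis_L2 basis_L2 basis_L2 basis_L2] r_def ..
  have h: "complex_of_real hbar \<noteq> 0" using pos by simp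
  have "\<i> / complex_of_real hbar * (of_real (hbar * \<Omega> * (real j + 1 / 2)) * r j k - of_real (hbar * \<Omega> * (real k + 1 / 2)) * r j k)
     = \<i> * of_real (\<Omega> * (real j - real k)) * r j k"
    using h by (simp add: field_simps)
  then show ?thesis
    unfolding lindblad_form_def Let_def H1 H2 T1 T2 T3 lindblad_matrix_rhs_def r_def[symmetric]
    by (simp add: algebra_simps power2_eq_square)
qed

end

section \<open>Number statistics and quadratic observables of a density operator\<close>

context oscillator
begin

definition fock_matrix :: "qop \<Rightarrow> nat \<Rightarrow> nat \<Rightarrow> complex" where
  "fock_matrix R j k = l2_inner (e j) (R (e k))"

definition mean_number :: "qop \<Rightarrow> real" where
  "mean_number R = (\<Sum>n. real n * diagonal (fock_matrix R) n)"

definition pair_amplitude :: "qop \<Rightarrow> complex" where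
  "pair_amplitude R = (\<Sum>n. pair_coherence (fock_matrix R) (n + 2))"

lemma density_matrix_fock_matrix:
  assumes R: "density_operator hbar m \<Omega> R"
  shows "density_matrix (fock_matrix R)"
proof
  show "fock_matrix R k j = cnj (fock_matrix R j k)" for j k
    unfolding fock_matrix_def by (rule density_hermitian[OF R basis_L2 basis_L2])
  show "2 * cmod (fock_matrix R j k) \<le> Re (fock_matrix R j j) + Re (fock_matrix R k k)" for j k
    unfolding fock_matrix_def by (rule density_offdiagonal_le[OF R basis_L2 basis_L2])
  have "((\<lambda>n. fock_matrix R n n) has_sum 1) UNIV"
    using R unfolding density_operator_def has_trace_def fock_matrix_def by (elim conjE)
  from sums_Re[OF has_sum_imp_sums[OF this]] show "(\<lambda>n. Re (fock_matrix R n n)) sums 1" by simp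
qed

text \<open>Observables \<open>c (\<sigma> a\<^sup>2 + (2 N + 1) + \<sigma> a\<^sup>\<dagger>\<^sup>2)\<close>: the values \<open>\<sigma> = 1, -1, 0\<close> give multiples of
  \<open>x\<^sup>2\<close>, \<open>p\<^sup>2\<close> and the Hamiltonian.\<close>

definition quadratic_observable :: "qop \<Rightarrow> real \<Rightarrow> real \<Rightarrow> bool" where
  "quadratic_observable Ob c \<sigma> \<longleftrightarrow> (\<forall>n. Ob (e n) = (\<lambda>x.
     of_real (c * \<sigma> * sqrt (real n * real (n - 1))) * e (n - 2) x
     + of_real (c * (2 * real n + 1)) * e n x
     + of_real (c * \<sigma> * sqrt (real (n + 1) * real (n + 2))) * e (n + 2) x))"

lemma quadratic_observable_position: "quadratic_observable (position \<circ> position) (x0\<^sup>2) 1"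
  unfolding quadratic_observable_def position_position_basis by (auto simp: algebra_simps)

lemma quadratic_observable_momentum:
  "quadratic_observable (momentum hbar \<circ> momentum hbar) (hbar\<^sup>2 / (4 * x0\<^sup>2)) (- 1)"
  unfolding quadratic_observable_def
proof (intro allI ext)
  fix n x
  show "(momentum hbar \<circ> momentum hbar) (e n) x =
     of_real (hbar\<^sup>2 / (4 * x0\<^sup>2) * - 1 * sqrt (real n * real (n - 1))) * e (n - 2) x
     + of_real (hbar\<^sup>2 / (4 * x0\<^sup>2) * (2 * real n + 1)) * e n x
     + of_real (hbar\<^sup>2 / (4 * x0\<^sup>2) * - 1 * sqrt (real (n + 1) * real (n + 2))) * e (n + 2) x"
    unfolding momentum_momentum[OF basis_schwartz] ddx_ddx_basis
    using x0_pos by (simp add: field_simps)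
qed

lemma quadratic_observable_scale:
  assumes "quadratic_observable Ob c \<sigma>"
  shows "quadratic_observable (scale_op d Ob) (d * c) \<sigma>"
  using assms unfolding quadratic_observable_def scale_op_def by (auto simp: algebra_simps)

lemma quadratic_observable_kinetic: "quadratic_observable (kinetic hbar m) (hbar * \<Omega> / 4) (- 1)"
proof -
  have "1 / (2 * m) * (hbar\<^sup>2 / (4 * x0\<^sup>2)) = hbar * \<Omega> / 4"
    unfolding x0_sq using pos by (simp add: field_simps power2_eq_square)
  then show ?thesis
    using quadratic_observable_scale[OF quadratic_observable_momentum, of "1 / (2 * m)"]
    unfolding kinetic_def by metis
qed

lemma quadratic_observable_potential:
  "quadratic_observable (potential (harmonic m \<Omega>)) (hbar * \<Omega> / 4) 1"
proof -
  have c: "1 / 2 * m * \<Omega>\<^sup>2 * x0\<^sup>2 = hbar * \<Omega> / 4"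
    unfolding x0_sq using pos by (simp add: field_simps power2_eq_square)
  have "potential (harmonic m \<Omega>) = scale_op (1 / 2 * m * \<Omega>\<^sup>2) (position \<circ> position)"
    by (auto simp: fun_eq_iff potential_def harmonic_def scale_op_def position_def power2_eq_square)
  then show ?thesis
    using quadratic_observable_scale[OF quadratic_observable_position, of "1 / 2 * m * \<Omega>\<^sup>2"] c by metis
qed

lemma quadratic_observable_hamiltonian:
  "quadratic_observable (hamiltonian hbar m (harmonic m \<Omega>)) (hbar * \<Omega> / 2) 0"
  unfolding quadratic_observable_def hamiltonian_basis by (auto simp: algebra_simps)

text \<open>A finite mean makes the diagonal sum converge and, through the bound on coherences, the
  two-step sums converge absolutely. The contributions of \<open>a\<^sup>2\<close> and its adjoint
  are complex conjugates, whence the real part.\<close>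

lemma quadratic_expectation:
  assumes R: "density_operator hbar m \<Omega> R" and mean: "summable (\<lambda>n. real n * diagonal (fock_matrix R) n)"
    and Ob: "quadratic_observable Ob c \<sigma>"
  shows "has_expectation hbar m \<Omega> R Ob
     (of_real (c * (2 * mean_number R + 1 + 2 * \<sigma> * Re (pair_amplitude R))))"
proof -
  interpret density_matrix "fock_matrix R" by (rule density_matrix_fock_matrix[OF R])
  define M where "M = fock_matrix R"
  define Q where "Q = pair_amplitude R"
  have pair: "((\<lambda>n. pair_coherence M (n + 2)) has_sum Q) UNIV"
    using pair_coherence_summable[OF mean] summable_norm_cancel[OF pair_coherence_summable[OF mean]]
    by (intro norm_summable_imp_has_sum) (auto simp: M_def Q_def pair_amplitude_def summable_sums)
  \<comment> \<open>Both indexings occur, one from \<open>a\<^sup>2\<close> and one from its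
    adjoint; they agree because the first two coherences vanish.\<close>
  have pair0: "(pair_coherence M has_sum Q) UNIV"
  proof (rule norm_summable_imp_has_sum)
    show "summable (\<lambda>n. norm (pair_coherence M n))"
      using pair_coherence_summable[OF mean] summable_iff_shift[of "\<lambda>n. norm (pair_coherence M n)" 2]
      by (simp add: M_def)
    have "(\<lambda>n. pair_coherence M (n + 2)) sums (Q - (\<Sum>i<2. pair_coherence M i))"
      using has_sum_imp_sums[OF pair] by (simp add: pair_coherence_def numeral_2_eq_2)
    then show "pair_coherence M sums Q" unfolding sums_iff_shift by simp
  qed
  have diag: "((\<lambda>n. complex_of_real (2 * (real n * diagonal M n) + diagonal M n)) has_sum
     of_real (2 * mean_number R + 1)) UNIV"
  proof (intro has_sum_of_real sums_nonneg_imp_has_sum sums_add sums_mult)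
    show "(\<lambda>n. real n * diagonal M n) sums mean_number R"
      using mean by (simp add: mean_number_def M_def summable_sums)
    show "diagonal M sums 1" using total by (simp add: M_def)
  qed (auto simp: nonneg M_def)
  have "((\<lambda>n. of_real (c * \<sigma>) * pair_coherence M n
      + of_real c * complex_of_real (2 * (real n * diagonal M n) + diagonal M n)
      + of_real (c * \<sigma>) * cnj (pair_coherence M (n + 2))) has_sum
     (of_real (c * \<sigma>) * Q + of_real c * of_real (2 * mean_number R + 1) + of_real (c * \<sigma>) * cnj Q)) UNIV"
    by (intro has_sum_add has_sum_cmult_right pair0 diag) (use pair in simp)
  moreover have "of_real (c * \<sigma>) * Q + of_real c * of_real (2 * mean_number R + 1) + of_real (c * \<sigma>) * cnj Q
     = of_real (c * (2 * mean_number R + 1 + 2 * \<sigma> * Re Q))"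
    by (simp add: complex_eq_iff algebra_simps)
  moreover have "l2_inner (e n) ((R \<circ> Ob) (e n)) = of_real (c * \<sigma>) * pair_coherence M n
      + of_real c * complex_of_real (2 * (real n * diagonal M n) + diagonal M n)
      + of_real (c * \<sigma>) * cnj (pair_coherence M (n + 2))" for n
  proof -
    have "l2_inner (e n) ((R \<circ> Ob) (e n)) = of_real (c * \<sigma> * sqrt (real n * real (n - 1))) * M n (n - 2)
       + of_real (c * (2 * real n + 1)) * M n n
       + of_real (c * \<sigma> * sqrt (real (n + 1) * real (n + 2))) * M n (n + 2)"
      using Ob unfolding quadratic_observable_def o_def
      by (simp only: density_lincomb3_right[OF R basis_L2 basis_L2 basis_L2 basis_L2] M_def fock_matrix_def)
    moreover have "M n n = of_real (diagonal M n)" unfolding M_def by (rule diagonal_eq)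
    moreover have "M n (n + 2) = cnj (M (n + 2) n)" unfolding M_def by (rule hermitian)
    ultimately show ?thesis by (simp add: pair_coherence_def algebra_simps)
  qed
  ultimately show ?thesis by (simp add: has_expectation_def has_trace_def Q_def)
qed

lemma expectation_eq:
  "has_expectation hbar m \<Omega> R Ob z \<Longrightarrow> expectation hbar m \<Omega> R Ob = z"
  unfolding has_expectation_def has_trace_def expectation_def by (rule infsumI)

lemma finite_energy_mean_summable:
  assumes R: "density_operator hbar m \<Omega> R" and "finite_energy hbar m \<Omega> R"
  shows "summable (\<lambda>n. real n * diagonal (fock_matrix R) n)"
proof -
  interpret density_matrix "fock_matrix R" by (rule density_matrix_fock_matrix[OF R])
  obtain E where E: "((\<lambda>n. l2_inner (e n) ((R \<circ> hamiltonian hbar m (harmonic m \<Omega>)) (e n))) has_sum E) UNIV"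
    using assms(2) unfolding finite_energy_def has_expectation_def has_trace_def by blast
  have "l2_inner (e n) ((R \<circ> hamiltonian hbar m (harmonic m \<Omega>)) (e n))
      = of_real (hbar * \<Omega> * (real n + 1 / 2)) * fock_matrix R n n" for n
    unfolding o_def hamiltonian_basis density_cmult_right[OF R basis_L2 basis_L2] fock_matrix_def ..
  then have "summable (\<lambda>n. Re (of_real (hbar * \<Omega> * (real n + 1 / 2)) * fock_matrix R n n))"
    using sums_Re[OF has_sum_imp_sums[OF E]] by (simp only: sums_iff)
  then have "summable (\<lambda>n. hbar * \<Omega> * (real n + 1 / 2) * diagonal (fock_matrix R) n)"
    unfolding diagonal_def by (simp only: complex_eq_iff Re_complex_of_real Im_complex_of_real times_complex.sel mult_zero_left diff_0_right)
  \<comment> \<open>The number operator is H / (hbar \<Omega>) - 1 / 2, applied termwise.\<close>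
  then have "summable (\<lambda>n. 1 / (hbar * \<Omega>) * (hbar * \<Omega> * (real n + 1 / 2) * diagonal (fock_matrix R) n) - 1 / 2 * diagonal (fock_matrix R) n)"
    using total by (intro summable_diff summable_mult) (auto simp: sums_iff)
  moreover have "1 / (hbar * \<Omega>) * (hbar * \<Omega> * (real n + 1 / 2) * diagonal (fock_matrix R) n) - 1 / 2 * diagonal (fock_matrix R) n
      = real n * diagonal (fock_matrix R) n" for n
    using pos by (simp add: field_simps)
  ultimately show ?thesis by simp
qed

lemma ground_population_deficit:
  assumes R: "density_operator hbar m \<Omega> R" and mean: "summable (\<lambda>n. real n * diagonal (fock_matrix R) n)"
  shows "norm (l2_inner (e 0) (R (e 0)) - 1) \<le> mean_number R"
proof -
  interpret density_matrix "fock_matrix R" by (rule density_matrix_fock_matrix[OF R])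
  have "l2_inner (e 0) (R (e 0)) - 1 = of_real (diagonal (fock_matrix R) 0 - 1)"
    using diagonal_eq[of 0] by (simp add: fock_matrix_def)
  \<comment> \<open>The mean of min n 1 is the probability of n > 0.\<close>
  moreover have "1 - diagonal (fock_matrix R) 0 \<le> mean_number R"
    using trunc_mean_le_mean[OF mean, of 1] by (simp add: trunc_mean_def mean_number_def)
  moreover have "diagonal (fock_matrix R) 0 \<le> 1" by (rule prob_le_1)
  ultimately show ?thesis by (simp only: norm_of_real abs_if split: if_splits) linarith
qed

lemma qld_moments:
  fixes \<mu> \<nu> \<eta> :: real
  defines "\<alpha> \<equiv> \<mu> * x0 + \<nu> * hbar / (2 * x0)" and "\<beta> \<equiv> \<mu> * x0 - \<nu> * hbar / (2 * x0)"
    and "z \<equiv> of_real \<eta> + \<i> * of_real \<Omega>"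
  assumes sol: "qld_solution hbar m \<Omega> \<mu> \<nu> R0 \<rho>" and \<eta>: "2 * \<mu> * \<nu> * hbar = \<eta>" "\<eta> > 0"
    and R0: "density_operator hbar m \<Omega> R0" "finite_energy hbar m \<Omega> R0" and t: "t \<ge> 0"
  shows "density_operator hbar m \<Omega> (\<rho> t)"
    and "summable (\<lambda>n. real n * diagonal (fock_matrix (\<rho> t)) n)"
    and "mean_number (\<rho> t) = exp (- 2 * \<eta> * t) * (mean_number R0 - \<beta>\<^sup>2 / \<eta>) + \<beta>\<^sup>2 / \<eta>"
    and "pair_amplitude (\<rho> t) = exp (- 2 * z * of_real t) * (pair_amplitude R0 + of_real (\<alpha> * \<beta>) / z) - of_real (\<alpha> * \<beta>) / z"
proof -
  have dens: "density_operator hbar m \<Omega> (\<rho> t)" if "t \<ge> 0" for t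
    using sol that unfolding qld_solution_def by blast
  show "density_operator hbar m \<Omega> (\<rho> t)" by (rule dens[OF t])
  \<comment> \<open>The product condition on the coefficients is the net damping: \<alpha>^2 -
    \<beta>^2 is four times the product of \<open>\<mu> x0\<close> and
    \<open>\<nu> hbar / (2 x0)\<close>.\<close>
  have gap: "\<alpha>\<^sup>2 - \<beta>\<^sup>2 = \<eta>"
    unfolding \<alpha>_def \<beta>_def \<eta>(1)[symmetric] using x0_pos by (simp add: power2_eq_square field_simps)
  \<comment> \<open>\<open>\<rho> 0\<close> and \<open>R0\<close> agree almost everywhere on each
    vector, which suffices for equal matrix entries.\<close>
  have start: "fock_matrix (\<rho> 0) = fock_matrix R0"
  proof (intro ext)
    fix j k
    have "AE x in lborel. \<rho> 0 (e k) x = R0 (e k) x"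
      using sol basis_L2[of k] unfolding qld_solution_def by blast
    then show "fock_matrix (\<rho> 0) j k = fock_matrix R0 j k"
      unfolding fock_matrix_def using dens[of 0] R0(1)
      by (intro l2_inner_cong_AE) (auto intro: density_L2 basis_L2)
  qed
  interpret lindblad_evolution \<alpha> \<beta> \<Omega> "\<lambda>t. fock_matrix (\<rho> t)"
  proof (rule lindblad_evolution.intro)
    show "density_matrix (fock_matrix (\<rho> t))" if "t \<ge> 0" for t
      by (rule density_matrix_fock_matrix[OF dens[OF that]])
    show "((\<lambda>s. fock_matrix (\<rho> s) j k) has_vector_derivative lindblad_matrix_rhs \<alpha> \<beta> \<Omega> (fock_matrix (\<rho> t)) j k) (at t within {0..})"
      if "t \<ge> 0" for t j k
    proof -
      have "((\<lambda>s. l2_inner (e j) (\<rho> s (e k))) has_vector_derivative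
           lindblad_form hbar m (harmonic m \<Omega>) \<mu> \<nu> (\<rho> t) (e j) (e k)) (at t within {0..})"
        using sol that basis_schwartz[of j] basis_schwartz[of k] unfolding qld_solution_def by blast
      then show ?thesis
        unfolding lindblad_form_basis[OF dens[OF that]] \<alpha>_def \<beta>_def fock_matrix_def[abs_def] .
    qed
    show "\<beta>\<^sup>2 < \<alpha>\<^sup>2" using gap \<eta>(2) by simp
    show "summable (\<lambda>n. real n * diagonal (fock_matrix (\<rho> 0)) n)"
      unfolding start by (rule finite_energy_mean_summable[OF R0])
  qed
  show "summable (\<lambda>n. real n * diagonal (fock_matrix (\<rho> t)) n)" by (rule mean_summable[OF t])
  show "mean_number (\<rho> t) = exp (- 2 * \<eta> * t) * (mean_number R0 - \<beta>\<^sup>2 / \<eta>) + \<beta>\<^sup>2 / \<eta>"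
    using mean_eq[OF t] unfolding gap mean_def start mean_number_def .
  show "pair_amplitude (\<rho> t) = exp (- 2 * z * of_real t) * (pair_amplitude R0 + of_real (\<alpha> * \<beta>) / z) - of_real (\<alpha> * \<beta>) / z"
    using pair_mean_eq[OF t] unfolding gap pair_mean_def start pair_amplitude_def z_def .
qed

end

section \<open>Relaxation to equilibrium\<close>

lemma exp_decay_tendsto_0:
  fixes \<eta> :: real
  assumes "\<eta> > 0"
  shows "((\<lambda>t. exp (- 2 * \<eta> * t)) \<longlongrightarrow> 0) at_top"
proof (rule filterlim_compose[OF exp_at_bot])
  show "filterlim (\<lambda>t. - 2 * \<eta> * t) at_bot at_top"
    by (rule filterlim_tendsto_neg_mult_at_bot[OF tendsto_const _ filterlim_ident]) (use assms in simp)
qed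

lemma trig_amplitude_le: "\<bar>a + b * cos x + c * sin x\<bar> \<le> \<bar>a\<bar> + \<bar>b\<bar> + \<bar>c\<bar>" for a b c x :: real
proof -
  have "\<bar>b * cos x\<bar> \<le> \<bar>b\<bar> * 1" "\<bar>c * sin x\<bar> \<le> \<bar>c\<bar> * 1"
    unfolding abs_mult by (intro mult_left_mono; simp)+
  then show ?thesis by linarith
qed

lemma damped_oscillation_le:
  fixes \<eta> a b c x :: real
  shows "\<bar>exp (- 2 * \<eta> * t) * (a + b * cos x + c * sin x)\<bar> \<le> (\<bar>a\<bar> + \<bar>b\<bar> + \<bar>c\<bar>) * exp (- 2 * \<eta> * t)"
  unfolding abs_mult by (simp add: mult.commute trig_amplitude_le)

lemma damped_oscillation_tendsto_0:
  fixes \<eta> a b c :: real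
  assumes "\<eta> > 0"
  shows "((\<lambda>t. exp (- 2 * \<eta> * t) * (a + b * cos (x t) + c * sin (x t))) \<longlongrightarrow> 0) at_top"
proof (rule Lim_null_comparison)
  show "((\<lambda>t. (\<bar>a\<bar> + \<bar>b\<bar> + \<bar>c\<bar>) * exp (- 2 * \<eta> * t)) \<longlongrightarrow> 0) at_top"
    by (intro tendsto_mult_right_zero exp_decay_tendsto_0 assms)
qed (use damped_oscillation_le in \<open>auto intro!: always_eventually\<close>)

text \<open>The real and imaginary parts of w become the cosine and sine amplitudes. The frequency
  is 2 \<Omega> because \<open>a\<^sup>2\<close> removes two quanta.\<close>

lemma Re_damped_rotation:
  fixes \<eta> \<Omega> t :: real
  shows "Re (exp (- 2 * (of_real \<eta> + \<i> * of_real \<Omega>) * of_real t) * w)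
    = exp (- 2 * \<eta> * t) * (Re w * cos (2 * \<Omega> * t) + Im w * sin (2 * \<Omega> * t))"
  by (simp add: Re_exp Im_exp algebra_simps)

lemma Re_of_real_divide: "Re (of_real a / (of_real \<eta> + \<i> * of_real \<Omega>)) = a * \<eta> / (\<eta>\<^sup>2 + \<Omega>\<^sup>2)"
  by (simp add: Re_divide)

lemma tanh_inverse_temperature_tendsto:
  fixes c :: real
  assumes "c > 0"
  shows "((\<lambda>T. tanh (c / T)) \<longlongrightarrow> 1) (at_right 0)"
proof (rule filterlim_compose[OF tanh_real_at_top])
  have "filterlim (\<lambda>T::real. c * inverse T) at_top (at_right 0)"
    by (rule filterlim_tendsto_pos_mult_at_top[OF tendsto_const assms filterlim_inverse_at_top_right])
  then show "filterlim (\<lambda>T. c / T) at_top (at_right 0)" by (simp add: divide_inverse)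
qed

context oscillator
begin

text \<open>The jump operator is \<open>lower \<mu> \<nu>\<close> times the annihilation operator plus \<open>raise \<mu> \<nu>\<close> times the
  creation operator.\<close>

definition lower :: "real \<Rightarrow> real \<Rightarrow> real" where
  "lower \<mu> \<nu> = \<mu> * x0 + \<nu> * hbar / (2 * x0)"

definition raise :: "real \<Rightarrow> real \<Rightarrow> real" where
  "raise \<mu> \<nu> = \<mu> * x0 - \<nu> * hbar / (2 * x0)"

definition noise :: "real \<Rightarrow> real \<Rightarrow> real \<Rightarrow> real" where
  "noise \<eta> \<mu> \<nu> = 4 / m\<^sup>2 * \<mu>\<^sup>2 * hbar\<^sup>2 + 4 * (\<Omega>\<^sup>2 + 2 * \<eta>\<^sup>2) * \<nu>\<^sup>2 * hbar\<^sup>2"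

text \<open>The stationary moments \<beta>^2 / \<eta> and -\<alpha> \<beta> \<eta> / (\<eta>^2 +
  \<Omega>^2), the latter being a real part, inserted into x^2 and p^2 / m^2. This identifies the
  constants expressed by D in the result.\<close>

lemma equilibrium_constants:
  assumes \<eta>: "2 * \<mu> * \<nu> * hbar = \<eta>" "\<eta> > 0"
  shows "x0\<^sup>2 * (2 * ((raise \<mu> \<nu>)\<^sup>2 / \<eta>) + 1 - 2 * (lower \<mu> \<nu> * raise \<mu> \<nu> * \<eta> / (\<eta>\<^sup>2 + \<Omega>\<^sup>2)))
      = noise \<eta> \<mu> \<nu> / (8 * \<eta> * (\<Omega>\<^sup>2 + \<eta>\<^sup>2))" (is ?X)
    and "\<Omega>\<^sup>2 * x0\<^sup>2 * (2 * ((raise \<mu> \<nu>)\<^sup>2 / \<eta>) + 1 + 2 * (lower \<mu> \<nu> * raise \<mu> \<nu> * \<eta> / (\<eta>\<^sup>2 + \<Omega>\<^sup>2)))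
      = (2 * \<eta>\<^sup>2 + \<Omega>\<^sup>2) * noise \<eta> \<mu> \<nu> / (8 * \<eta> * (\<Omega>\<^sup>2 + \<eta>\<^sup>2)) - 2 * hbar\<^sup>2 * \<nu>\<^sup>2 * \<eta>" (is ?Y)
proof -
  \<comment> \<open>The position and momentum shares of the jump operator in oscillator units; in
    these variables both claims are rational identities subject to 4 u v = \<eta>.\<close>
  define u v s W where "u = \<mu> * x0" and "v = \<nu> * hbar / (2 * x0)" and "s = x0\<^sup>2" and "W = \<eta>\<^sup>2 + \<Omega>\<^sup>2"
  have s: "s > 0" "W > 0" using x0_pos \<eta>(2) by (auto simp: s_def W_def intro: add_pos_nonneg)
  have uv: "4 * u * v = \<eta>" unfolding \<eta>(1)[symmetric] u_def v_def using x0_pos by simp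
  have lr: "lower \<mu> \<nu> = u + v" "raise \<mu> \<nu> = u - v" by (simp_all add: lower_def raise_def u_def v_def)
  have mu: "\<mu>\<^sup>2 = u\<^sup>2 / s" using x0_pos by (simp add: u_def s_def power_mult_distrib)
  have nu: "\<nu>\<^sup>2 * hbar\<^sup>2 = 4 * s * v\<^sup>2" using x0_pos by (simp add: v_def s_def power_mult_distrib power_divide)
  have hm: "hbar\<^sup>2 / m\<^sup>2 = 4 * \<Omega>\<^sup>2 * s\<^sup>2"
    unfolding s_def x0_sq using pos by (simp add: field_simps power2_eq_square)
  have noise: "noise \<eta> \<mu> \<nu> = 16 * s * (\<Omega>\<^sup>2 * u\<^sup>2 + (\<Omega>\<^sup>2 + 2 * \<eta>\<^sup>2) * v\<^sup>2)"
  proof -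
    have "noise \<eta> \<mu> \<nu> = 4 * \<mu>\<^sup>2 * (hbar\<^sup>2 / m\<^sup>2) + 4 * (\<Omega>\<^sup>2 + 2 * \<eta>\<^sup>2) * (\<nu>\<^sup>2 * hbar\<^sup>2)"
      by (simp add: noise_def)
    also have "\<dots> = 16 * s * (\<Omega>\<^sup>2 * u\<^sup>2 + (\<Omega>\<^sup>2 + 2 * \<eta>\<^sup>2) * v\<^sup>2)"
      unfolding mu nu hm using s by (simp add: field_simps power2_eq_square)
    finally show ?thesis .
  qed
  \<comment> \<open>The zero-point 1 cancels the cross term -4 u v / \<eta>.\<close>
  have b: "2 * ((u - v)\<^sup>2 / \<eta>) + 1 = 2 * (u\<^sup>2 + v\<^sup>2) / \<eta>"
    using \<eta>(2) uv by (simp add: field_simps power2_eq_square)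
  have ab: "(u + v) * (u - v) = u\<^sup>2 - v\<^sup>2" by (simp add: algebra_simps power2_eq_square)
  have O: "\<Omega>\<^sup>2 = W - \<eta>\<^sup>2" by (simp add: W_def)
  have W': "W - \<eta>\<^sup>2 + \<eta>\<^sup>2 = W" by simp
  show ?X
    unfolding lr b ab noise s_def[symmetric] unfolding O W' using s \<eta>(2) by (simp add: field_simps) (simp add: power2_eq_square algebra_simps)
  have nu': "2 * hbar\<^sup>2 * \<nu>\<^sup>2 * \<eta> = 8 * s * v\<^sup>2 * \<eta>"
    using nu by (simp add: mult_ac)
  show ?Y
    unfolding lr b ab noise nu' s_def[symmetric] unfolding O W' using s \<eta>(2) by (simp add: field_simps) (simp add: power4_eq_xxxx power2_eq_square algebra_simps)
qed

text \<open>Deviation of the initial second moment from its stationary value. Like the amplitudes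
  below, it depends on the initial state and the coefficients, not on the trajectory.\<close>

definition coherent_part :: "real \<Rightarrow> real \<Rightarrow> real \<Rightarrow> qop \<Rightarrow> complex" where
  "coherent_part \<eta> \<mu> \<nu> R0 = pair_amplitude R0
     + of_real (lower \<mu> \<nu> * raise \<mu> \<nu>) / (of_real \<eta> + \<i> * of_real \<Omega>)"

definition amp_const :: "real \<Rightarrow> real \<Rightarrow> real \<Rightarrow> qop \<Rightarrow> real" where
  "amp_const \<eta> \<mu> \<nu> R0 = 2 * x0\<^sup>2 * (mean_number R0 - (raise \<mu> \<nu>)\<^sup>2 / \<eta>)"

definition amp_cos :: "real \<Rightarrow> real \<Rightarrow> real \<Rightarrow> qop \<Rightarrow> real" where
  "amp_cos \<eta> \<mu> \<nu> R0 = 2 * x0\<^sup>2 * Re (coherent_part \<eta> \<mu> \<nu> R0)"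

definition amp_sin :: "real \<Rightarrow> real \<Rightarrow> real \<Rightarrow> qop \<Rightarrow> real" where
  "amp_sin \<eta> \<mu> \<nu> R0 = 2 * x0\<^sup>2 * Im (coherent_part \<eta> \<mu> \<nu> R0)"

text \<open>The number mean relaxes without oscillating and the second moment rotates while it
  decays. Passing from position to momentum flips the sign of the second moment, hence of the
  oscillating terms.\<close>

lemma qld_quadratures:
  assumes sol: "qld_solution hbar m \<Omega> \<mu> \<nu> R0 \<rho>" and \<eta>: "2 * \<mu> * \<nu> * hbar = \<eta>" "\<eta> > 0"
    and R0: "density_operator hbar m \<Omega> R0" "finite_energy hbar m \<Omega> R0" and t: "t \<ge> 0"
  shows "x0\<^sup>2 * (2 * mean_number (\<rho> t) + 1 + 2 * 1 * Re (pair_amplitude (\<rho> t)))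
     = exp (- 2 * \<eta> * t) * (amp_const \<eta> \<mu> \<nu> R0 + amp_cos \<eta> \<mu> \<nu> R0 * cos (2 * \<Omega> * t) + amp_sin \<eta> \<mu> \<nu> R0 * sin (2 * \<Omega> * t))
       + noise \<eta> \<mu> \<nu> / (8 * \<eta> * (\<Omega>\<^sup>2 + \<eta>\<^sup>2))" (is ?X)
    and "\<Omega>\<^sup>2 * x0\<^sup>2 * (2 * mean_number (\<rho> t) + 1 + 2 * - 1 * Re (pair_amplitude (\<rho> t)))
     = exp (- 2 * \<eta> * t) * (amp_const \<eta> \<mu> \<nu> R0 * \<Omega>\<^sup>2 - \<Omega>\<^sup>2 * amp_cos \<eta> \<mu> \<nu> R0 * cos (2 * \<Omega> * t)
         - \<Omega>\<^sup>2 * amp_sin \<eta> \<mu> \<nu> R0 * sin (2 * \<Omega> * t))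
       + (2 * \<eta>\<^sup>2 + \<Omega>\<^sup>2) * noise \<eta> \<mu> \<nu> / (8 * \<eta> * (\<Omega>\<^sup>2 + \<eta>\<^sup>2)) - 2 * hbar\<^sup>2 * \<nu>\<^sup>2 * \<eta>" (is ?Y)
proof -
  define E where "E = exp (- 2 * \<eta> * t)"
  define b where "b = (raise \<mu> \<nu>)\<^sup>2 / \<eta>"
  define k where "k = lower \<mu> \<nu> * raise \<mu> \<nu> * \<eta> / (\<eta>\<^sup>2 + \<Omega>\<^sup>2)"
  define w where "w = coherent_part \<eta> \<mu> \<nu> R0"
  have N: "mean_number (\<rho> t) = E * (mean_number R0 - b) + b"
    using qld_moments(3)[OF sol \<eta> R0 t] by (simp add: E_def b_def raise_def)
  have "pair_amplitude (\<rho> t) = exp (- 2 * (of_real \<eta> + \<i> * of_real \<Omega>) * of_real t) * w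
      - of_real (lower \<mu> \<nu> * raise \<mu> \<nu>) / (of_real \<eta> + \<i> * of_real \<Omega>)"
    using qld_moments(4)[OF sol \<eta> R0 t] by (simp only: w_def coherent_part_def lower_def raise_def)
  then have Q: "Re (pair_amplitude (\<rho> t)) = E * (Re w * cos (2 * \<Omega> * t) + Im w * sin (2 * \<Omega> * t)) - k"
    by (simp only: minus_complex.sel Re_damped_rotation Re_of_real_divide E_def k_def)
  note amps = amp_const_def amp_cos_def amp_sin_def b_def[symmetric] w_def[symmetric] E_def[symmetric]
  show ?X
    unfolding equilibrium_constants(1)[OF \<eta>, symmetric] N Q amps k_def[symmetric] by (simp add: algebra_simps)
  have "\<Omega>\<^sup>2 * x0\<^sup>2 * (2 * mean_number (\<rho> t) + 1 + 2 * - 1 * Re (pair_amplitude (\<rho> t)))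
     = E * (amp_const \<eta> \<mu> \<nu> R0 * \<Omega>\<^sup>2 - \<Omega>\<^sup>2 * amp_cos \<eta> \<mu> \<nu> R0 * cos (2 * \<Omega> * t)
         - \<Omega>\<^sup>2 * amp_sin \<eta> \<mu> \<nu> R0 * sin (2 * \<Omega> * t)) + \<Omega>\<^sup>2 * x0\<^sup>2 * (2 * b + 1 + 2 * k)"
    unfolding N Q amps by (simp add: algebra_simps)
  then show ?Y
    unfolding b_def k_def equilibrium_constants(2)[OF \<eta>] E_def by simp
qed

lemma momentum_scale: "1 / m\<^sup>2 * (hbar\<^sup>2 / (4 * x0\<^sup>2)) = \<Omega>\<^sup>2 * x0\<^sup>2"
  unfolding x0_sq using pos by (simp add: field_simps power2_eq_square)

lemma potential_scale: "1 / 2 * m * \<Omega>\<^sup>2 * x0\<^sup>2 = hbar * \<Omega> / 4"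
  unfolding x0_sq using pos by (simp add: field_simps power2_eq_square)

lemma kinetic_scale: "m / 2 * (\<Omega>\<^sup>2 * x0\<^sup>2) = hbar * \<Omega> / 4"
  using potential_scale by simp

text \<open>The energies are rescaled quadratures: m \<Omega>^2 / 2 times \<open>x0\<^sup>2\<close>
  and m / 2 times \<open>\<Omega>\<^sup>2 * x0\<^sup>2\<close> both equal hbar \<Omega> / 4. The
  limits and the rate then come from the damped oscillation.\<close>

lemma qld_fixed_temperature:
  fixes \<mu> \<nu> \<eta> :: real and R0 :: qop
  defines "A \<equiv> amp_const \<eta> \<mu> \<nu> R0" and "B \<equiv> amp_cos \<eta> \<mu> \<nu> R0" and "C \<equiv> amp_sin \<eta> \<mu> \<nu> R0"
    and "D \<equiv> noise \<eta> \<mu> \<nu>"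
  assumes sol: "qld_solution hbar m \<Omega> \<mu> \<nu> R0 \<rho>" and \<eta>: "2 * \<mu> * \<nu> * hbar = \<eta>" "\<eta> > 0"
    and R0: "density_operator hbar m \<Omega> R0" "finite_energy hbar m \<Omega> R0"
  shows "\<forall>t\<ge>0.
          has_expectation hbar m \<Omega> (\<rho> t) (position \<circ> position)
            (complex_of_real
              (exp (- 2 * \<eta> * t) * (A + B * cos (2 * \<Omega> * t) + C * sin (2 * \<Omega> * t))
               + D / (8 * \<eta> * (\<Omega>\<^sup>2 + \<eta>\<^sup>2)))) \<and>
          has_expectation hbar m \<Omega> (\<rho> t)
            (scale_op (1 / m\<^sup>2) (momentum hbar \<circ> momentum hbar))
            (complex_of_real
              (exp (- 2 * \<eta> * t) *
                 (A * \<Omega>\<^sup>2 - \<Omega>\<^sup>2 * B * cos (2 * \<Omega> * t) - \<Omega>\<^sup>2 * C * sin (2 * \<Omega> * t))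
               + (2 * \<eta>\<^sup>2 + \<Omega>\<^sup>2) * D / (8 * \<eta> * (\<Omega>\<^sup>2 + \<eta>\<^sup>2))
               - 2 * hbar\<^sup>2 * \<nu>\<^sup>2 * \<eta>)) \<and>
          has_expectation hbar m \<Omega> (\<rho> t) (potential (harmonic m \<Omega>))
            (complex_of_real (1 / 2 * m * \<Omega>\<^sup>2)
               * expectation hbar m \<Omega> (\<rho> t) (position \<circ> position)) \<and>
          (\<exists>K. has_expectation hbar m \<Omega> (\<rho> t) (kinetic hbar m) K)" (is ?moments)
    and "(\<lambda>t. expectation hbar m \<Omega> (\<rho> t) (potential (harmonic m \<Omega>))
               - complex_of_real (1 / 2 * m * \<Omega>\<^sup>2 * (D / (8 * \<eta> * (\<Omega>\<^sup>2 + \<eta>\<^sup>2)))))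
          \<in> O[at_top](\<lambda>t. complex_of_real (exp (- 2 * \<eta> * t)))" (is ?rate)
    and "((\<lambda>t. expectation hbar m \<Omega> (\<rho> t) (potential (harmonic m \<Omega>))) \<longlongrightarrow>
          complex_of_real (1 / 2 * m * \<Omega>\<^sup>2 * (D / (8 * \<eta> * (\<Omega>\<^sup>2 + \<eta>\<^sup>2))))) at_top" (is ?pot)
    and "((\<lambda>t. expectation hbar m \<Omega> (\<rho> t) (kinetic hbar m)) \<longlongrightarrow>
          complex_of_real (m * (2 * \<eta>\<^sup>2 + \<Omega>\<^sup>2) * D / (16 * \<eta> * (\<Omega>\<^sup>2 + \<eta>\<^sup>2))
                           - m * hbar\<^sup>2 * \<nu>\<^sup>2 * \<eta>)) at_top" (is ?kin)
proof -
  define X where "X = D / (8 * \<eta> * (\<Omega>\<^sup>2 + \<eta>\<^sup>2))"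
  define Y where "Y = (2 * \<eta>\<^sup>2 + \<Omega>\<^sup>2) * D / (8 * \<eta> * (\<Omega>\<^sup>2 + \<eta>\<^sup>2)) - 2 * hbar\<^sup>2 * \<nu>\<^sup>2 * \<eta>"
  define osc where "osc = (\<lambda>t. exp (- 2 * \<eta> * t) * (A + B * cos (2 * \<Omega> * t) + C * sin (2 * \<Omega> * t)))"
  define osc' where "osc' = (\<lambda>t. exp (- 2 * \<eta> * t) * (A * \<Omega>\<^sup>2 - \<Omega>\<^sup>2 * B * cos (2 * \<Omega> * t) - \<Omega>\<^sup>2 * C * sin (2 * \<Omega> * t)))"
  note q = qld_quadratures[OF sol \<eta> R0, folded A_def B_def C_def D_def]
  note E = quadratic_expectation[OF qld_moments(1)[OF sol \<eta> R0] qld_moments(2)[OF sol \<eta> R0]]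
  have pos2: "has_expectation hbar m \<Omega> (\<rho> t) (position \<circ> position) (of_real (osc t + X))" if "t \<ge> 0" for t
    using E[OF that that quadratic_observable_position] unfolding q(1)[OF that] osc_def X_def .
  have mom2: "has_expectation hbar m \<Omega> (\<rho> t) (scale_op (1 / m\<^sup>2) (momentum hbar \<circ> momentum hbar)) (of_real (osc' t + Y))"
    if "t \<ge> 0" for t
    using E[OF that that quadratic_observable_scale[OF quadratic_observable_momentum, of "1 / m\<^sup>2"]]
    unfolding momentum_scale q(2)[OF that] osc'_def Y_def by (simp only: add_diff_eq)
  have pot: "has_expectation hbar m \<Omega> (\<rho> t) (potential (harmonic m \<Omega>)) (of_real (1 / 2 * m * \<Omega>\<^sup>2 * (osc t + X)))"
    if "t \<ge> 0" for t
  proof -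
    have "1 / 2 * m * \<Omega>\<^sup>2 * (osc t + X) = hbar * \<Omega> / 4 * (2 * mean_number (\<rho> t) + 1 + 2 * 1 * Re (pair_amplitude (\<rho> t)))"
      unfolding osc_def X_def q(1)[OF that, symmetric] potential_scale[symmetric] by (simp only: mult.assoc)
    then show ?thesis using E[OF that that quadratic_observable_potential] by (simp only:)
  qed
  have kin: "has_expectation hbar m \<Omega> (\<rho> t) (kinetic hbar m) (of_real (m / 2 * (osc' t + Y)))" if "t \<ge> 0" for t
  proof -
    have "m / 2 * (osc' t + Y) = hbar * \<Omega> / 4 * (2 * mean_number (\<rho> t) + 1 + 2 * - 1 * Re (pair_amplitude (\<rho> t)))"
      unfolding osc'_def Y_def add_diff_eq q(2)[OF that, symmetric] kinetic_scale[symmetric] by (simp only: mult.assoc)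
    then show ?thesis using E[OF that that quadratic_observable_kinetic] by (simp only:)
  qed
  show ?moments
  proof (intro allI impI conjI)
    fix t :: real assume t: "0 \<le> t"
    show "has_expectation hbar m \<Omega> (\<rho> t) (potential (harmonic m \<Omega>))
        (complex_of_real (1 / 2 * m * \<Omega>\<^sup>2) * expectation hbar m \<Omega> (\<rho> t) (position \<circ> position))"
      using pot[OF t] unfolding expectation_eq[OF pos2[OF t]] by (simp only: of_real_mult)
    show "\<exists>K. has_expectation hbar m \<Omega> (\<rho> t) (kinetic hbar m) K" using kin[OF t] by blast
  qed (use pos2 mom2 in \<open>simp_all only: osc_def osc'_def X_def Y_def add_diff_eq\<close>)
  have ev: "\<forall>\<^sub>F t :: real in at_top. 0 \<le> t" by (rule eventually_ge_at_top)
  have osc0: "(osc \<longlongrightarrow> 0) at_top"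
    unfolding osc_def by (rule damped_oscillation_tendsto_0[OF \<eta>(2)])
  have osc0': "(osc' \<longlongrightarrow> 0) at_top"
    using damped_oscillation_tendsto_0[OF \<eta>(2), of "A * \<Omega>\<^sup>2" "- \<Omega>\<^sup>2 * B" "\<lambda>t. 2 * \<Omega> * t" "- \<Omega>\<^sup>2 * C"]
    by (simp add: osc'_def[abs_def] algebra_simps)
  have "((\<lambda>t. complex_of_real (1 / 2 * m * \<Omega>\<^sup>2 * (osc t + X))) \<longlongrightarrow> of_real (1 / 2 * m * \<Omega>\<^sup>2 * (0 + X))) at_top"
    by (intro tendsto_of_real tendsto_mult tendsto_add tendsto_const osc0)
  then have "((\<lambda>t. complex_of_real (1 / 2 * m * \<Omega>\<^sup>2 * (osc t + X))) \<longlongrightarrow> of_real (1 / 2 * m * \<Omega>\<^sup>2 * X)) at_top"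
    by (simp only: add_0)
  then show ?pot unfolding X_def[symmetric]
    by (rule Lim_transform_eventually) (use ev in eventually_elim, simp only: expectation_eq[OF pot])
  have "((\<lambda>t. complex_of_real (m / 2 * (osc' t + Y))) \<longlongrightarrow> of_real (m / 2 * (0 + Y))) at_top"
    by (intro tendsto_of_real tendsto_mult tendsto_add tendsto_const osc0')
  moreover have "m / 2 * (0 + Y) = m * (2 * \<eta>\<^sup>2 + \<Omega>\<^sup>2) * D / (16 * \<eta> * (\<Omega>\<^sup>2 + \<eta>\<^sup>2)) - m * hbar\<^sup>2 * \<nu>\<^sup>2 * \<eta>"
  proof -
    have "m / 2 * (0 + (c * D / (8 * \<eta> * W) - 2 * hbar\<^sup>2 * \<nu>\<^sup>2 * \<eta>)) = m * c * D / (16 * \<eta> * W) - m * hbar\<^sup>2 * \<nu>\<^sup>2 * \<eta>" for c W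
      by (simp add: right_diff_distrib)
    then show ?thesis unfolding Y_def .
  qed
  ultimately have "((\<lambda>t. complex_of_real (m / 2 * (osc' t + Y))) \<longlongrightarrow>
     of_real (m * (2 * \<eta>\<^sup>2 + \<Omega>\<^sup>2) * D / (16 * \<eta> * (\<Omega>\<^sup>2 + \<eta>\<^sup>2)) - m * hbar\<^sup>2 * \<nu>\<^sup>2 * \<eta>)) at_top"
    by (simp only:)
  then show ?kin
    by (rule Lim_transform_eventually) (use ev in eventually_elim, simp only: expectation_eq[OF kin])
  show ?rate
  proof (rule bigoI)
    show "\<forall>\<^sub>F t in at_top. norm (expectation hbar m \<Omega> (\<rho> t) (potential (harmonic m \<Omega>))
        - complex_of_real (1 / 2 * m * \<Omega>\<^sup>2 * (D / (8 * \<eta> * (\<Omega>\<^sup>2 + \<eta>\<^sup>2)))))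
       \<le> (1 / 2 * m * \<Omega>\<^sup>2 * (\<bar>A\<bar> + \<bar>B\<bar> + \<bar>C\<bar>)) * norm (complex_of_real (exp (- 2 * \<eta> * t)))"
      using ev
    proof eventually_elim
      fix t :: real assume t: "0 \<le> t"
      have "expectation hbar m \<Omega> (\<rho> t) (potential (harmonic m \<Omega>))
        - complex_of_real (1 / 2 * m * \<Omega>\<^sup>2 * (D / (8 * \<eta> * (\<Omega>\<^sup>2 + \<eta>\<^sup>2)))) = of_real (1 / 2 * m * \<Omega>\<^sup>2 * osc t)"
        unfolding expectation_eq[OF pot[OF t]] X_def[symmetric] of_real_diff[symmetric] by (simp only: distrib_left add_diff_cancel_right')
      moreover have "\<bar>osc t\<bar> \<le> (\<bar>A\<bar> + \<bar>B\<bar> + \<bar>C\<bar>) * exp (- 2 * \<eta> * t)"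
        unfolding osc_def by (rule damped_oscillation_le)
      then have "1 / 2 * m * \<Omega>\<^sup>2 * \<bar>osc t\<bar> \<le> 1 / 2 * m * \<Omega>\<^sup>2 * ((\<bar>A\<bar> + \<bar>B\<bar> + \<bar>C\<bar>) * exp (- 2 * \<eta> * t))"
        using pos by (intro mult_left_mono) auto
      moreover have "\<bar>1 / 2 * m * \<Omega>\<^sup>2 * osc t\<bar> = 1 / 2 * m * \<Omega>\<^sup>2 * \<bar>osc t\<bar>"
        using pos by (simp add: abs_mult)
      ultimately show "norm (expectation hbar m \<Omega> (\<rho> t) (potential (harmonic m \<Omega>))
        - complex_of_real (1 / 2 * m * \<Omega>\<^sup>2 * (D / (8 * \<eta> * (\<Omega>\<^sup>2 + \<eta>\<^sup>2)))))
       \<le> (1 / 2 * m * \<Omega>\<^sup>2 * (\<bar>A\<bar> + \<bar>B\<bar> + \<bar>C\<bar>)) * norm (complex_of_real (exp (- 2 * \<eta> * t)))"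
        by (simp only: norm_of_real abs_exp_cancel mult.assoc)
    qed
  qed
qed

section \<open>The limit of zero temperature and large time\<close>

context
  fixes \<eta> k :: real and \<mu> \<nu> :: "real \<Rightarrow> real"
  assumes \<eta>k: "\<eta> > 0" "k > 0"
    and coeffs: "\<forall>T>0. langevin_coeffs hbar m \<Omega> \<eta> k T (\<mu> T) (\<nu> T)"
begin

lemma coeff_product: "T > 0 \<Longrightarrow> 2 * \<mu> T * \<nu> T * hbar = \<eta>"
  using coeffs unfolding langevin_coeffs_def by blast

lemma positive_temperature: "\<forall>\<^sub>F T :: real in at_right 0. T > 0"
  by (simp add: eventually_at_right_less)

text \<open>The argument hbar \<Omega> / (4 k T) grows without bound, so tanh and its inverse coth
  tend to 1. The limits concern squares because the conditions fix \<mu> and \<nu> only up to a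
  common sign, which may vary with T.\<close>

lemma coeff_limits:
  "((\<lambda>T. (\<mu> T)\<^sup>2) \<longlongrightarrow> \<eta> * m * \<Omega> / (2 * hbar)) (at_right 0)"
  "((\<lambda>T. (\<nu> T)\<^sup>2) \<longlongrightarrow> \<eta> / (2 * hbar * m * \<Omega>)) (at_right 0)"
proof -
  define h where "h = (\<lambda>T. tanh (hbar * \<Omega> / (4 * k * T)))"
  have "((\<lambda>T. tanh ((hbar * \<Omega> / (4 * k)) / T)) \<longlongrightarrow> 1) (at_right 0)"
    by (rule tanh_inverse_temperature_tendsto) (use pos \<eta>k in simp)
  then have h: "(h \<longlongrightarrow> 1) (at_right 0)" by (simp add: h_def)
  have "((\<lambda>T. \<eta> * m * \<Omega> / (2 * hbar) * inverse (h T)) \<longlongrightarrow> \<eta> * m * \<Omega> / (2 * hbar) * inverse 1) (at_right 0)"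
    by (intro tendsto_intros h) simp
  then have "((\<lambda>T. \<eta> * m * \<Omega> / (2 * hbar) * inverse (h T)) \<longlongrightarrow> \<eta> * m * \<Omega> / (2 * hbar)) (at_right 0)" by simp
  then show "((\<lambda>T. (\<mu> T)\<^sup>2) \<longlongrightarrow> \<eta> * m * \<Omega> / (2 * hbar)) (at_right 0)"
  proof (rule Lim_transform_eventually)
    show "\<forall>\<^sub>F T in at_right 0. \<eta> * m * \<Omega> / (2 * hbar) * inverse (h T) = (\<mu> T)\<^sup>2"
      using positive_temperature
      by eventually_elim (use coeffs in \<open>auto simp: langevin_coeffs_def h_def tanh_def\<close>)
  qed
  have "((\<lambda>T. \<eta> / (2 * hbar * m * \<Omega>) * h T) \<longlongrightarrow> \<eta> / (2 * hbar * m * \<Omega>) * 1) (at_right 0)"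
    by (intro tendsto_intros h)
  then have "((\<lambda>T. \<eta> / (2 * hbar * m * \<Omega>) * h T) \<longlongrightarrow> \<eta> / (2 * hbar * m * \<Omega>)) (at_right 0)" by simp
  then show "((\<lambda>T. (\<nu> T)\<^sup>2) \<longlongrightarrow> \<eta> / (2 * hbar * m * \<Omega>)) (at_right 0)"
  proof (rule Lim_transform_eventually)
    show "\<forall>\<^sub>F T in at_right 0. \<eta> / (2 * hbar * m * \<Omega>) * h T = (\<nu> T)\<^sup>2"
      using positive_temperature
      by eventually_elim (use coeffs in \<open>auto simp: langevin_coeffs_def h_def\<close>)
  qed
qed

lemma noise_limit: "((\<lambda>T. noise \<eta> (\<mu> T) (\<nu> T)) \<longlongrightarrow> 4 * \<eta> * hbar * (\<Omega>\<^sup>2 + \<eta>\<^sup>2) / (m * \<Omega>)) (at_right 0)"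
proof -
  have "((\<lambda>T. noise \<eta> (\<mu> T) (\<nu> T)) \<longlongrightarrow> 4 / m\<^sup>2 * (\<eta> * m * \<Omega> / (2 * hbar)) * hbar\<^sup>2
      + 4 * (\<Omega>\<^sup>2 + 2 * \<eta>\<^sup>2) * (\<eta> / (2 * hbar * m * \<Omega>)) * hbar\<^sup>2) (at_right 0)"
    unfolding noise_def by (intro tendsto_add tendsto_mult tendsto_const coeff_limits)
  also have "4 / m\<^sup>2 * (\<eta> * m * \<Omega> / (2 * hbar)) * hbar\<^sup>2
      + 4 * (\<Omega>\<^sup>2 + 2 * \<eta>\<^sup>2) * (\<eta> / (2 * hbar * m * \<Omega>)) * hbar\<^sup>2 = 4 * \<eta> * hbar * (\<Omega>\<^sup>2 + \<eta>\<^sup>2) / (m * \<Omega>)"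
    using pos by (simp add: field_simps power2_eq_square)
  finally show ?thesis .
qed

lemma zero_temperature_potential:
  "((\<lambda>T. 1 / 2 * m * \<Omega>\<^sup>2 * (noise \<eta> (\<mu> T) (\<nu> T) / (8 * \<eta> * (\<Omega>\<^sup>2 + \<eta>\<^sup>2)))) \<longlongrightarrow> 1 / 4 * hbar * \<Omega>) (at_right 0)"
proof -
  have W: "\<Omega>\<^sup>2 + \<eta>\<^sup>2 > 0" using pos by (intro add_pos_nonneg) auto
  have "((\<lambda>T. 1 / 2 * m * \<Omega>\<^sup>2 * (noise \<eta> (\<mu> T) (\<nu> T) / (8 * \<eta> * (\<Omega>\<^sup>2 + \<eta>\<^sup>2)))) \<longlongrightarrow>
     1 / 2 * m * \<Omega>\<^sup>2 * (4 * \<eta> * hbar * (\<Omega>\<^sup>2 + \<eta>\<^sup>2) / (m * \<Omega>) / (8 * \<eta> * (\<Omega>\<^sup>2 + \<eta>\<^sup>2)))) (at_right 0)"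
    by (intro tendsto_mult tendsto_divide tendsto_const noise_limit) (use W \<eta>k in simp)
  also have "1 / 2 * m * \<Omega>\<^sup>2 * (4 * \<eta> * hbar * (\<Omega>\<^sup>2 + \<eta>\<^sup>2) / (m * \<Omega>) / (8 * \<eta> * (\<Omega>\<^sup>2 + \<eta>\<^sup>2))) = 1 / 4 * hbar * \<Omega>"
    using pos \<eta>k W by (simp add: divide_simps) (simp add: power2_eq_square)
  finally show ?thesis .
qed

lemma zero_temperature_kinetic:
  "((\<lambda>T. m * (2 * \<eta>\<^sup>2 + \<Omega>\<^sup>2) * noise \<eta> (\<mu> T) (\<nu> T) / (16 * \<eta> * (\<Omega>\<^sup>2 + \<eta>\<^sup>2)) - m * hbar\<^sup>2 * (\<nu> T)\<^sup>2 * \<eta>) \<longlongrightarrow>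
     1 / 4 * hbar * \<Omega>) (at_right 0)"
proof -
  define W where "W = \<Omega>\<^sup>2 + \<eta>\<^sup>2"
  have W: "W > 0" using pos unfolding W_def by (intro add_pos_nonneg) auto
  have "((\<lambda>T. m * (2 * \<eta>\<^sup>2 + \<Omega>\<^sup>2) * noise \<eta> (\<mu> T) (\<nu> T) / (16 * \<eta> * W) - m * hbar\<^sup>2 * (\<nu> T)\<^sup>2 * \<eta>) \<longlongrightarrow>
     m * (2 * \<eta>\<^sup>2 + \<Omega>\<^sup>2) * (4 * \<eta> * hbar * W / (m * \<Omega>)) / (16 * \<eta> * W) - m * hbar\<^sup>2 * (\<eta> / (2 * hbar * m * \<Omega>)) * \<eta>) (at_right 0)"
    by (intro tendsto_mult tendsto_divide tendsto_diff tendsto_const noise_limit[folded W_def] coeff_limits) (use W \<eta>k in simp)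
  also have "m * (2 * \<eta>\<^sup>2 + \<Omega>\<^sup>2) * (4 * \<eta> * hbar * W / (m * \<Omega>)) / (16 * \<eta> * W) - m * hbar\<^sup>2 * (\<eta> / (2 * hbar * m * \<Omega>)) * \<eta>
     = 1 / 4 * hbar * \<Omega>"
    using pos \<eta>k W by (simp add: divide_simps) (simp add: power2_eq_square algebra_simps)
  finally show ?thesis unfolding W_def .
qed

text \<open>Both quantities are expressed by squares of \<mu> and \<nu>: the cross term of the
  square of \<open>raise\<close> is the constant \<eta> / 2, and the product with
  \<open>lower\<close> is a difference of squares. Each share tends to \<eta> / 4.\<close>

lemma jump_coefficient_limits:
  "((\<lambda>T. (raise (\<mu> T) (\<nu> T))\<^sup>2) \<longlongrightarrow> 0) (at_right 0)"
  "((\<lambda>T. lower (\<mu> T) (\<nu> T) * raise (\<mu> T) (\<nu> T)) \<longlongrightarrow> 0) (at_right 0)"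
proof -
  have c: "\<eta> * m * \<Omega> / (2 * hbar) * x0\<^sup>2 = \<eta> / 4" "\<eta> / (2 * hbar * m * \<Omega>) * (hbar\<^sup>2 / (4 * x0\<^sup>2)) = \<eta> / 4"
    unfolding x0_sq using pos by (simp_all add: field_simps power2_eq_square)
  have "((\<lambda>T. (\<mu> T)\<^sup>2 * x0\<^sup>2 + (\<nu> T)\<^sup>2 * (hbar\<^sup>2 / (4 * x0\<^sup>2)) - \<eta> / 2) \<longlongrightarrow>
      \<eta> * m * \<Omega> / (2 * hbar) * x0\<^sup>2 + \<eta> / (2 * hbar * m * \<Omega>) * (hbar\<^sup>2 / (4 * x0\<^sup>2)) - \<eta> / 2) (at_right 0)"
    by (intro tendsto_add tendsto_diff tendsto_mult tendsto_const coeff_limits)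
  then have "((\<lambda>T. (\<mu> T)\<^sup>2 * x0\<^sup>2 + (\<nu> T)\<^sup>2 * (hbar\<^sup>2 / (4 * x0\<^sup>2)) - \<eta> / 2) \<longlongrightarrow> 0) (at_right 0)"
    unfolding c by simp
  then show "((\<lambda>T. (raise (\<mu> T) (\<nu> T))\<^sup>2) \<longlongrightarrow> 0) (at_right 0)"
  proof (rule Lim_transform_eventually)
    show "\<forall>\<^sub>F T in at_right 0. (\<mu> T)\<^sup>2 * x0\<^sup>2 + (\<nu> T)\<^sup>2 * (hbar\<^sup>2 / (4 * x0\<^sup>2)) - \<eta> / 2 = (raise (\<mu> T) (\<nu> T))\<^sup>2"
      using positive_temperature
    proof eventually_elim
      fix T :: real assume "T > 0"
      then have "\<eta> / 2 = \<mu> T * \<nu> T * hbar" using coeff_product by force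
      then show "(\<mu> T)\<^sup>2 * x0\<^sup>2 + (\<nu> T)\<^sup>2 * (hbar\<^sup>2 / (4 * x0\<^sup>2)) - \<eta> / 2 = (raise (\<mu> T) (\<nu> T))\<^sup>2"
        unfolding raise_def using x0_pos by (simp add: field_simps power2_eq_square)
    qed
  qed
  have "((\<lambda>T. (\<mu> T)\<^sup>2 * x0\<^sup>2 - (\<nu> T)\<^sup>2 * (hbar\<^sup>2 / (4 * x0\<^sup>2))) \<longlongrightarrow>
      \<eta> * m * \<Omega> / (2 * hbar) * x0\<^sup>2 - \<eta> / (2 * hbar * m * \<Omega>) * (hbar\<^sup>2 / (4 * x0\<^sup>2))) (at_right 0)"
    by (intro tendsto_diff tendsto_mult tendsto_const coeff_limits)
  moreover have "(\<mu> T)\<^sup>2 * x0\<^sup>2 - (\<nu> T)\<^sup>2 * (hbar\<^sup>2 / (4 * x0\<^sup>2)) = lower (\<mu> T) (\<nu> T) * raise (\<mu> T) (\<nu> T)" for T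
    unfolding raise_def lower_def using x0_pos by (simp add: field_simps power2_eq_square)
  ultimately show "((\<lambda>T. lower (\<mu> T) (\<nu> T) * raise (\<mu> T) (\<nu> T)) \<longlongrightarrow> 0) (at_right 0)"
    unfolding c by simp
qed

context
  fixes R0 :: qop and \<rho> :: "real \<Rightarrow> real \<Rightarrow> qop"
  assumes R0: "density_operator hbar m \<Omega> R0" "finite_energy hbar m \<Omega> R0"
    and solutions: "\<forall>T>0. qld_solution hbar m \<Omega> (\<mu> T) (\<nu> T) R0 (\<rho> T)"
begin

lemma sol: "T > 0 \<Longrightarrow> qld_solution hbar m \<Omega> (\<mu> T) (\<nu> T) R0 (\<rho> T)"
  using solutions by blast

lemma eventually_physical: "\<forall>\<^sub>F (T, t) in at_right (0::real) \<times>\<^sub>F at_top. T > 0 \<and> t \<ge> (0::real)"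
  using eventually_prodI[OF positive_temperature eventually_ge_at_top[of "0::real"]]
  by (simp add: case_prod_unfold)

text \<open>The transient is an exponential in t times a quantity convergent in T, and the remaining
  term depends on T alone. Hence convergence holds along the product filter, without an order of
  limits.\<close>

lemma mean_number_ground:
  "((\<lambda>(T, t). mean_number (\<rho> T t)) \<longlongrightarrow> 0) (at_right 0 \<times>\<^sub>F at_top)"
proof -
  let ?F = "at_right (0::real) \<times>\<^sub>F (at_top :: real filter)"
  let ?b = "\<lambda>T. (raise (\<mu> T) (\<nu> T))\<^sup>2 / \<eta>"
  have b: "((\<lambda>x. ?b (fst x)) \<longlongrightarrow> 0) ?F"
    using tendsto_divide[OF jump_coefficient_limits(1) tendsto_const, of \<eta>] \<eta>k
    by (intro filterlim_compose[OF _ filterlim_fst]) auto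
  have e: "((\<lambda>x. exp (- 2 * \<eta> * snd x)) \<longlongrightarrow> 0) ?F"
    by (intro filterlim_compose[OF exp_decay_tendsto_0 filterlim_snd] \<eta>k)
  have "((\<lambda>x. exp (- 2 * \<eta> * snd x) * (mean_number R0 - ?b (fst x)) + ?b (fst x)) \<longlongrightarrow> 0 * (mean_number R0 - 0) + 0) ?F"
    by (intro tendsto_add tendsto_mult tendsto_diff tendsto_const b e)
  then have "((\<lambda>x. exp (- 2 * \<eta> * snd x) * (mean_number R0 - ?b (fst x)) + ?b (fst x)) \<longlongrightarrow> 0) ?F" by simp
  then show ?thesis
  proof (rule Lim_transform_eventually)
    show "\<forall>\<^sub>F x in ?F. exp (- 2 * \<eta> * snd x) * (mean_number R0 - ?b (fst x)) + ?b (fst x) = (case x of (T, t) \<Rightarrow> mean_number (\<rho> T t))"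
      using eventually_physical
      by eventually_elim
        (auto simp: raise_def qld_moments(3)[OF sol coeff_product \<eta>k(1) R0])
  qed
qed

lemma pair_amplitude_ground:
  "((\<lambda>(T, t). pair_amplitude (\<rho> T t)) \<longlongrightarrow> 0) (at_right 0 \<times>\<^sub>F at_top)"
proof -
  let ?F = "at_right (0::real) \<times>\<^sub>F (at_top :: real filter)"
  define z where "z = complex_of_real \<eta> + \<i> * of_real \<Omega>"
  let ?b = "\<lambda>T. of_real (lower (\<mu> T) (\<nu> T) * raise (\<mu> T) (\<nu> T)) / z"
  have z: "z \<noteq> 0" using \<eta>k by (simp add: z_def complex_eq_iff)
  have "((\<lambda>T. ?b T) \<longlongrightarrow> of_real 0 / z) (at_right 0)"
    using z by (intro tendsto_divide tendsto_of_real jump_coefficient_limits(2) tendsto_const)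
  then have b: "((\<lambda>x. ?b (fst x)) \<longlongrightarrow> 0) ?F"
    by (intro filterlim_compose[OF _ filterlim_fst]) auto
  \<comment> \<open>The modulus of the rotating factor is exp (- 2 \<eta> t).\<close>
  have "((\<lambda>t. norm (exp (- 2 * z * of_real t))) \<longlongrightarrow> 0) at_top"
    using exp_decay_tendsto_0[OF \<eta>k(1)] by (simp add: z_def)
  then have "((\<lambda>t. exp (- 2 * z * of_real t)) \<longlongrightarrow> 0) at_top" by (rule tendsto_norm_zero_cancel)
  then have e: "((\<lambda>x. exp (- 2 * z * of_real (snd x))) \<longlongrightarrow> 0) ?F"
    by (rule filterlim_compose[OF _ filterlim_snd])
  have "((\<lambda>x. exp (- 2 * z * of_real (snd x)) * (pair_amplitude R0 + ?b (fst x)) - ?b (fst x)) \<longlongrightarrow> 0 * (pair_amplitude R0 + 0) - 0) ?F"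
    by (intro tendsto_add tendsto_mult tendsto_diff tendsto_const b e)
  then have "((\<lambda>x. exp (- 2 * z * of_real (snd x)) * (pair_amplitude R0 + ?b (fst x)) - ?b (fst x)) \<longlongrightarrow> 0) ?F" by simp
  then show ?thesis
  proof (rule Lim_transform_eventually)
    show "\<forall>\<^sub>F x in ?F. exp (- 2 * z * of_real (snd x)) * (pair_amplitude R0 + ?b (fst x)) - ?b (fst x)
        = (case x of (T, t) \<Rightarrow> pair_amplitude (\<rho> T t))"
      using eventually_physical
    proof eventually_elim
      fix x :: "real \<times> real" assume "case x of (T, t) \<Rightarrow> T > 0 \<and> t \<ge> 0"
      then obtain T t where x: "x = (T, t)" "T > 0" "t \<ge> 0" by (cases x) auto
      show "exp (- 2 * z * of_real (snd x)) * (pair_amplitude R0 + ?b (fst x)) - ?b (fst x)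
        = (case x of (T, t) \<Rightarrow> pair_amplitude (\<rho> T t))"
        unfolding x(1) prod.case fst_conv snd_conv qld_moments(4)[OF sol[OF x(2)] coeff_product[OF x(2)] \<eta>k(1) R0 x(3)]
          z_def lower_def raise_def ..
    qed
  qed
qed

lemma quadratic_expectation_exists:
  assumes "T > 0" "t \<ge> 0" "quadratic_observable Ob c \<sigma>"
  shows "has_expectation hbar m \<Omega> (\<rho> T t) Ob
     (of_real (c * (2 * mean_number (\<rho> T t) + 1 + 2 * \<sigma> * Re (pair_amplitude (\<rho> T t)))))"
  using assms by (intro quadratic_expectation qld_moments(1,2)[OF sol coeff_product \<eta>k(1) R0])

text \<open>With both moments gone, only the zero-point 1 in 2 N + 1 is left, whatever \<sigma>; its
  coefficient c is the ground state value.\<close>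

lemma quadratic_expectation_ground:
  assumes Ob: "quadratic_observable Ob c \<sigma>"
  shows "((\<lambda>(T, t). expectation hbar m \<Omega> (\<rho> T t) Ob) \<longlongrightarrow> of_real c) (at_right 0 \<times>\<^sub>F at_top)"
proof -
  let ?F = "at_right (0::real) \<times>\<^sub>F (at_top :: real filter)"
  have "((\<lambda>x. complex_of_real (c * (2 * mean_number (\<rho> (fst x) (snd x)) + 1 + 2 * \<sigma> * Re (pair_amplitude (\<rho> (fst x) (snd x))))))
      \<longlongrightarrow> of_real (c * (2 * 0 + 1 + 2 * \<sigma> * Re 0))) ?F"
    using mean_number_ground pair_amplitude_ground unfolding case_prod_unfold
    by (intro tendsto_of_real tendsto_mult tendsto_add tendsto_const tendsto_Re)
  then have "((\<lambda>x. complex_of_real (c * (2 * mean_number (\<rho> (fst x) (snd x)) + 1 + 2 * \<sigma> * Re (pair_amplitude (\<rho> (fst x) (snd x))))))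
      \<longlongrightarrow> of_real c) ?F" by simp
  then show ?thesis
  proof (rule Lim_transform_eventually)
    show "\<forall>\<^sub>F x in ?F. complex_of_real (c * (2 * mean_number (\<rho> (fst x) (snd x)) + 1 + 2 * \<sigma> * Re (pair_amplitude (\<rho> (fst x) (snd x)))))
       = (case x of (T, t) \<Rightarrow> expectation hbar m \<Omega> (\<rho> T t) Ob)"
      using eventually_physical
      by eventually_elim (auto simp only: case_prod_unfold expectation_eq[OF quadratic_expectation_exists[OF _ _ Ob]])
  qed
qed

lemma ground_population_tendsto:
  "((\<lambda>(T, t). l2_inner (e 0) (\<rho> T t (e 0))) \<longlongrightarrow> 1) (at_right 0 \<times>\<^sub>F at_top)"
proof -
  have "((\<lambda>(T, t). l2_inner (e 0) (\<rho> T t (e 0)) - 1) \<longlongrightarrow> 0) (at_right 0 \<times>\<^sub>F at_top)"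
  proof (rule Lim_null_comparison[OF _ mean_number_ground])
    show "\<forall>\<^sub>F x in at_right 0 \<times>\<^sub>F at_top. norm (case x of (T, t) \<Rightarrow> l2_inner (e 0) (\<rho> T t (e 0)) - 1)
        \<le> (case x of (T, t) \<Rightarrow> mean_number (\<rho> T t))"
      using eventually_physical
    proof eventually_elim
      fix x :: "real \<times> real" assume "case x of (T, t) \<Rightarrow> T > 0 \<and> t \<ge> 0"
      then obtain T t where x: "x = (T, t)" "T > 0" "t \<ge> 0" by (cases x) auto
      show "norm (case x of (T, t) \<Rightarrow> l2_inner (e 0) (\<rho> T t (e 0)) - 1) \<le> (case x of (T, t) \<Rightarrow> mean_number (\<rho> T t))"
        unfolding x(1) prod.case
        by (intro ground_population_deficit qld_moments(1,2)[OF sol[OF x(2)] coeff_product[OF x(2)] \<eta>k(1) R0 x(3)])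
    qed
  qed
  then show ?thesis unfolding case_prod_unfold by (simp only: LIM_zero_iff)
qed

end

end

end

theorem mainTheorem4:
  fixes hbar m \<Omega> \<eta> k :: real and \<mu> \<nu> D :: "real \<Rightarrow> real" and R0 :: qop
  assumes pos: "hbar > 0" "m > 0" "\<Omega> > 0" "\<eta> > 0" "k > 0"
    and coeffs: "\<And>T. T > 0 \<Longrightarrow> langevin_coeffs hbar m \<Omega> \<eta> k T (\<mu> T) (\<nu> T)"
    and D: "\<And>T. D T = 4 / m\<^sup>2 * (\<mu> T)\<^sup>2 * hbar\<^sup>2
                        + 4 * (\<Omega>\<^sup>2 + 2 * \<eta>\<^sup>2) * (\<nu> T)\<^sup>2 * hbar\<^sup>2"
    and R0: "density_operator hbar m \<Omega> R0" "finite_energy hbar m \<Omega> R0"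
  shows
    "(\<forall>T>0. \<exists>A B C :: real. \<forall>\<rho>. qld_solution hbar m \<Omega> (\<mu> T) (\<nu> T) R0 \<rho> \<longrightarrow>
        (\<forall>t\<ge>0.
          has_expectation hbar m \<Omega> (\<rho> t) (position \<circ> position)
            (complex_of_real
              (exp (- 2 * \<eta> * t) * (A + B * cos (2 * \<Omega> * t) + C * sin (2 * \<Omega> * t))
               + D T / (8 * \<eta> * (\<Omega>\<^sup>2 + \<eta>\<^sup>2)))) \<and>
          has_expectation hbar m \<Omega> (\<rho> t)
            (scale_op (1 / m\<^sup>2) (momentum hbar \<circ> momentum hbar))
            (complex_of_real
              (exp (- 2 * \<eta> * t) *
                 (A * \<Omega>\<^sup>2 - \<Omega>\<^sup>2 * B * cos (2 * \<Omega> * t) - \<Omega>\<^sup>2 * C * sin (2 * \<Omega> * t))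
               + (2 * \<eta>\<^sup>2 + \<Omega>\<^sup>2) * D T / (8 * \<eta> * (\<Omega>\<^sup>2 + \<eta>\<^sup>2))
               - 2 * hbar\<^sup>2 * (\<nu> T)\<^sup>2 * \<eta>)) \<and>
          has_expectation hbar m \<Omega> (\<rho> t) (potential (harmonic m \<Omega>))
            (complex_of_real (1 / 2 * m * \<Omega>\<^sup>2)
               * expectation hbar m \<Omega> (\<rho> t) (position \<circ> position)) \<and>
          (\<exists>K. has_expectation hbar m \<Omega> (\<rho> t) (kinetic hbar m) K)) \<and>
        (\<lambda>t. expectation hbar m \<Omega> (\<rho> t) (potential (harmonic m \<Omega>))
               - complex_of_real (1 / 2 * m * \<Omega>\<^sup>2 * (D T / (8 * \<eta> * (\<Omega>\<^sup>2 + \<eta>\<^sup>2)))))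
          \<in> O[at_top](\<lambda>t. complex_of_real (exp (- 2 * \<eta> * t))) \<and>
        ((\<lambda>t. expectation hbar m \<Omega> (\<rho> t) (potential (harmonic m \<Omega>))) \<longlongrightarrow>
          complex_of_real (1 / 2 * m * \<Omega>\<^sup>2 * (D T / (8 * \<eta> * (\<Omega>\<^sup>2 + \<eta>\<^sup>2))))) at_top \<and>
        ((\<lambda>t. expectation hbar m \<Omega> (\<rho> t) (kinetic hbar m)) \<longlongrightarrow>
          complex_of_real (m * (2 * \<eta>\<^sup>2 + \<Omega>\<^sup>2) * D T / (16 * \<eta> * (\<Omega>\<^sup>2 + \<eta>\<^sup>2))
                           - m * hbar\<^sup>2 * (\<nu> T)\<^sup>2 * \<eta>)) at_top)
     \<and> ((\<lambda>T. 1 / 2 * m * \<Omega>\<^sup>2 * (D T / (8 * \<eta> * (\<Omega>\<^sup>2 + \<eta>\<^sup>2)))) \<longlongrightarrow>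
          1 / 4 * hbar * \<Omega>) (at_right 0)
     \<and> ((\<lambda>T. m * (2 * \<eta>\<^sup>2 + \<Omega>\<^sup>2) * D T / (16 * \<eta> * (\<Omega>\<^sup>2 + \<eta>\<^sup>2))
               - m * hbar\<^sup>2 * (\<nu> T)\<^sup>2 * \<eta>) \<longlongrightarrow> 1 / 4 * hbar * \<Omega>) (at_right 0)
     \<and> ground_state (hamiltonian hbar m (harmonic m \<Omega>)) (1 / 2 * hbar * \<Omega>)
          (qho_basis hbar m \<Omega> 0)
     \<and> (\<forall>\<rho>. (\<forall>T>0. qld_solution hbar m \<Omega> (\<mu> T) (\<nu> T) R0 (\<rho> T)) \<longrightarrow>
        (\<forall>T>0. \<forall>t\<ge>0. \<exists>E. has_expectation hbar m \<Omega> (\<rho> T t)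
                            (hamiltonian hbar m (harmonic m \<Omega>)) E) \<and>
        ((\<lambda>(T, t). expectation hbar m \<Omega> (\<rho> T t) (potential (harmonic m \<Omega>))) \<longlongrightarrow>
          complex_of_real (1 / 4 * hbar * \<Omega>)) (at_right 0 \<times>\<^sub>F at_top) \<and>
        ((\<lambda>(T, t). expectation hbar m \<Omega> (\<rho> T t) (kinetic hbar m)) \<longlongrightarrow>
          complex_of_real (1 / 4 * hbar * \<Omega>)) (at_right 0 \<times>\<^sub>F at_top) \<and>
        ((\<lambda>(T, t). expectation hbar m \<Omega> (\<rho> T t) (hamiltonian hbar m (harmonic m \<Omega>))) \<longlongrightarrow>
          complex_of_real (1 / 2 * hbar * \<Omega>)) (at_right 0 \<times>\<^sub>F at_top) \<and>
        ((\<lambda>(T, t). l2_inner (qho_basis hbar m \<Omega> 0) (\<rho> T t (qho_basis hbar m \<Omega> 0))) \<longlongrightarrow> 1)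
          (at_right 0 \<times>\<^sub>F at_top))"
proof -
  have \<eta>k: "\<eta> > 0" "k > 0" using pos by auto
  interpret oscillator hbar m \<Omega> by standard (use pos in auto)
  have Dn: "D = (\<lambda>T. noise \<eta> (\<mu> T) (\<nu> T))" by (rule ext) (simp add: D noise_def)
  have coeffs_all: "\<forall>T>0. langevin_coeffs hbar m \<Omega> \<eta> k T (\<mu> T) (\<nu> T)" using coeffs by blast
  note prod = coeff_product[OF \<eta>k coeffs_all]
  have quarter: "1 / 4 * hbar * \<Omega> = hbar * \<Omega> / 4" and half: "1 / 2 * hbar * \<Omega> = hbar * \<Omega> / 2" by simp_all
  show ?thesis
    unfolding Dn
  proof (intro conjI zero_temperature_potential[OF \<eta>k coeffs_all] zero_temperature_kinetic[OF \<eta>k coeffs_all]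
      ground_state_basis_0, goal_cases)
    case 1
    show ?case
    proof (intro allI impI, goal_cases)
      case (1 T)
      \<comment> \<open>The amplitudes are chosen before the trajectory, as functions of the initial
        state and the coefficients at temperature T.\<close>
      show ?case
        by (rule exI[of _ "amp_const \<eta> (\<mu> T) (\<nu> T) R0"], rule exI[of _ "amp_cos \<eta> (\<mu> T) (\<nu> T) R0"],
            rule exI[of _ "amp_sin \<eta> (\<mu> T) (\<nu> T) R0"], rule allI, rule impI)
          (intro conjI qld_fixed_temperature[OF _ prod[OF 1] \<eta>k(1) R0])
    qed
  next
    case 2
    show ?case
      unfolding quarter half
    proof (rule allI, rule impI, goal_cases)
      case (1 \<rho>)
      note family = \<eta>k coeffs_all R0 1
      show ?case
        by (intro conjI quadratic_expectation_ground[OF family quadratic_observable_potential]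
            quadratic_expectation_ground[OF family quadratic_observable_kinetic]
            quadratic_expectation_ground[OF family quadratic_observable_hamiltonian]
            ground_population_tendsto[OF family])
          (use quadratic_expectation_exists[OF family _ _ quadratic_observable_hamiltonian] in blast)
    qed
  qed
qed

end
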